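(* Let $\frac{p}{q}\in\mathbb{Q}\cap[0,1]$ be given and let $\{F_{a,b}\}$ be a family of lifts in Class $\mathcal{N}$. For $j\ge1$ let $l_j=\frac{jp+p_1}{jq+q_1}$ and $r_j=\frac{jp+p_2}{jq+q_2}$, where $\frac{p_1}{q_1}$ and $\frac{p_2}{q_2}$ are the left and right parents of $\frac pq$ (for $\frac pq=\frac01$ only the $r_j$, with $\frac{p_2}{q_2}=\frac11$, and for $\frac pq=\frac11$ only the $l_j$, with $\frac{p_1}{q_1}=\frac01$, are defined and considered). Then there exists $\varepsilon_{\frac{p}{q}}>0$ such that all the tips $T_{r_j}$ of $Lock_{r_j}$ and $T_{l_j}$ of $Lock_{l_j}$, $j\ge 1$, are bounded away from the critical line by a distance at least $\varepsilon_{\frac{p}{q}}$. Furthermore, the sequences of tips $\{T^I_{l_j}\}_{j\ge1}$ and $\{T^I_{r_j}\}_{j\ge1}$ each converge, monotonically in $b$, to a point on the boundary of the $\frac{p}{q}$ locking region $Lock_{\frac pq}$ above the critical line. On the other hand, for any irrational $\omega\in(0,1)$, let $\{\frac{c_j}{d_j}\}_{j\ge1}$ be the path in the Farey tree which converges to $\omega$; then the tips $T^I_{\frac{c_j}{d_j}}$ converge to the critical line as $j\to\infty$.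
   Context: A degree-one lift is a continuous $F:\mathbb{R}\to\mathbb{R}$ with $F(x+1)=F(x)+1$ for all $x$. Its rotation set $Rot(F)$ is the set of all values $\lim_{m\to\infty}\frac{F^m(x)-x}{m}$ over those $x\in\mathbb{R}$ for which the limit exists; it is a single point or a nondegenerate closed interval. Its lower and upper monotone bounds are $F_l(x)=\inf\{F(y)\mid y\ge x\}$ and $F_u(x)=\sup\{F(y)\mid y\le x\}$. Class $\mathcal{B}$: lifts $F$ of degree-one circle maps that are $C^3$, piecewise strictly monotone, have at most two critical points (per fundamental domain $[0,1)$), both turning points when there are two, and have negative Schwarzian derivative $S(F)=\frac{F'''}{F'}-\frac32\left(\frac{F''}{F'}\right)^2$ (where defined) when they have two critical points. Class $\mathcal{N}$: two-parameter families of lifts $\{F_{a,b}\}$ (with $a\in\mathbb{R}$ and $b$ real) such that (i) each $F_{a,b}$ is in Class $\mathcal{B}$; (ii) $F_{a,b}$ and $\frac{d}{dx}F_{a,b}$ depend continuously on $(a,b)$; (iii) $a$ is a translation parameter: $F_{a,b}=F_{0,b}+a$; (iv) the Hausdorff distance $\Delta$ between (the graphs of) the upper and lower monotone bounds of $F_{a,b}$ is a nondecreasing function of $b$ such that the value $0$ can be attained and the value $1$ can be exceeded. The critical line is the horizontal line $b=\max\{b\mid\Delta=0\}$. On it $F_{a,b}$ has a unique critical point in $[0,1)$, and above it $F_{a,b}$ has two. When $F_{a,b}$ has two turning points per fundamental domain, with maximum at $C$ and minimum at $K$, the origin is chosen so that $0\le C<K<1$; with $K^-$ the closest point below $K$ with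 the same image as $K$ and $C^+$ the closest point above $C$ with the same image as $C$, one assumes $0<K^-\le C\le K\le C^+<1$ when $0\le\Delta<1$ (all four points being equal to the unique critical point on the critical line). $Lock_\omega$ is the set of $(a,b)$ with $Rot(F_{a,b})=\{\omega\}$. $Lock^I_\omega$ is the connected component of $Lock_\omega$ that contains all parameters in $Lock_\omega$ of invertible maps. A tip of $Lock_{\frac pq}$ is a point $(a_0,b_0)$, with $b_0$ on or above the critical line, such that $(a,b_0)\in Lock_{\frac pq}$ if and only if $a=a_0$. The greatest value of $b$ in $Lock^I_{\frac pq}$ is achieved at a tip, and this point is denoted $T^I_{\frac pq}$. $T_{\frac pq}$ denotes an arbitrary tip of $Lock_{\frac pq}$. Farey tree: all fractions are in lowest terms and in $[0,1]$. Fractions $\frac{p_1}{q_1},\frac{p_2}{q_2}$ are Farey neighbors if $p_1q_2-p_2q_1=\pm1$; their Farey sum is then $\frac{p_1}{q_1}\oplus\frac{p_2}{q_2}=\frac{p_1+p_2}{q_1+q_2}$. Every rational in $(0,1)$ is uniquely a Farey sum $\frac{p}{q}=\frac{p_1}{q_1}\oplus\frac{p_2}{q_2}$ with $\frac{p_1}{q_1}<\frac{p_2}{q_2}$; $\frac{p_1}{q_1}$ is its left parent and $\frac{p_2}{q_2}$ its right parent. With $l_j,r_j$ as in the claim, the first children of $\frac pq$ are $l_1$ and $r_1$ (those that are defined). The Farey tree has vertex set $\mathbb{Q}\cap[0,1]$ with one edge between every fraction and each of its first children. Vertices $\frac01,\frac11$ are at level $0$, and the vertices at level $n>0$ are the first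 children of the vertices at level $n-1$. For each irrational $\omega\in(0,1)$ there is precisely one infinite path in the tree, descending one level at each step from $\frac12$, along which the values converge to $\omega$. *)

theory Defs
  imports "HOL-Analysis.Analysis"
begin

definition degree_one_lift :: "(real \<Rightarrow> real) \<Rightarrow> bool" where
  "degree_one_lift G \<longleftrightarrow> continuous_on UNIV G \<and> (\<forall>x. G (x + 1) = G x + 1)"

definition Rot :: "(real \<Rightarrow> real) \<Rightarrow> real set" where
  "Rot G = {\<rho>. \<exists>x. (\<lambda>m. ((G ^^ m) x - x) / real m) \<longlonglongrightarrow> \<rho>}"

definition lower_bound :: "(real \<Rightarrow> real) \<Rightarrow> real \<Rightarrow> real" where
  "lower_bound G x = Inf (G ` {x..})"

definition upper_bound :: "(real \<Rightarrow> real) \<Rightarrow> real \<Rightarrow> real" where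
  "upper_bound G x = Sup (G ` {..x})"

definition hausdorff_distance :: "'a::metric_space set \<Rightarrow> 'a set \<Rightarrow> real" where
  "hausdorff_distance A B = max (SUP x\<in>A. infdist x B) (SUP y\<in>B. infdist y A)"

definition graph_of :: "(real \<Rightarrow> real) \<Rightarrow> (real \<times> real) set" where
  "graph_of G = range (\<lambda>x. (x, G x))"

text \<open>The quantity written \<open>\<Delta>\<close>; the plane carries the Euclidean metric.\<close>

definition bound_gap :: "(real \<Rightarrow> real) \<Rightarrow> real" where
  "bound_gap G = hausdorff_distance (graph_of (upper_bound G)) (graph_of (lower_bound G))"

definition C3 :: "(real \<Rightarrow> real) \<Rightarrow> bool" where
  "C3 G \<longleftrightarrow> (\<forall>k<3. \<forall>x. (deriv ^^ k) G field_differentiable at x)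
     \<and> continuous_on UNIV ((deriv ^^ 3) G)"

text \<open>\<open>S\<close> is the set of division points, so \<open>s\<close> and \<open>t\<close> below are consecutive ones.
  By periodicity it is enough to divide \<open>[0,1]\<close>.\<close>

definition piecewise_strictly_monotone :: "(real \<Rightarrow> real) \<Rightarrow> bool" where
  "piecewise_strictly_monotone G \<longleftrightarrow>
     (\<exists>S. finite S \<and> {0, 1} \<subseteq> S \<and> S \<subseteq> {0..1} \<and>
        (\<forall>s\<in>S. \<forall>t\<in>S. s < t \<and> {s<..<t} \<inter> S = {} \<longrightarrow>
           strict_mono_on {s..t} G \<or> strict_antimono_on {s..t} G))"

definition critical_points :: "(real \<Rightarrow> real) \<Rightarrow> real set" where
  "critical_points G = {x \<in> {0..<1}. deriv G x = 0}"

definition turning_max :: "(real \<Rightarrow> real) \<Rightarrow> real \<Rightarrow> bool" where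
  "turning_max G c \<longleftrightarrow>
     (\<exists>e>0. strict_mono_on {c - e..c} G \<and> strict_antimono_on {c..c + e} G)"

definition turning_min :: "(real \<Rightarrow> real) \<Rightarrow> real \<Rightarrow> bool" where
  "turning_min G c \<longleftrightarrow>
     (\<exists>e>0. strict_antimono_on {c - e..c} G \<and> strict_mono_on {c..c + e} G)"

definition schwarzian :: "(real \<Rightarrow> real) \<Rightarrow> real \<Rightarrow> real" where
  "schwarzian G x =
     (deriv ^^ 3) G x / deriv G x - 3 / 2 * ((deriv ^^ 2) G x / deriv G x)\<^sup>2"

definition class_B :: "(real \<Rightarrow> real) \<Rightarrow> bool" where
  "class_B G \<longleftrightarrow>
     degree_one_lift G \<and> C3 G \<and> piecewise_strictly_monotone G \<and>
     finite (critical_points G) \<and> card (critical_points G) \<le> 2 \<and>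
     (card (critical_points G) = 2 \<longrightarrow>
        (\<forall>c\<in>critical_points G. turning_max G c \<or> turning_min G c) \<and>
        (\<forall>x. deriv G x \<noteq> 0 \<longrightarrow> schwarzian G x < 0))"

text \<open>A family is a function \<open>F\<close> with \<open>F a b\<close> the lift of parameter \<open>(a,b)\<close>. In class N the
  gap does not depend on the translation parameter, so the critical value below may be read off
  at \<open>a = 0\<close>; the maximum exists since the gap is continuous in \<open>b\<close>, nondecreasing, 0 somewhere and
  greater than 1 somewhere.\<close>

definition critical_value :: "(real \<Rightarrow> real \<Rightarrow> real \<Rightarrow> real) \<Rightarrow> real" where
  "critical_value F = (GREATEST b. bound_gap (F 0 b) = 0)"

definition critical_line :: "(real \<Rightarrow> real \<Rightarrow> real \<Rightarrow> real) \<Rightarrow> (real \<times> real) set" where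
  "critical_line F = {(a, b). b = critical_value F}"

definition closest_below :: "(real \<Rightarrow> real) \<Rightarrow> real \<Rightarrow> real" where
  "closest_below G K = Sup {x. x < K \<and> G x = G K}"

definition closest_above :: "(real \<Rightarrow> real) \<Rightarrow> real \<Rightarrow> real" where
  "closest_above G C = Inf {x. C < x \<and> G x = G C}"

text \<open>Choice of the origin. The chain \<open>0 < K\<^sup>- \<le> C < K \<le> C\<^sup>+ < 1\<close> is imposed where the gap is
  less than 1, with the extra proviso \<open>G C - G K < 1\<close>. The proviso is necessary: since
  \<open>G\<close> has degree one, the chain is equivalent to \<open>G C - G K < 1\<close> up to a translation of the
  origin, whereas the Hausdorff distance of the graphs is still less than 1 when
  \<open>G C - G K = 1\<close>, because horizontal distances count as well. Without the proviso no family
  could have a gap that runs from 0 to beyond 1. The last line is the chain on the critical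
  line, where \<open>K\<^sup>-\<close>, \<open>C\<close>, \<open>K\<close>, \<open>C\<^sup>+\<close> all stand for the unique critical point.\<close>

definition normalized_origin :: "(real \<Rightarrow> real \<Rightarrow> real \<Rightarrow> real) \<Rightarrow> bool" where
  "normalized_origin F \<longleftrightarrow>
     (\<forall>a b C K. C \<in> {0..<1} \<and> K \<in> {0..<1} \<and> turning_max (F a b) C \<and> turning_min (F a b) K \<longrightarrow>
        C < K \<and>
        (bound_gap (F a b) < 1 \<and> F a b C - F a b K < 1 \<longrightarrow>
           0 < closest_below (F a b) K \<and> closest_below (F a b) K \<le> C \<and>
           K \<le> closest_above (F a b) C \<and> closest_above (F a b) C < 1)) \<and>
     (\<forall>a. \<forall>c\<in>critical_points (F a (critical_value F)). 0 < c)"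

text \<open>Continuous dependence on the parameters refers to the uniform topology.\<close>

definition class_N :: "(real \<Rightarrow> real \<Rightarrow> real \<Rightarrow> real) \<Rightarrow> bool" where
  "class_N F \<longleftrightarrow>
     (\<forall>a b. class_B (F a b)) \<and>
     (\<forall>a b. uniform_limit UNIV (\<lambda>(a', b'). F a' b') (F a b) (at (a, b))) \<and>
     (\<forall>a b. uniform_limit UNIV (\<lambda>(a', b'). deriv (F a' b')) (deriv (F a b)) (at (a, b))) \<and>
     (\<forall>a b x. F a b x = F 0 b x + a) \<and>
     (\<forall>a. mono (\<lambda>b. bound_gap (F a b)) \<and>
        (\<exists>b. bound_gap (F a b) = 0) \<and> (\<exists>b. bound_gap (F a b) > 1)) \<and>
     normalized_origin F"

definition Lock :: "(real \<Rightarrow> real \<Rightarrow> real \<Rightarrow> real) \<Rightarrow> real \<Rightarrow> (real \<times> real) set" where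
  "Lock F \<omega> = {(a, b). Rot (F a b) = {\<omega>}}"

definition Lock_I :: "(real \<Rightarrow> real \<Rightarrow> real \<Rightarrow> real) \<Rightarrow> real \<Rightarrow> (real \<times> real) set" where
  "Lock_I F \<omega> =
     (THE S. S \<in> components (Lock F \<omega>) \<and> {(a, b) \<in> Lock F \<omega>. bij (F a b)} \<subseteq> S)"

definition is_tip :: "(real \<Rightarrow> real \<Rightarrow> real \<Rightarrow> real) \<Rightarrow> real \<Rightarrow> real \<times> real \<Rightarrow> bool" where
  "is_tip F \<omega> T \<longleftrightarrow>
     critical_value F \<le> snd T \<and> (\<forall>a. (a, snd T) \<in> Lock F \<omega> \<longleftrightarrow> a = fst T)"

definition tip_I :: "(real \<Rightarrow> real \<Rightarrow> real \<Rightarrow> real) \<Rightarrow> real \<Rightarrow> real \<times> real" where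
  "tip_I F \<omega> =
     (THE T. is_tip F \<omega> T \<and> T \<in> Lock_I F \<omega> \<and> (\<forall>z\<in>Lock_I F \<omega>. snd z \<le> snd T))"

definition num :: "rat \<Rightarrow> int" where "num r = fst (quotient_of r)"

definition den :: "rat \<Rightarrow> int" where "den r = snd (quotient_of r)"

definition farey_neighbors :: "rat \<Rightarrow> rat \<Rightarrow> bool" where
  "farey_neighbors r s \<longleftrightarrow> \<bar>num r * den s - num s * den r\<bar> = 1"

definition farey_sum :: "rat \<Rightarrow> rat \<Rightarrow> rat" where
  "farey_sum r s = Fract (num r + num s) (den r + den s)"

definition farey_parents :: "rat \<Rightarrow> rat \<Rightarrow> rat \<Rightarrow> bool" where
  "farey_parents r s t \<longleftrightarrow>
     0 \<le> s \<and> s < t \<and> t \<le> 1 \<and> farey_neighbors s t \<and> r = farey_sum s t"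

text \<open>Meaningful for \<open>r \<in> (0,1]\<close> and \<open>r \<in> [0,1)\<close>, respectively.\<close>

definition left_parent :: "rat \<Rightarrow> rat" where
  "left_parent r = (if r = 1 then 0 else THE s. \<exists>t. farey_parents r s t)"

definition right_parent :: "rat \<Rightarrow> rat" where
  "right_parent r = (if r = 0 then 1 else THE t. \<exists>s. farey_parents r s t)"

definition left_fraction :: "rat \<Rightarrow> nat \<Rightarrow> rat" where
  "left_fraction r j =
     Fract (int j * num r + num (left_parent r)) (int j * den r + den (left_parent r))"

definition right_fraction :: "rat \<Rightarrow> nat \<Rightarrow> rat" where
  "right_fraction r j =
     Fract (int j * num r + num (right_parent r)) (int j * den r + den (right_parent r))"

definition first_children :: "rat \<Rightarrow> rat set" where
  "first_children r =
     {s. 0 < r \<and> s = left_fraction r 1 \<or> r < 1 \<and> s = right_fraction r 1}"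

text \<open>Going down one level along an edge of the tree means passing to a first child. The path is
  indexed from 0.\<close>

definition farey_path :: "(nat \<Rightarrow> rat) \<Rightarrow> real \<Rightarrow> bool" where
  "farey_path c \<omega> \<longleftrightarrow>
     c 0 = 1 / 2 \<and> (\<forall>j. c (Suc j) \<in> first_children (c j)) \<and>
     (\<lambda>j. real_of_rat (c j)) \<longlonglongrightarrow> \<omega>"

end

theory Submission
  imports Defs
begin

text \<open>For a fixed \<open>b\<close> the parameters \<open>a\<close> locked at \<open>p/q\<close> form the interval from \<open>\<alpha>\<close> to \<open>\<beta>\<close>, where
  \<open>\<alpha>\<close> is the least \<open>a\<close> for which some point satisfies \<open>G\<^sup>q x \<ge> x + p\<close> with \<open>G\<close> the lower
  bound, and \<open>\<beta>\<close> the greatest one with \<open>G\<^sup>q x \<le> x + p\<close> for the upper bound; both ends are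
  continuous in \<open>b\<close>, and a tip is a point where they meet.

  Above the critical line the minimum principle for maps with negative Schwarzian derivative shows
  that at \<open>a = \<beta>\<close> there is a \<open>p/q\<close>-periodic orbit outside the arcs from \<open>K\<^sup>-\<close> to
  \<open>C\<^sup>+\<close>. Decreasing or increasing \<open>a\<close> until \<open>K\<^sup>-\<close> or \<open>C\<^sup>+\<close> itself becomes periodic turns such an
  orbit into one for either Farey parent, so locking of a child at a height \<open>b\<close> forces locking of
  its parents at that height, and the heights of the tips decrease along the sequences. At a tip
  \<open>K\<^sup>-\<close> and \<open>C\<^sup>+\<close> are neighbours on one periodic orbit, hence \<open>F\<^sup>q K\<^sup>- = C\<^sup>+ + p\<close> when \<open>p/q\<close> is the
  left parent. Near the critical line this is impossible, because \<open>K\<^sup>-\<close> and \<open>C\<^sup>+\<close> merge while the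
  flatness of \<open>F\<close> keeps the displacement of \<open>C\<^sup>+\<close> under \<open>F\<^sup>q - p\<close> away from 0. Finally, Denjoy's
  distortion argument, applied to the gaps of the periodic orbits, bounds the number of closest
  returns of any fraction locked at a given height above the critical line, whereas this number is
  unbounded along fractions converging to an irrational.\<close>

subsection \<open>Degree-one lifts and their monotone bounds\<close>

text \<open>The rotation set is defined through orbits of the map itself, whereas only monotone
  lifts have a rigid orbit order. Every question is therefore moved to the two monotone bounds,
  whose periodic orbits become lists indexed by the integers with the map acting as an index shift;
  Farey relations turn into identities between indices. What the bounds alone do not decide is
  whether their periodic orbits belong to the map: an orbit of the upper bound may enter the
  interval from \<open>K\<^sup>-\<close> to \<open>C\<close>, where the two bounds differ. Excluding
  this is the task of the negative Schwarzian derivative. As \<open>a\<close> acts by translation,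
  only the maps with \<open>a = 0\<close> are studied, as a family in \<open>b\<close>. The
  reflection x -> -x exchanges the two bounds, the ends \<alpha> and \<beta>, and left with right
  parents, so one-sided statements are proved for one side only. A gap greater than 1 enters through
  one consequence: at such a height the bounds agree nowhere, no rational is locked, and the tip
  heights are finite. The flatness near the critical line comes from the zero of the derivative at
  \<open>C\<close>, since \<open>C\<^sup>+\<close> is then close to \<open>C\<close>.\<close>

lemma lift_cont: "degree_one_lift G \<Longrightarrow> continuous_on S G"
  unfolding degree_one_lift_def using continuous_on_subset by blast

lemma lift_isCont: "degree_one_lift G \<Longrightarrow> isCont G x"
  unfolding degree_one_lift_def using continuous_on_eq_continuous_at by auto

lemma lift_add_int:
  assumes "degree_one_lift G"
  shows "G (x + of_int k) = G x + of_int k"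
proof -
  have one: "G (x + 1) = G x + 1" for x
    using assms by (simp add: degree_one_lift_def)
  have nat: "G (x + real n) = G x + real n" for x n
  proof (induction n)
    case (Suc n)
    then show ?case using one[of "x + real n"] by (simp add: algebra_simps)
  qed simp
  show ?thesis
  proof (cases "k \<ge> 0")
    case True
    then show ?thesis using nat[of x "nat k"] by simp
  next
    case False
    then show ?thesis using nat[of "x + of_int k" "nat (- k)"] by simp
  qed
qed

lemma lift_deriv_add_int:
  assumes "degree_one_lift f" "\<And>x. (f has_real_derivative f' x) (at x)"
  shows "f' (x + of_int k) = f' x"
proof -
  have "((\<lambda>x. f (x + of_int k)) has_real_derivative f' (x + of_int k)) (at x)"
    using assms(2)[of "x + of_int k"] by (simp add: DERIV_shift)
  moreover have "((\<lambda>x. f (x + of_int k)) has_real_derivative f' x) (at x)"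
    unfolding lift_add_int[OF assms(1)] using assms(2)[of x] by (auto intro!: derivative_eq_intros)
  ultimately show ?thesis by (rule DERIV_unique)
qed

lemma degree_one_lift_comp:
  "degree_one_lift G \<Longrightarrow> degree_one_lift H \<Longrightarrow> degree_one_lift (G \<circ> H)"
  unfolding degree_one_lift_def
  by (auto intro: continuous_on_compose2[of UNIV G UNIV H] simp: comp_def)

lemma degree_one_lift_funpow: "degree_one_lift G \<Longrightarrow> degree_one_lift (G ^^ n)"
proof (induction n)
  case 0
  then show ?case by (simp add: degree_one_lift_def continuous_on_id id_def)
next
  case (Suc n)
  then show ?case using degree_one_lift_comp[of G "G ^^ n"] by (simp add: comp_def)
qed

lemma degree_one_lift_translate: "degree_one_lift G \<Longrightarrow> degree_one_lift (\<lambda>x. G x + a)"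
  unfolding degree_one_lift_def by (auto intro!: continuous_intros)

lemma lift_reduce:
  obtains k :: int where "c \<le> x + of_int k" "x + of_int k < c + (1::real)"
proof -
  let ?k = "- \<lfloor>x - c\<rfloor>"
  have "c \<le> x + of_int ?k" "x + of_int ?k < c + 1"
    using floor_correct[of "x - c"] by (simp_all, linarith+)
  then show ?thesis using that by blast
qed

lemma lift_displacement_bounded:
  assumes "degree_one_lift G"
  obtains B where "\<And>x. \<bar>G x - x\<bar> \<le> B"
proof -
  have "continuous_on {0..1} (\<lambda>x. G x - x)"
    using lift_cont[OF assms] by (intro continuous_intros)
  then have "compact ((\<lambda>x. G x - x) ` {0..1})"
    by (intro compact_continuous_image) auto
  then have "bounded ((\<lambda>x. G x - x) ` {0..1})" by (rule compact_imp_bounded)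
  then obtain B where B: "\<And>x. x \<in> {0..1} \<Longrightarrow> \<bar>G x - x\<bar> \<le> B"
    unfolding bounded_iff by force
  have "\<bar>G x - x\<bar> \<le> B" for x
  proof -
    obtain k :: int where k: "0 \<le> x + of_int k" "x + of_int k < 0 + 1"
      using lift_reduce by blast
    show ?thesis using B[of "x + of_int k"] k by (simp add: lift_add_int[OF assms])
  qed
  then show ?thesis using that by blast
qed

text \<open>Conjugation by the reflection x -> -x. It exchanges the monotone bounds, maxima with
  minima and left with right, and negates rotation numbers.\<close>

definition refl_map :: "(real \<Rightarrow> real) \<Rightarrow> real \<Rightarrow> real" where
  "refl_map G x = - G (- x)"

lemma refl_map_refl_map [simp]: "refl_map (refl_map G) = G"
  by (simp add: refl_map_def fun_eq_iff)

lemma degree_one_lift_refl_map: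
  assumes "degree_one_lift G"
  shows "degree_one_lift (refl_map G)"
proof -
  have "G (- x - 1) = G (- x) - 1" for x
    using lift_add_int[OF assms, of "- x" "- 1"] by simp
  then show ?thesis
    unfolding degree_one_lift_def refl_map_def
    by (auto intro!: continuous_intros continuous_on_compose2[of UNIV G UNIV uminus]
        lift_cont[OF assms])
qed

lemma mono_refl_map: "mono G \<Longrightarrow> mono (refl_map G)"
  by (simp add: mono_def refl_map_def)

lemma funpow_refl_map: "(refl_map G ^^ n) x = - (G ^^ n) (- x)"
  by (induction n) (simp_all add: refl_map_def)

section \<open>The upper and lower monotone bounds of a lift\<close>

lemma upper_bound_bdd:
  assumes "degree_one_lift f"
  shows "bdd_above (f ` {..x})"
proof -
  obtain B where B: "\<And>x. \<bar>f x - x\<bar> \<le> B" using lift_displacement_bounded[OF assms] by blast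
  show ?thesis
  proof (rule bdd_aboveI2)
    fix y assume "y \<in> {..x}"
    then show "f y \<le> x + B" using B[of y] by simp
  qed
qed

lemma upper_bound_ge: "degree_one_lift f \<Longrightarrow> y \<le> x \<Longrightarrow> f y \<le> upper_bound f x"
  unfolding upper_bound_def by (intro cSUP_upper upper_bound_bdd) auto

lemma upper_bound_leI: "(\<And>y. y \<le> x \<Longrightarrow> f y \<le> c) \<Longrightarrow> upper_bound f x \<le> c"
  unfolding upper_bound_def by (intro cSUP_least) auto

text \<open>Moving a point up by a positive integer raises its value by that integer, so the
  supremum over the half-line is already the maximum over its last period, which is compact.\<close>

lemma upper_bound_attained:
  assumes "degree_one_lift f"
  obtains y where "x - 1 \<le> y" "y \<le> x" "f y = upper_bound f x"
proof -
  have "\<exists>y\<in>{x-1..x}. \<forall>z\<in>{x-1..x}. f z \<le> f y"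
    by (rule continuous_attains_sup) (auto intro: lift_cont[OF assms])
  then obtain y where y: "y \<in> {x-1..x}" "\<And>z. z \<in> {x-1..x} \<Longrightarrow> f z \<le> f y" by blast
  have "f z \<le> f y" if "z \<le> x" for z
  proof -
    obtain k :: int where k: "x - 1 \<le> z + of_int k" "z + of_int k < x - 1 + 1"
      using lift_reduce by blast
    show ?thesis
    proof (cases "k \<ge> 0")
      case True
      have "f (z + of_int k) \<le> f y" using y(2) k by auto
      then show ?thesis using True by (simp add: lift_add_int[OF assms])
    next
      case False
      then have "of_int k \<le> (-1::real)" by linarith
      then have "z = x" using k that by linarith
      then show ?thesis using y(2)[of x] by simp
    qed
  qed
  then have "upper_bound f x \<le> f y" by (rule upper_bound_leI)
  moreover have "f y \<le> upper_bound f x" using y by (intro upper_bound_ge assms) auto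
  ultimately show ?thesis using that[of y] y by auto
qed

lemma mono_upper_bound: "degree_one_lift f \<Longrightarrow> mono (upper_bound f)"
  by (intro monoI upper_bound_leI upper_bound_ge) auto

lemma upper_bound_add_one:
  assumes "degree_one_lift f"
  shows "upper_bound f (x + 1) = upper_bound f x + 1"
proof (rule antisym)
  have shift: "f (y + 1) = f y + 1" for y using assms by (simp add: degree_one_lift_def)
  show "upper_bound f (x + 1) \<le> upper_bound f x + 1"
  proof (rule upper_bound_leI)
    fix y assume "y \<le> x + 1"
    then show "f y \<le> upper_bound f x + 1"
      using upper_bound_ge[OF assms, of "y - 1" x] shift[of "y - 1"] by simp
  qed
  have "upper_bound f x \<le> upper_bound f (x + 1) - 1"
  proof (rule upper_bound_leI)
    fix y assume "y \<le> x"
    then show "f y \<le> upper_bound f (x + 1) - 1"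
      using upper_bound_ge[OF assms, of "y + 1" "x + 1"] shift[of y] by simp
  qed
  then show "upper_bound f x + 1 \<le> upper_bound f (x + 1)" by simp
qed

text \<open>The bound can rise between two nearby points only if its value at the right one is
  attained by \<open>f\<close> between them, where \<open>f\<close> itself varies little.\<close>

lemma isCont_upper_bound:
  assumes "degree_one_lift f"
  shows "isCont (upper_bound f) x"
  unfolding isCont_def LIM_def
proof (intro allI impI)
  fix e :: real assume "e > 0"
  then obtain d where d: "d > 0" "\<And>y. \<bar>y - x\<bar> < d \<Longrightarrow> \<bar>f y - f x\<bar> < e / 3"
    using lift_isCont[OF assms, of x, unfolded isCont_def LIM_def, rule_format, of "e/3"]
    by (force simp: dist_real_def)
  show "\<exists>s>0. \<forall>y. y \<noteq> x \<and> dist y x < s \<longrightarrow> dist (upper_bound f y) (upper_bound f x) < e"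
  proof (intro exI conjI allI impI)
    fix y assume y: "y \<noteq> x \<and> dist y x < d"
    let ?u = "min x y" and ?v = "max x y"
    obtain z where z: "z \<le> ?v" "f z = upper_bound f ?v"
      using upper_bound_attained[OF assms] by metis
    have "upper_bound f ?v \<le> upper_bound f ?u + 2 * e / 3"
    proof (cases "z \<le> ?u")
      case True
      then show ?thesis using upper_bound_ge[OF assms True] z \<open>e > 0\<close> by simp
    next
      case False
      then have "\<bar>z - x\<bar> < d" "\<bar>?u - x\<bar> < d" using y z by (auto simp: dist_real_def min_def max_def split: if_splits)
      then have "\<bar>f z - f ?u\<bar> < 2 * e / 3" using d(2)[of z] d(2)[of ?u] by linarith
      then show ?thesis using upper_bound_ge[OF assms, of ?u ?u] z by linarith
    qed
    moreover have "upper_bound f ?u \<le> upper_bound f ?v"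
      using mono_upper_bound[OF assms] by (auto simp: mono_def)
    ultimately have "\<bar>upper_bound f ?v - upper_bound f ?u\<bar> < e" using \<open>e > 0\<close> by linarith
    then show "dist (upper_bound f y) (upper_bound f x) < e"
      by (auto simp: dist_real_def min_def max_def split: if_splits)
  qed (use d in auto)
qed

lemma degree_one_lift_upper_bound:
  "degree_one_lift f \<Longrightarrow> degree_one_lift (upper_bound f)"
  by (simp add: degree_one_lift_def[of "upper_bound f"] upper_bound_add_one
      isCont_upper_bound continuous_at_imp_continuous_on)

lemma upper_bound_dist:
  assumes "degree_one_lift f" "degree_one_lift g" "\<And>x. \<bar>f x - g x\<bar> \<le> d"
  shows "\<bar>upper_bound f x - upper_bound g x\<bar> \<le> d"
proof -
  have "upper_bound f x \<le> upper_bound g x + d"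
  proof (rule upper_bound_leI)
    fix y assume "y \<le> x"
    then show "f y \<le> upper_bound g x + d"
      using upper_bound_ge[OF assms(2), of y x] assms(3)[of y] by linarith
  qed
  moreover have "upper_bound g x \<le> upper_bound f x + d"
  proof (rule upper_bound_leI)
    fix y assume "y \<le> x"
    then show "g y \<le> upper_bound f x + d"
      using upper_bound_ge[OF assms(1), of y x] assms(3)[of y] by linarith
  qed
  ultimately show ?thesis by linarith
qed

lemma upper_bound_translate: 
  assumes "degree_one_lift f"
  shows "upper_bound (\<lambda>x. f x + a) x = upper_bound f x + a"
proof (rule antisym)
  show "upper_bound (\<lambda>x. f x + a) x \<le> upper_bound f x + a"
    by (rule upper_bound_leI) (use upper_bound_ge[OF assms] in auto)
  have "upper_bound f x \<le> upper_bound (\<lambda>x. f x + a) x - a"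
    by (rule upper_bound_leI)
      (use upper_bound_ge[OF degree_one_lift_translate[OF assms], of _ x a] in \<open>simp add: le_diff_eq\<close>)
  then show "upper_bound f x + a \<le> upper_bound (\<lambda>x. f x + a) x" by simp
qed

lemma upper_bound_mono_eq:
  assumes "degree_one_lift f" "mono f"
  shows "upper_bound f = f"
proof (rule ext, rule antisym)
  fix x
  show "upper_bound f x \<le> f x" by (rule upper_bound_leI) (use assms(2) in \<open>auto simp: mono_def\<close>)
  show "f x \<le> upper_bound f x" by (rule upper_bound_ge[OF assms(1)]) simp
qed

lemma lower_bound_refl: "lower_bound f = refl_map (upper_bound (refl_map f))"
proof
  fix x
  have "uminus ` f ` {x..} = refl_map f ` {..- x}"
    unfolding refl_map_def image_image
    by (auto simp: image_iff) (metis atMost_iff neg_le_iff_le minus_minus)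
  then show "lower_bound f x = refl_map (upper_bound (refl_map f)) x"
    by (simp add: lower_bound_def upper_bound_def refl_map_def Inf_real_def)
qed

lemma upper_bound_refl: "upper_bound f = refl_map (lower_bound (refl_map f))"
  by (simp add: lower_bound_refl)

lemma degree_one_lift_lower_bound:
  "degree_one_lift f \<Longrightarrow> degree_one_lift (lower_bound f)"
  by (simp add: lower_bound_refl degree_one_lift_refl_map degree_one_lift_upper_bound)

lemma mono_lower_bound: "degree_one_lift f \<Longrightarrow> mono (lower_bound f)"
  by (simp add: lower_bound_refl mono_refl_map mono_upper_bound degree_one_lift_refl_map)

lemma lower_bound_le: "degree_one_lift f \<Longrightarrow> x \<le> y \<Longrightarrow> lower_bound f x \<le> f y"
  using upper_bound_ge[OF degree_one_lift_refl_map, of f "- y" "- x"]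
  by (simp add: lower_bound_refl refl_map_def)

lemma lower_bound_attained:
  assumes "degree_one_lift f"
  obtains y where "x \<le> y" "y \<le> x + 1" "f y = lower_bound f x"
proof -
  obtain y where y: "- x - 1 \<le> y" "y \<le> - x" "refl_map f y = upper_bound (refl_map f) (- x)"
    using upper_bound_attained[OF degree_one_lift_refl_map[OF assms]] by blast
  have "f (- y) = lower_bound f x" using y(3) by (simp add: lower_bound_refl refl_map_def)
  then show ?thesis using that[of "- y"] y by auto
qed

lemma lower_bound_dist:
  assumes "degree_one_lift f" "degree_one_lift g" "\<And>x. \<bar>f x - g x\<bar> \<le> d"
  shows "\<bar>lower_bound f x - lower_bound g x\<bar> \<le> d"
proof -
  have "\<bar>refl_map f x - refl_map g x\<bar> \<le> d" for x
    using assms(3)[of "- x"] by (simp add: refl_map_def)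
  then show ?thesis
    using upper_bound_dist[OF assms(1,2)[THEN degree_one_lift_refl_map], of d "- x"]
    by (simp add: lower_bound_refl refl_map_def)
qed

lemma lower_bound_translate:
  assumes "degree_one_lift f"
  shows "lower_bound (\<lambda>x. f x + a) x = lower_bound f x + a"
proof -
  have "refl_map (\<lambda>x. f x + a) = (\<lambda>x. refl_map f x + - a)"
    by (simp add: refl_map_def fun_eq_iff)
  then show ?thesis
    using upper_bound_translate[OF degree_one_lift_refl_map[OF assms], of "- a" "- x"]
    by (simp add: lower_bound_refl refl_map_def)
qed

lemma lower_bound_mono_eq: "degree_one_lift f \<Longrightarrow> mono f \<Longrightarrow> lower_bound f = f"
  using upper_bound_mono_eq[of "refl_map f"]
  by (simp add: lower_bound_refl mono_refl_map degree_one_lift_refl_map)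

lemma lower_le_upper: "degree_one_lift f \<Longrightarrow> lower_bound f x \<le> upper_bound f x"
  using lower_bound_le[of f x x] upper_bound_ge[of f x x] by simp

subsection \<open>Monotone lifts and periodic orbits\<close>

lemma mono_iter_le:
  assumes "degree_one_lift G" "mono G" "(G ^^ n) w \<le> w + of_int c"
  shows "(G ^^ (m * n)) w \<le> w + real m * of_int c"
proof (induction m)
  case (Suc m)
  have "(G ^^ (Suc m * n)) w = (G ^^ n) ((G ^^ (m * n)) w)"
    by (simp add: funpow_add)
  also have "\<dots> \<le> (G ^^ n) (w + of_int (int m * c))"
    using Suc mono_pow[OF assms(2), of n] by (simp add: mono_def)
  also have "\<dots> = (G ^^ n) w + of_int (int m * c)"
    by (rule lift_add_int[OF degree_one_lift_funpow[OF assms(1)]])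
  finally show ?case using assms(3) by (simp add: algebra_simps)
qed simp

lemma mono_iter_ge:
  assumes "degree_one_lift G" "mono G" "(G ^^ n) w \<ge> w + of_int c"
  shows "(G ^^ (m * n)) w \<ge> w + real m * of_int c"
  using mono_iter_le[of "refl_map G" n "- w" "- c" m] assms
  by (simp add: funpow_refl_map degree_one_lift_refl_map mono_refl_map)

lemma periodic_iter:
  assumes "degree_one_lift G" "(G ^^ Q) w = w + of_int P"
  shows "(G ^^ (m * Q)) w = w + of_int (int m * P)"
proof (induction m)
  case (Suc m)
  have "(G ^^ (Suc m * Q)) w = (G ^^ Q) ((G ^^ (m * Q)) w)"
    by (simp add: funpow_add)
  then show ?case
    using Suc assms(2) lift_add_int[OF degree_one_lift_funpow[OF assms(1)], of Q w "int m * P"]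
    by (simp add: algebra_simps)
qed simp

text \<open>Iterating the inequality \<open>Q\<close> times and comparing with the exact
  displacement \<open>n P\<close> of the periodic point gives the weak inequality. Equality would
  mean that a strict drop under \<open>G ^^ n\<close> is made up later, which monotonicity
  forbids.\<close>

lemma periodic_less:
  assumes G: "degree_one_lift G" "mono G" and per: "(G ^^ Q) w = w + of_int P" and "Q > 0"
    and less: "(G ^^ n) w + of_int k < w"
  shows "int n * P + k * int Q < 0"
proof -
  have le: "(G ^^ n) w \<le> w + of_int (- k)" using less by simp
  obtain Q' where Q': "Q = Suc Q'" using \<open>Q > 0\<close> by (cases Q) auto
  have "(G ^^ (Q * n)) w = (G ^^ (Q' * n)) ((G ^^ n) w)"
    by (simp add: Q' funpow_add funpow_swap1 add.commute[of n] del: funpow.simps)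
  also have "\<dots> \<le> (G ^^ (Q' * n)) (w + of_int (- k))"
    using le mono_pow[OF G(2)] by (simp add: mono_def)
  also have "\<dots> = (G ^^ (Q' * n)) w + of_int (- k)"
    by (rule lift_add_int[OF degree_one_lift_funpow[OF G(1)]])
  finally have 1: "(G ^^ (Q * n)) w \<le> (G ^^ (Q' * n)) w + of_int (- k)" .
  have 2: "(G ^^ (Q' * n)) w \<le> w + real Q' * of_int (- k)"
    by (rule mono_iter_le[OF G le])
  have "(G ^^ (Q * n)) w = w + of_int (int n * P)"
    using periodic_iter[OF G(1) per, of n] by (simp add: mult.commute)
  then have "of_int (int n * P) \<le> real Q * of_int (- k)"
    using 1 2 Q' by (simp add: algebra_simps)
  then have le0: "of_int (int n * P + k * int Q) \<le> (0::real)" by (simp add: algebra_simps)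
  have "int n * P + k * int Q \<noteq> 0"
  proof
    assume eq: "int n * P + k * int Q = 0"
    show False
    proof (cases "Q' = 0")
      case True
      then have "k = - (int n * P)" using eq Q' by simp
      then show ?thesis using less periodic_iter[OF G(1) per, of n] Q' True by simp
    next
      case False
      \<comment> \<open>The strict drop is applied at the end of the chain, because a merely
        monotone map need not preserve strict inequalities.\<close>
      have "(G ^^ (Q * n)) w = (G ^^ n) ((G ^^ (Q' * n)) w)"
        by (simp add: Q' funpow_add)
      also have "\<dots> \<le> (G ^^ n) (w + of_int (int Q' * (- k)))"
        using 2 mono_pow[OF G(2)] by (simp add: mono_def)
      also have "\<dots> = (G ^^ n) w + of_int (int Q' * (- k))"
        by (rule lift_add_int[OF degree_one_lift_funpow[OF G(1)]])
      also have "\<dots> < w - of_int k + of_int (int Q' * (- k))" using less by simp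
      also have "\<dots> = w + of_int (int n * P)"
      proof -
        have "int n * P = - k - k * int Q'" using eq Q' by (simp add: algebra_simps)
        then have "real_of_int (int n * P) = of_int (- k - k * int Q')" by (simp only:)
        then show ?thesis by (simp add: algebra_simps)
      qed
      finally show False
        using periodic_iter[OF G(1) per, of n] by (simp add: mult.commute)
    qed
  qed
  then show ?thesis using le0 by linarith
qed

lemma periodic_greater:
  assumes "degree_one_lift G" "mono G" "(G ^^ Q) w = w + of_int P" "Q > 0"
    "(G ^^ n) w + of_int k > w"
  shows "int n * P + k * int Q > 0"
  using periodic_less[of "refl_map G" Q "- w" "- P" n "- k"] assms
  by (simp add: funpow_refl_map degree_one_lift_refl_map mono_refl_map)

lemma periodic_eq:
  assumes "degree_one_lift G" "(G ^^ Q) w = w + of_int P" "(G ^^ n) w + of_int k = w"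
  shows "int n * P + k * int Q = 0"
proof -
  have "(G ^^ n) w = w + of_int (- k)" using assms(3) by simp
  then have "(G ^^ (Q * n)) w = w + of_int (int Q * (- k))"
    by (rule periodic_iter[OF assms(1)])
  moreover have "(G ^^ (n * Q)) w = w + of_int (int n * P)"
    by (rule periodic_iter[OF assms(1,2)])
  ultimately have "(of_int (int n * P + k * int Q) :: real) = 0"
    by (simp add: mult.commute algebra_simps)
  then show ?thesis by linarith
qed

lemma orbit_shift:
  assumes G: "degree_one_lift G" and per: "(G ^^ Q) x = x + of_int P"
  shows "(G ^^ Q) ((G ^^ n) x) = (G ^^ n) x + of_int P"
proof -
  have "(G ^^ Q) ((G ^^ n) x) = (G ^^ n) ((G ^^ Q) x)"
    by (metis add.commute comp_apply funpow_add)
  then show ?thesis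
    using per lift_add_int[OF degree_one_lift_funpow[OF G]] by simp
qed

text \<open>The integer \<open>n P + k Q\<close> thus serves as the address of the orbit point
  \<open>(G ^^ n) x + k\<close>: the order of a lifted periodic orbit depends on \<open>P\<close>
  and \<open>Q\<close> only.\<close>

lemma orbit_order:
  assumes G: "degree_one_lift G" "mono G" and per: "(G ^^ Q) x = x + of_int P" and "Q > 0"
  shows "(G ^^ n) x + of_int k < (G ^^ n') x + of_int k' \<longleftrightarrow> int n * P + k * int Q < int n' * P + k' * int Q"
    and "(G ^^ n) x + of_int k = (G ^^ n') x + of_int k' \<longleftrightarrow> int n * P + k * int Q = int n' * P + k' * int Q"
proof -
  have less: "int n * P + k * int Q < int n' * P + k' * int Q"
    if "(G ^^ n) x + of_int k < (G ^^ n') x + of_int k'" for n n' k k'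
  proof (cases "n' \<le> n")
    case True
    let ?w = "(G ^^ n') x"
    have "(G ^^ (n - n')) ?w = (G ^^ n) x"
      by (metis True comp_apply funpow_add le_add_diff_inverse2)
    then have "(G ^^ (n - n')) ?w + of_int (k - k') < ?w" using that by simp
    from periodic_less[OF G orbit_shift[OF G(1) per] \<open>Q > 0\<close> this]
    show ?thesis using True by (simp add: algebra_simps of_nat_diff)
  next
    case False
    let ?w = "(G ^^ n) x"
    have "(G ^^ (n' - n)) ?w = (G ^^ n') x"
      by (metis False comp_apply funpow_add le_add_diff_inverse2 nat_le_linear)
    then have "(G ^^ (n' - n)) ?w + of_int (k' - k) > ?w" using that by simp
    from periodic_greater[OF G orbit_shift[OF G(1) per] \<open>Q > 0\<close> this]
    show ?thesis using False by (simp add: algebra_simps of_nat_diff)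
  qed
  have eq: "int n * P + k * int Q = int n' * P + k' * int Q"
    if "(G ^^ n) x + of_int k = (G ^^ n') x + of_int k'" for n n' k k'
  proof (cases "n' \<le> n")
    case True
    let ?w = "(G ^^ n') x"
    have "(G ^^ (n - n')) ?w = (G ^^ n) x"
      by (metis True comp_apply funpow_add le_add_diff_inverse2)
    then have "(G ^^ (n - n')) ?w + of_int (k - k') = ?w" using that by simp
    from periodic_eq[OF G(1) orbit_shift[OF G(1) per] this]
    show ?thesis using True by (simp add: algebra_simps of_nat_diff)
  next
    case False
    let ?w = "(G ^^ n) x"
    have "(G ^^ (n' - n)) ?w = (G ^^ n') x"
      by (metis False comp_apply funpow_add le_add_diff_inverse2 nat_le_linear)
    then have "(G ^^ (n' - n)) ?w + of_int (k' - k) = ?w" using that by simp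
    from periodic_eq[OF G(1) orbit_shift[OF G(1) per] this]
    show ?thesis using False by (simp add: algebra_simps of_nat_diff)
  qed
  show "(G ^^ n) x + of_int k < (G ^^ n') x + of_int k' \<longleftrightarrow> int n * P + k * int Q < int n' * P + k' * int Q"
    using less[of n k n' k'] less[of n' k' n k] eq[of n k n' k'] by linarith
  show "(G ^^ n) x + of_int k = (G ^^ n') x + of_int k' \<longleftrightarrow> int n * P + k * int Q = int n' * P + k' * int Q"
    using less[of n k n' k'] less[of n' k' n k] eq[of n k n' k'] by linarith
qed

text \<open>A lifted periodic orbit listed in increasing order. The dynamics is then a shift of
  indices, so that returns and Farey relations become integer arithmetic.\<close>

definition orbit_enum :: "(real \<Rightarrow> real) \<Rightarrow> int \<Rightarrow> nat \<Rightarrow> (int \<Rightarrow> real) \<Rightarrow> bool" where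
  "orbit_enum G P Q X \<longleftrightarrow>
     strict_mono X \<and> (\<forall>i. X (i + int Q) = X i + 1) \<and> (\<forall>i. G (X i) = X (i + P))"

lemma orbit_enum_exists:
  assumes G: "degree_one_lift G" "mono G" and per: "(G ^^ Q) x = x + of_int P" and "Q > 0"
    and cop: "coprime P (int Q)"
  obtains X where "orbit_enum G P Q X" "X 0 = x"
proof -
  obtain u v where uv: "u * P + v * int Q = 1"
    using bezout_int[of P "int Q"] cop by (auto simp: coprime_iff_gcd_eq_1)
  \<comment> \<open>\<open>u\<close> inverts \<open>P\<close> modulo \<open>Q\<close>; hence
    \<open>N i\<close> iterations lead to an address congruent to \<open>i\<close> modulo
    \<open>Q\<close>, and \<open>K i\<close> is the integer translation still missing.\<close>
  define N where "N i = nat ((i * u) mod int Q)" for i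
  define K where "K i = (i - int (N i) * P) div int Q" for i
  define X where "X i = (G ^^ N i) x + of_int (K i)" for i
  have N: "int (N i) = (i * u) mod int Q" for i
    using \<open>Q > 0\<close> by (simp add: N_def)
  have NK: "int (N i) * P + K i * int Q = i" for i
  proof -
    have "int Q dvd i - int (N i) * P"
    proof -
      have "i - int (N i) * P = i * (u * P + v * int Q) - ((i * u) mod int Q) * P"
        by (simp add: uv N)
      also have "\<dots> = ((i * u) - (i * u) mod int Q) * P + i * v * int Q"
        by (simp add: algebra_simps)
      also have "\<dots> = ((i * u) div int Q * int Q) * P + i * v * int Q"
        by (simp add: minus_mod_eq_div_mult)
      finally show ?thesis by simp
    qed
    then show ?thesis by (simp add: K_def)
  qed
  note ord = orbit_order[OF G per \<open>Q > 0\<close>]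
  have X: "X i = (G ^^ n) x + of_int k" if "int n * P + k * int Q = i" for i n k
    unfolding X_def using ord(2)[of "N i" "K i" n k] NK[of i] that by simp
  have "strict_mono X"
  proof (rule strict_monoI)
    fix i j :: int assume "i < j"
    then show "X i < X j" unfolding X_def using ord(1)[of "N i" "K i" "N j" "K j"] NK by simp
  qed
  moreover have "X (i + int Q) = X i + 1" for i
    using X[of "N i" "K i + 1" "i + int Q"] NK[of i] by (simp add: algebra_simps X_def)
  moreover have "G (X i) = X (i + P)" for i
  proof -
    have "X (i + P) = (G ^^ Suc (N i)) x + of_int (K i)"
      by (rule X) (use NK[of i] in \<open>simp add: algebra_simps\<close>)
    then show ?thesis unfolding X_def[of i] lift_add_int[OF G(1)] by simp
  qed
  moreover have "X 0 = x" using X[of 0 0 0] by simp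
  ultimately show ?thesis using that[of X] unfolding orbit_enum_def by blast
qed

lemma orbit_enum_add:
  assumes "orbit_enum G P Q X"
  shows "X (i + k * int Q) = X i + of_int k"
proof -
  have one: "X (i + int Q) = X i + 1" for i using assms by (simp add: orbit_enum_def)
  have nat: "X (i + int n * int Q) = X i + real n" for i n
  proof (induction n)
    case (Suc n)
    then show ?case using one[of "i + int n * int Q"] by (simp add: algebra_simps)
  qed simp
  show ?thesis
  proof (cases "k \<ge> 0")
    case True
    then show ?thesis using nat[of i "nat k"] by simp
  next
    case False
    then show ?thesis using nat[of "i + k * int Q" "nat (- k)"] by simp
  qed
qed

lemma orbit_enum_funpow:
  assumes "orbit_enum G P Q X"
  shows "(G ^^ n) (X i) = X (i + int n * P)"
proof (induction n)
  case (Suc n)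
  then show ?case using assms by (simp add: orbit_enum_def algebra_simps)
qed simp

lemma orbit_enum_shift: "orbit_enum G P Q X \<Longrightarrow> orbit_enum G P Q (\<lambda>i. X (i + s))"
  by (auto simp: orbit_enum_def strict_mono_def add.assoc add.left_commute)
     (metis add.commute add.left_commute)+

lemma orbit_enum_less: "orbit_enum G P Q X \<Longrightarrow> X i < X j \<longleftrightarrow> i < j"
  by (simp add: orbit_enum_def strict_mono_less)

lemma orbit_enum_le: "orbit_enum G P Q X \<Longrightarrow> X i \<le> X j \<longleftrightarrow> i \<le> j"
  by (simp add: orbit_enum_def strict_mono_less_eq)

lemma orbit_enum_locate:
  assumes "orbit_enum G P Q X" "Q > 0"
  obtains i where "X (i - 1) < y" "y \<le> X i"
proof -
  obtain k :: int where k: "X 0 \<le> y + of_int k" "y + of_int k < X 0 + 1"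
    using lift_reduce by blast
  have lo: "X (0 + (- k - 1) * int Q) < y" and hi: "y \<le> X (0 + (1 - k) * int Q)"
    using k orbit_enum_add[OF assms(1), of 0 "- k - 1"] orbit_enum_add[OF assms(1), of 0 "1 - k"] by auto
  define S where "S = {i. i \<ge> (- k - 1) * int Q \<and> y \<le> X i}"
  have ne: "(1 - k) * int Q \<in> S" using hi assms(2) by (auto simp: S_def algebra_simps)
  have bd: "\<forall>i\<in>S. i \<ge> (- k - 1) * int Q" by (simp add: S_def)
  define n where "n = (LEAST n. (- k - 1) * int Q + int n \<in> S)"
  have ex: "\<exists>n. (- k - 1) * int Q + int n \<in> S"
    using ne assms(2) by (intro exI[of _ "nat (2 * int Q)"]) (simp add: algebra_simps)
  define i where "i = (- k - 1) * int Q + int n"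
  have iS: "i \<in> S" unfolding i_def n_def using LeastI_ex[OF ex] .
  have "n \<noteq> 0"
  proof
    assume "n = 0" then show False using iS lo by (simp add: i_def S_def)
  qed
  then obtain n' where n': "n = Suc n'" by (cases n) auto
  have "(- k - 1) * int Q + int n' \<notin> S" using not_less_Least[of n' "\<lambda>n. (- k - 1) * int Q + int n \<in> S"] n' n_def by simp
  then have "X (i - 1) < y" using n' by (simp add: S_def i_def)
  moreover have "y \<le> X i" using iS by (simp add: S_def)
  ultimately show ?thesis using that by blast
qed

subsection \<open>Rotation numbers of monotone lifts\<close>

lemma mono_lift_iter_dist:
  assumes G: "degree_one_lift G" "mono G"
  shows "\<bar>((G ^^ n) x - x) - ((G ^^ n) y - y)\<bar> \<le> 1"
proof -
  obtain k :: int where k: "x \<le> y + of_int k" "y + of_int k < x + 1" using lift_reduce by blast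
  have Gn: "degree_one_lift (G ^^ n)" "mono (G ^^ n)"
    using degree_one_lift_funpow[OF G(1)] mono_pow[OF G(2)] by auto
  have "(G ^^ n) x \<le> (G ^^ n) (y + of_int k)" "(G ^^ n) (y + of_int k) \<le> (G ^^ n) (x + of_int 1)"
    using k monoD[OF Gn(2)] by auto
  then show ?thesis using k by (simp only: lift_add_int[OF Gn(1)])
qed

text \<open>Under the same iterate all points have the same displacement up to 1, so the
  displacements of 0 are additive up to a bounded error and their averages form a Cauchy
  sequence.\<close>

lemma mono_lift_rotation_number:
  assumes G: "degree_one_lift G" "mono G"
  obtains \<rho> where "\<And>x. (\<lambda>m. ((G ^^ m) x - x) / real m) \<longlonglongrightarrow> \<rho>"
proof -
  define s where "s n = (G ^^ n) 0" for n
  have mult: "\<bar>s (n * m) - real n * s m\<bar> \<le> real n" for n m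
  proof (induction n)
    case (Suc n)
    have "s (Suc n * m) = (G ^^ m) (s (n * m))" by (simp add: s_def funpow_add)
    then have "\<bar>s (Suc n * m) - s (n * m) - s m\<bar> \<le> 1"
      using mono_lift_iter_dist[OF G, of m "s (n * m)" 0] by (simp add: s_def)
    then show ?case using Suc by (simp add: algebra_simps)
  qed (simp add: s_def)
  have close: "\<bar>s n / real n - s m / real m\<bar> \<le> 1 / real n + 1 / real m" if "n > 0" "m > 0" for n m
  proof -
    have "\<bar>s (n * m) / (real n * real m) - s m / real m\<bar> = \<bar>s (n * m) - real n * s m\<bar> / (real n * real m)"
      using that by (simp add: field_simps)
    also have "\<dots> \<le> real n / (real n * real m)" using mult that by (intro divide_right_mono) auto
    finally have 1: "\<bar>s (n * m) / (real n * real m) - s m / real m\<bar> \<le> 1 / real m" using that by simp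
    define t where "t = s (n * m) / (real n * real m)"
    have "\<bar>s (n * m) / (real n * real m) - s n / real n\<bar> = \<bar>s (m * n) - real m * s n\<bar> / (real n * real m)"
      using that by (simp add: field_simps)
    also have "\<dots> \<le> real m / (real n * real m)" using mult that by (intro divide_right_mono) auto
    finally have "\<bar>s (n * m) / (real n * real m) - s n / real n\<bar> \<le> 1 / real n" using that by simp
    with 1 show ?thesis unfolding t_def[symmetric] by linarith
  qed
  have "Cauchy (\<lambda>n. s n / real n)"
  proof (rule metric_CauchyI)
    fix e :: real assume "e > 0"
    obtain M :: nat where M: "M > 0" "1 / real M < e / 2"
      using \<open>e > 0\<close> by (metis half_gt_zero_iff nat_approx_posE zero_less_Suc)
    show "\<exists>M. \<forall>m\<ge>M. \<forall>n\<ge>M. dist (s m / real m) (s n / real n) < e"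
    proof (intro exI[of _ M] allI impI)
      fix m n assume "M \<le> m" "M \<le> n"
      moreover from this have "1 / real m \<le> 1 / real M" "1 / real n \<le> 1 / real M" using M by (auto simp: frac_le)
      ultimately show "dist (s m / real m) (s n / real n) < e"
        using close[of m n] M unfolding dist_real_def by linarith
    qed
  qed
  then obtain \<rho> where \<rho>: "(\<lambda>n. s n / real n) \<longlonglongrightarrow> \<rho>" by (auto simp: Cauchy_convergent_iff convergent_def)
  have "(\<lambda>m. ((G ^^ m) x - x) / real m) \<longlonglongrightarrow> \<rho>" for x
  proof (rule Lim_transform[OF \<rho>])
    show "(\<lambda>m. ((G ^^ m) x - x) / real m - s m / real m) \<longlonglongrightarrow> 0"
    proof (rule Lim_null_comparison)
      show "(\<lambda>m. 1 / real m) \<longlonglongrightarrow> 0" by (rule lim_1_over_n)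
      show "\<forall>\<^sub>F m in sequentially. norm (((G ^^ m) x - x) / real m - s m / real m) \<le> 1 / real m"
      proof (intro always_eventually allI)
        fix m
        have "norm (((G ^^ m) x - x) / real m - s m / real m) = \<bar>((G ^^ m) x - x) - ((G ^^ m) 0 - 0)\<bar> / real m"
          by (simp add: s_def diff_divide_distrib[symmetric])
        also have "\<dots> \<le> 1 / real m" using mono_lift_iter_dist[OF G, of m x 0] by (intro divide_right_mono) auto
        finally show "norm (((G ^^ m) x - x) / real m - s m / real m) \<le> 1 / real m" .
      qed
    qed
  qed
  then show ?thesis using that by blast
qed

definition has_type :: "(real \<Rightarrow> real) \<Rightarrow> int \<Rightarrow> nat \<Rightarrow> bool" where
  "has_type G p q \<longleftrightarrow> (\<exists>x. (G ^^ q) x = x + of_int p)"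

lemma has_type_lim:
  assumes G: "degree_one_lift G" "mono G" and "q > 0" "has_type G p q"
  shows "(\<lambda>m. ((G ^^ m) x - x) / real m) \<longlonglongrightarrow> of_int p / of_nat q"
proof -
  obtain \<rho> where \<rho>: "\<And>x. (\<lambda>m. ((G ^^ m) x - x) / real m) \<longlonglongrightarrow> \<rho>"
    using mono_lift_rotation_number[OF G] by blast
  obtain w where w: "(G ^^ q) w = w + of_int p" using assms by (auto simp: has_type_def)
  have "(\<lambda>m. ((G ^^ (Suc m * q)) w - w) / real (Suc m * q)) \<longlonglongrightarrow> \<rho>"
  proof (rule LIMSEQ_subseq_LIMSEQ[OF \<rho>[of w], of "\<lambda>m. Suc m * q", unfolded comp_def])
    show "strict_mono (\<lambda>m. Suc m * q)" using \<open>q > 0\<close> by (auto simp: strict_mono_def)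
  qed
  moreover have "((G ^^ (Suc m * q)) w - w) / real (Suc m * q) = of_int p / of_nat q" for m
    using periodic_iter[OF G(1) w, of "Suc m"] \<open>q > 0\<close> by (simp del: of_nat_Suc funpow.simps mult_Suc)
  ultimately have "\<rho> = of_int p / of_nat q" by (simp add: LIMSEQ_const_iff)
  then show ?thesis using \<rho> by simp
qed

lemma funpow_le_funpow:
  fixes G H :: "real \<Rightarrow> real"
  assumes "\<And>x. G x \<le> H x" "mono H" "x \<le> y"
  shows "(G ^^ n) x \<le> (H ^^ n) y"
proof (induction n)
  case (Suc n)
  have "G ((G ^^ n) x) \<le> H ((G ^^ n) x)" by (rule assms)
  also have "\<dots> \<le> H ((H ^^ n) y)" using Suc assms(2) by (simp add: mono_def)
  finally show ?case by simp
qed (use assms in simp)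

lemma funpow_le_funpow':
  fixes G H :: "real \<Rightarrow> real"
  assumes "\<And>x. G x \<le> H x" "mono G" "x \<le> y"
  shows "(G ^^ n) x \<le> (H ^^ n) y"
proof (induction n)
  case (Suc n)
  have "G ((G ^^ n) x) \<le> G ((H ^^ n) y)" using Suc assms(2) by (simp add: mono_def)
  also have "\<dots> \<le> H ((H ^^ n) y)" by (rule assms)
  finally show ?case by simp
qed (use assms in simp)

text \<open>On the set where \<open>f\<close> meets its lower bound both maps agree, and the lower bound maps this set
  onto the line; a nested intersection of compact sets yields a whole orbit inside it.\<close>

lemma lower_bound_orbit:
  assumes f: "degree_one_lift f"
  obtains x where "\<And>n. (f ^^ n) x = (lower_bound f ^^ n) x"
proof -
  let ?l = "lower_bound f"
  note l = degree_one_lift_lower_bound[OF f] mono_lower_bound[OF f]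
  \<comment> \<open>A preimage of \<open>z\<close> under the lower bound is moved to the right, to
    the point where the infimum is attained; there \<open>f\<close> meets its lower bound.\<close>
  have onto: "\<exists>x. f x = z \<and> ?l x = z" for z
  proof -
    obtain B where B: "\<And>x. \<bar>?l x - x\<bar> \<le> B" using lift_displacement_bounded[OF l(1)] by blast
    have "B \<ge> 0" using B[of 0] by linarith
    then have "\<exists>y\<ge>z-B. y \<le> z+B \<and> ?l y = z"
      using B[of "z - B"] B[of "z + B"] by (intro IVT') (auto intro: lift_cont[OF l(1)])
    then obtain y where y: "?l y = z" by blast
    obtain x where x: "y \<le> x" "x \<le> y + 1" "f x = ?l y" using lower_bound_attained[OF f] by blast
    have "?l x \<le> f x" using lower_bound_le[OF f, of x x] by simp
    moreover have "?l y \<le> ?l x" using l(2) x(1) by (simp add: mono_def)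
    ultimately show ?thesis using x y by auto
  qed
  define K where "K n = {x. \<forall>i<n. f ((?l ^^ i) x) = ?l ((?l ^^ i) x)}" for n
  have cont: "continuous_on UNIV (?l ^^ i)" for i
    by (rule lift_cont[OF degree_one_lift_funpow[OF l(1)]])
  have closed: "closed (K n)" for n
  proof -
    have "closed {x. f ((?l ^^ i) x) = ?l ((?l ^^ i) x)}" for i
      by (intro closed_Collect_eq continuous_on_compose2[OF lift_cont[OF f] cont]
          continuous_on_compose2[OF lift_cont[OF l(1)] cont]) auto
    moreover have "K n = (\<Inter>i\<in>{..<n}. {x. f ((?l ^^ i) x) = ?l ((?l ^^ i) x)})"
      by (auto simp: K_def)
    ultimately show ?thesis by (metis (no_types, lifting) closed_INT)
  qed
  have ne: "K n \<noteq> {}" for n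
  proof (induction n)
    case (Suc n)
    then obtain z where z: "z \<in> K n" by blast
    obtain x where x: "f x = z" "?l x = z" using onto by blast
    have "x \<in> K (Suc n)"
    proof -
      have "f ((?l ^^ i) x) = ?l ((?l ^^ i) x)" if "i < Suc n" for i
      proof (cases i)
        case (Suc j)
        have "(?l ^^ i) x = (?l ^^ j) z" by (simp add: Suc funpow_Suc_right x del: funpow.simps)
        then show ?thesis using z that Suc by (simp add: K_def)
      qed (use x in simp)
      then show ?thesis by (simp add: K_def)
    qed
    then show ?case by blast
  qed (simp add: K_def)
  have per: "x + of_int k \<in> K n" if "x \<in> K n" for x k n
    using that by (simp add: K_def lift_add_int[OF degree_one_lift_funpow[OF l(1)]]
        lift_add_int[OF f] lift_add_int[OF l(1)])
  have ne': "{0..1} \<inter> K n \<noteq> {}" for n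
  proof -
    obtain x where "x \<in> K n" using ne by blast
    moreover obtain k :: int where "0 \<le> x + of_int k" "x + of_int k < 0 + 1" using lift_reduce by blast
    ultimately show ?thesis using per[of x n k] by fastforce
  qed
  have "(\<Inter>n. {0..1} \<inter> K n) \<noteq> {}"
  proof (rule compact_nest)
    show "compact ({0..1} \<inter> K n)" for n using closed by (simp add: compact_Int_closed)
    show "{0..1} \<inter> K n \<noteq> {}" for n by (rule ne')
    show "{0..1} \<inter> K n \<subseteq> {0..1} \<inter> K m" if "m \<le> n" for m n using that by (auto simp: K_def)
  qed
  then obtain x where "\<And>n. x \<in> K n" by blast
  then have x: "f ((?l ^^ i) x) = ?l ((?l ^^ i) x)" for i by (auto simp: K_def)
  have "(f ^^ n) x = (?l ^^ n) x" for n
    by (induction n) (simp_all add: x)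
  then show ?thesis using that by blast
qed

text \<open>The displacement of the \<open>q\<close>-th iterate is continuous and periodic; if it
  omits the value \<open>p\<close>, it stays on one side of it with a margin by compactness.\<close>

lemma no_type_cases:
  assumes G: "degree_one_lift G" and no: "\<not> has_type G p q"
  obtains (above) d where "d > 0" "\<And>x. (G ^^ q) x \<ge> x + of_int p + d"
  | (below) d where "d > 0" "\<And>x. (G ^^ q) x \<le> x + of_int p - d"
proof -
  have Gq: "degree_one_lift (G ^^ q)" by (rule degree_one_lift_funpow[OF G])
  let ?h = "\<lambda>x. (G ^^ q) x - x - of_int p"
  have cont: "continuous_on S ?h" for S by (intro continuous_intros lift_cont[OF Gq])
  have nz: "?h x \<noteq> 0" for x using no by (auto simp: has_type_def algebra_simps)
  have per: "?h (x + of_int k) = ?h x" for x k by (simp add: lift_add_int[OF Gq])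
  obtain u where u: "u \<in> {0..1}" "\<And>x. x \<in> {0..1} \<Longrightarrow> ?h u \<le> ?h x"
    using continuous_attains_inf[OF _ _ cont, of "{0..1}"] by auto
  obtain v where v: "v \<in> {0..1}" "\<And>x. x \<in> {0..1} \<Longrightarrow> ?h x \<le> ?h v"
    using continuous_attains_sup[OF _ _ cont, of "{0..1}"] by auto
  have glob: "?h u \<le> ?h x \<and> ?h x \<le> ?h v" for x
  proof -
    obtain k :: int where k: "0 \<le> x + of_int k" "x + of_int k < 0 + 1" using lift_reduce by blast
    then show ?thesis using u(2)[of "x + of_int k"] v(2)[of "x + of_int k"] per[of x k] by simp
  qed
  have "?h u > 0 \<or> ?h v < 0"
  proof (rule ccontr)
    assume "\<not> ?thesis"
    then have "?h u \<le> 0" "0 \<le> ?h v" by auto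
    moreover have "connected (range ?h)" using cont by (intro connected_continuous_image) auto
    ultimately have "0 \<in> range ?h" unfolding connected_iff_interval by blast
    then show False using nz by auto
  qed
  then show ?thesis
  proof
    assume "?h u > 0"
    then show ?thesis using above[of "?h u"] glob by (force simp: algebra_simps)
  next
    assume "?h v < 0"
    then show ?thesis using below[of "- ?h v"] glob by (force simp: algebra_simps)
  qed
qed

text \<open>The monotone minorant \<open>G\<close> is the lower bound of \<open>f\<close> in one
  application and equal to the map itself in the other.\<close>

lemma rot_ge:
  assumes f: "degree_one_lift f" and q: "q > 0" and l: "degree_one_lift G" "mono G" "\<And>x. G x \<le> f x"
    and above: "\<And>x. (G ^^ q) x \<ge> x + of_int p + d" "d > 0"
    and lim: "(\<lambda>m. ((f ^^ m) x - x) / real m) \<longlonglongrightarrow> \<rho>"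
  shows "\<rho> \<ge> (of_int p + d) / real q"
proof -
  have step: "(G ^^ (m * q)) x \<ge> x + real m * (of_int p + d)" for m
  proof (induction m)
    case (Suc m)
    have "(G ^^ (Suc m * q)) x = (G ^^ q) ((G ^^ (m * q)) x)" by (simp add: funpow_add)
    then show ?case using Suc above(1)[of "(G ^^ (m * q)) x"] by (simp add: algebra_simps)
  qed simp
  have "(\<lambda>m. ((f ^^ (Suc m * q)) x - x) / real (Suc m * q)) \<longlonglongrightarrow> \<rho>"
  proof (rule LIMSEQ_subseq_LIMSEQ[OF lim, of "\<lambda>m. Suc m * q", unfolded comp_def])
    show "strict_mono (\<lambda>m. Suc m * q)" using q by (auto simp: strict_mono_def)
  qed
  moreover have "(of_int p + d) / real q \<le> ((f ^^ (Suc m * q)) x - x) / real (Suc m * q)" for m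
  proof -
    have "(G ^^ (Suc m * q)) x \<le> (f ^^ (Suc m * q)) x"
      by (rule funpow_le_funpow'[OF l(3,2)]) simp
    then have "real (Suc m) * (of_int p + d) \<le> (f ^^ (Suc m * q)) x - x" using step[of "Suc m"] by linarith
    then have "real (Suc m) * (of_int p + d) / real (Suc m * q) \<le> ((f ^^ (Suc m * q)) x - x) / real (Suc m * q)"
      by (intro divide_right_mono) auto
    then show ?thesis by (simp only: of_nat_mult) (simp only: mult_divide_mult_cancel_left of_nat_eq_0_iff nat.simps simp_thms if_False)
  qed
  ultimately show ?thesis by (intro LIMSEQ_le_const) auto
qed

lemma Rot_refl_map: "Rot (refl_map f) = uminus ` Rot f"
proof -
  have "(\<lambda>m. ((refl_map f ^^ m) x - x) / real m) = (\<lambda>m. - (((f ^^ m) (- x) - (- x)) / real m))" for x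
    by (rule ext) (simp add: funpow_refl_map add_divide_distrib diff_divide_distrib)
  then have *: "((\<lambda>m. ((refl_map f ^^ m) x - x) / real m) \<longlonglongrightarrow> \<rho>) \<longleftrightarrow>
     ((\<lambda>m. ((f ^^ m) (- x) - (- x)) / real m) \<longlonglongrightarrow> - \<rho>)" for x \<rho>
    using tendsto_minus_cancel_left[of "\<lambda>m. ((f ^^ m) (- x) - (- x)) / real m" \<rho> sequentially] by simp
  show ?thesis
  proof (intro set_eqI iffI)
    fix \<rho> assume "\<rho> \<in> Rot (refl_map f)"
    then have "- \<rho> \<in> Rot f" unfolding Rot_def using * by blast
    then show "\<rho> \<in> uminus ` Rot f" by force
  next
    fix \<rho> assume "\<rho> \<in> uminus ` Rot f"
    then have "- \<rho> \<in> Rot f" by auto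
    then obtain y where "(\<lambda>m. ((f ^^ m) y - y) / real m) \<longlonglongrightarrow> - \<rho>" unfolding Rot_def by blast
    then show "\<rho> \<in> Rot (refl_map f)" unfolding Rot_def using *[of "- y" \<rho>, unfolded minus_minus] by blast
  qed
qed

text \<open>If the lower bound moved all points too far, so would \<open>f\<close>. If it moved them
  too little, the orbit that \<open>f\<close> shares with its lower bound would contribute a smaller
  number to the rotation set.\<close>

lemma Rot_imp_lower_type:
  assumes f: "degree_one_lift f" and q: "q > 0" and R: "Rot f = {of_int p / real q}"
  shows "has_type (lower_bound f) p q"
proof (rule ccontr)
  let ?l = "lower_bound f"
  note l = degree_one_lift_lower_bound[OF f] mono_lower_bound[OF f]
  assume "\<not> ?thesis"
  from l(1) this show False
  proof (cases rule: no_type_cases)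
    case (above d)
    obtain x where "(\<lambda>m. ((f ^^ m) x - x) / real m) \<longlonglongrightarrow> of_int p / real q"
      using R unfolding Rot_def by blast
    from rot_ge[OF f q l lower_bound_le[OF f] above(2,1) this]
    have "d / real q \<le> 0" by (simp add: add_divide_distrib)
    then show ?thesis using above(1) q by (simp add: divide_le_0_iff)
  next
    case (below d)
    obtain x where x: "\<And>n. (f ^^ n) x = (?l ^^ n) x" using lower_bound_orbit[OF f] by blast
    obtain \<rho> where \<rho>: "\<And>x. (\<lambda>m. ((?l ^^ m) x - x) / real m) \<longlonglongrightarrow> \<rho>"
      using mono_lift_rotation_number[OF l] by blast
    have "\<rho> \<in> Rot f" using \<rho>[of x] unfolding x[symmetric] Rot_def by blast
    then have r: "\<rho> = of_int p / real q" using R by simp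
    have "(\<lambda>m. ((refl_map ?l ^^ m) (- x) - (- x)) / real m) \<longlonglongrightarrow> - \<rho>"
    proof -
      have "(\<lambda>m. - (((?l ^^ m) x - x) / real m)) \<longlonglongrightarrow> - \<rho>" by (intro tendsto_minus \<rho>)
      then show ?thesis by (simp add: funpow_refl_map minus_divide_left)
    qed
    moreover have "(refl_map ?l ^^ q) y \<ge> y + of_int (- p) + d" for y
      using below(2)[of "- y"] by (simp add: funpow_refl_map)
    ultimately have "- \<rho> \<ge> (of_int (- p) + d) / real q"
      using rot_ge[OF degree_one_lift_refl_map[OF l(1)] q degree_one_lift_refl_map[OF l(1)] mono_refl_map[OF l(2)], of "- p" d "- x" "- \<rho>"] below(1)
      by simp
    then have "d / real q \<le> 0" using r by (simp add: add_divide_distrib diff_divide_distrib)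
    then show ?thesis using below(1) q by (simp add: divide_le_0_iff)
  qed
qed

lemma has_type_refl_map: "has_type (refl_map G) p q \<longleftrightarrow> has_type G (- p) q"
  unfolding has_type_def funpow_refl_map
proof
  assume "\<exists>x. - (G ^^ q) (- x) = x + real_of_int p"
  then obtain x where "- (G ^^ q) (- x) = x + real_of_int p" by blast
  then show "\<exists>x. (G ^^ q) x = x + real_of_int (- p)" by (intro exI[of _ "- x"]) simp
next
  assume "\<exists>x. (G ^^ q) x = x + real_of_int (- p)"
  then obtain x where "(G ^^ q) x = x + real_of_int (- p)" by blast
  then show "\<exists>x. - (G ^^ q) (- x) = x + real_of_int p" by (intro exI[of _ "- x"]) simp
qed

text \<open>The bridge from the rotation set to the monotone bounds. In the converse direction every
  orbit of \<open>f\<close> is squeezed between orbits of the two bounds, which both rotate by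
  \<open>p/q\<close>.\<close>

lemma Rot_eq_iff:
  assumes f: "degree_one_lift f" and q: "q > 0"
  shows "Rot f = {of_int p / real q} \<longleftrightarrow> has_type (lower_bound f) p q \<and> has_type (upper_bound f) p q"
proof
  assume R: "Rot f = {of_int p / real q}"
  then have "Rot (refl_map f) = {of_int (- p) / real q}" by (simp add: Rot_refl_map)
  from Rot_imp_lower_type[OF degree_one_lift_refl_map[OF f] q this]
  have "has_type (upper_bound f) p q" by (simp add: upper_bound_refl has_type_refl_map)
  with Rot_imp_lower_type[OF f q R] show "has_type (lower_bound f) p q \<and> has_type (upper_bound f) p q" by simp
next
  assume *: "has_type (lower_bound f) p q \<and> has_type (upper_bound f) p q"
  have lim: "(\<lambda>m. ((f ^^ m) x - x) / real m) \<longlonglongrightarrow> of_int p / real q" for x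
  proof (rule tendsto_sandwich)
    show "(\<lambda>m. ((lower_bound f ^^ m) x - x) / real m) \<longlonglongrightarrow> of_int p / real q"
      using * by (intro has_type_lim q degree_one_lift_lower_bound mono_lower_bound f) auto
    show "(\<lambda>m. ((upper_bound f ^^ m) x - x) / real m) \<longlonglongrightarrow> of_int p / real q"
      using * by (intro has_type_lim q degree_one_lift_upper_bound mono_upper_bound f) auto
    show "\<forall>\<^sub>F m in sequentially. ((lower_bound f ^^ m) x - x) / real m \<le> ((f ^^ m) x - x) / real m"
      by (intro always_eventually allI divide_right_mono diff_right_mono funpow_le_funpow'
          mono_lower_bound f lower_bound_le) auto
    show "\<forall>\<^sub>F m in sequentially. ((f ^^ m) x - x) / real m \<le> ((upper_bound f ^^ m) x - x) / real m"
      by (intro always_eventually allI divide_right_mono diff_right_mono funpow_le_funpow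
          mono_upper_bound f upper_bound_ge) auto
  qed
  show "Rot f = {of_int p / real q}"
  proof (intro set_eqI iffI)
    fix \<rho> assume "\<rho> \<in> Rot f"
    then obtain x where "(\<lambda>m. ((f ^^ m) x - x) / real m) \<longlonglongrightarrow> \<rho>" by (auto simp: Rot_def)
    then show "\<rho> \<in> {of_int p / real q}" using LIMSEQ_unique[OF _ lim[of x]] by simp
  next
    fix \<rho> assume "\<rho> \<in> {of_int p / real q}"
    then show "\<rho> \<in> Rot f" using lim[of 0] unfolding Rot_def by blast
  qed
qed

subsection \<open>Translation intervals of a rotation type\<close>

lemma lift_uniformly_continuous:
  assumes "degree_one_lift G"
  shows "uniformly_continuous_on UNIV G"
  unfolding uniformly_continuous_on_def
proof (intro allI impI ballI)
  fix e :: real assume "e > 0"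
  have "uniformly_continuous_on {-1..2} G"
    by (intro compact_uniformly_continuous lift_cont[OF assms]) auto
  then obtain d where d: "d > 0"
    "\<And>x y. x \<in> {-1..2} \<Longrightarrow> y \<in> {-1..2} \<Longrightarrow> dist y x < d \<Longrightarrow> dist (G y) (G x) < e"
    unfolding uniformly_continuous_on_def using \<open>e > 0\<close> by metis
  show "\<exists>d>0. \<forall>x\<in>UNIV. \<forall>x'\<in>UNIV. dist x' x < d \<longrightarrow> dist (G x') (G x) < e"
  proof (intro exI[of _ "min d 1"] conjI ballI impI)
    fix x y :: real assume xy: "dist y x < min d 1"
    obtain k :: int where k: "0 \<le> x + of_int k" "x + of_int k < 0 + 1" using lift_reduce by blast
    have "dist (G (y + of_int k)) (G (x + of_int k)) < e"
      using xy k by (intro d(2)) (auto simp: dist_real_def)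
    then show "dist (G y) (G x) < e" by (simp add: lift_add_int[OF assms] dist_real_def)
  qed (use d in auto)
qed

lemma iter_close:
  assumes "degree_one_lift G" "e > 0"
  obtains d where "d > 0" "\<And>H x. (\<And>x. \<bar>G x - H x\<bar> \<le> d) \<Longrightarrow> \<bar>(G ^^ n) x - (H ^^ n) x\<bar> \<le> e"
proof -
  have "\<exists>d>0. \<forall>H. (\<forall>x. \<bar>G x - H x\<bar> \<le> d) \<longrightarrow> (\<forall>x. \<bar>(G ^^ n) x - (H ^^ n) x\<bar> \<le> e)"
    using \<open>e > 0\<close>
  proof (induction n arbitrary: e)
    case (Suc n)
    obtain r where r: "r > 0" "\<And>x y. \<bar>y - x\<bar> < r \<Longrightarrow> \<bar>G y - G x\<bar> < e / 2"
      using lift_uniformly_continuous[OF assms(1), unfolded uniformly_continuous_on_def, rule_format, of "e/2"]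
        Suc.prems by (auto simp: dist_real_def)
    obtain d where d: "d > 0"
      "\<And>H x. (\<And>x. \<bar>G x - H x\<bar> \<le> d) \<Longrightarrow> \<bar>(G ^^ n) x - (H ^^ n) x\<bar> \<le> r / 2"
      using Suc.IH[of "r/2"] r by auto
    show ?case
    proof (intro exI[of _ "min d (e/2)"] conjI allI impI)
      fix H x assume H: "\<forall>x. \<bar>G x - H x\<bar> \<le> min d (e/2)"
      have "\<bar>(G ^^ n) x - (H ^^ n) x\<bar> \<le> r / 2" using H by (intro d(2)) auto
      then have "\<bar>(G ^^ n) x - (H ^^ n) x\<bar> < r" using r(1) by linarith
      then have "\<bar>G ((G ^^ n) x) - G ((H ^^ n) x)\<bar> < e / 2" by (rule r(2))
      moreover have "\<bar>G ((H ^^ n) x) - H ((H ^^ n) x)\<bar> \<le> e / 2" using H by auto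
      ultimately show "\<bar>(G ^^ Suc n) x - (H ^^ Suc n) x\<bar> \<le> e"
        unfolding funpow.simps comp_apply by linarith
    qed (use d Suc.prems in auto)
  qed (auto intro: exI[of _ 1])
  then show ?thesis using that by blast
qed

abbreviation (input) translate :: "(real \<Rightarrow> real) \<Rightarrow> real \<Rightarrow> real \<Rightarrow> real" where
  "translate G a \<equiv> (\<lambda>x. G x + a)"

lemma mono_trans: "mono G \<Longrightarrow> mono (translate G a)"
  by (auto simp: mono_def)

lemma refl_map_trans: "refl_map (translate G a) = translate (refl_map G) (- a)"
  by (simp add: refl_map_def fun_eq_iff)

text \<open>The first \<open>q - 1\<close> steps preserve the order, and the translation in the last
  step alone contributes \<open>a' - a\<close>.\<close>

lemma trans_iter_mono:
  assumes "mono G" "a \<le> a'" "q > 0"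
  shows "(translate G a ^^ q) x + (a' - a) \<le> (translate G a' ^^ q) x"
proof -
  obtain r where r: "q = Suc r" using assms(3) by (cases q) auto
  have "(translate G a ^^ r) x \<le> (translate G a' ^^ r) x"
    by (rule funpow_le_funpow) (use assms mono_trans in auto)
  then have "G ((translate G a ^^ r) x) \<le> G ((translate G a' ^^ r) x)" using assms(1) by (simp add: mono_def)
  then show ?thesis by (simp add: r)
qed

text \<open>For monotone \<open>G\<close> this is the left end of the interval of translations that
  produce a periodic orbit of type \<open>p/q\<close>.\<close>

definition lo :: "int \<Rightarrow> nat \<Rightarrow> (real \<Rightarrow> real) \<Rightarrow> real" where
  "lo p q G = Inf {a. \<exists>x. x + of_int p \<le> (translate G a ^^ q) x}"

text \<open>The right end of the same interval, encoded as a reflected \<open>lo\<close> so that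
  each fact about one end gives the fact about the other.\<close>

definition hi :: "int \<Rightarrow> nat \<Rightarrow> (real \<Rightarrow> real) \<Rightarrow> real" where
  "hi p q G = - lo (- p) q (refl_map G)"

text \<open>The admissible translations form a half-line, which is closed: at a non-admissible
  infimum all displacements would fall short of \<open>p\<close> by a margin, and a slightly larger
  translation could not make it up.\<close>

lemma lo_le_iff:
  assumes G: "degree_one_lift G" "mono G" and q: "q > 0"
  shows "lo p q G \<le> a \<longleftrightarrow> (\<exists>x. x + of_int p \<le> (translate G a ^^ q) x)"
proof -
  let ?U = "{a. \<exists>x. x + of_int p \<le> (translate G a ^^ q) x}"
  have up: "a' \<in> ?U" if a: "a \<in> ?U" "a \<le> a'" for a a'
  proof -
    obtain x where "x + of_int p \<le> (translate G a ^^ q) x" using a by blast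
    then have "x + of_int p \<le> (translate G a' ^^ q) x" using trans_iter_mono[OF G(2) a(2) q, of x] a(2) by linarith
    then show ?thesis by blast
  qed
  obtain B where B: "\<And>x. \<bar>(G ^^ q) x - x\<bar> \<le> B"
    using lift_displacement_bounded[OF degree_one_lift_funpow[OF G(1)]] by blast
  have "\<bar>of_int p\<bar> + B \<in> ?U"
  proof -
    have "0 \<le> \<bar>of_int p\<bar> + B" using B[of 0] by linarith
    from trans_iter_mono[OF G(2) this q, of 0] have "0 + of_int p \<le> (translate G (\<bar>of_int p\<bar> + B) ^^ q) 0"
      using B[of 0] by simp
    then show ?thesis by blast
  qed
  then have ne: "?U \<noteq> {}" by blast
  have bdd: "bdd_below ?U"
  proof (rule bdd_belowI)
    fix a assume "a \<in> ?U"
    show "- (\<bar>of_int p\<bar> + B + 1) \<le> a"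
    proof (rule ccontr)
      assume "\<not> ?thesis"
      then have "- (\<bar>of_int p\<bar> + B + 1) \<in> ?U" using up[OF \<open>a \<in> ?U\<close>] by simp
      then obtain x where x: "x + of_int p \<le> (translate G (- (\<bar>of_int p\<bar> + B + 1)) ^^ q) x" by blast
      have "- (\<bar>of_int p\<bar> + B + 1) \<le> 0" using B[of 0] by linarith
      from trans_iter_mono[OF G(2) this q, of x] show False using x B[of x] by simp
    qed
  qed
  have inU: "lo p q G \<in> ?U"
  proof (rule ccontr)
    assume no: "lo p q G \<notin> ?U"
    let ?a = "lo p q G"
    have less: "(translate G ?a ^^ q) x < x + of_int p" for x
    proof (rule ccontr)
      assume "\<not> ?thesis"
      then have "x + of_int p \<le> (translate G ?a ^^ q) x" by simp
      then show False using no by blast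
    qed
    then have "\<not> has_type (translate G ?a) p q" unfolding has_type_def by (metis less_irrefl)
    from degree_one_lift_translate[OF G(1)] this show False
    proof (cases rule: no_type_cases)
      case (above d)
      then show ?thesis using less[of 0] above(2)[of 0] by simp
    next
      case (below d)
      obtain r where r: "r > 0"
        "\<And>H x. (\<And>x. \<bar>translate G ?a x - H x\<bar> \<le> r) \<Longrightarrow> \<bar>(translate G ?a ^^ q) x - (H ^^ q) x\<bar> \<le> d / 2"
        using iter_close[OF degree_one_lift_translate[OF G(1), of ?a], of "d/2" q] below(1) by auto
      have "\<exists>c\<in>?U. c < ?a + r"
        using cInf_lessD[OF ne, of "?a + r"] r(1) unfolding lo_def by auto
      then have "?a + r \<in> ?U" using up[of _ "?a + r"] by (metis less_imp_le)
      then obtain x where x: "x + of_int p \<le> (translate G (?a + r) ^^ q) x" by blast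
      have "\<bar>(translate G ?a ^^ q) x - (translate G (?a + r) ^^ q) x\<bar> \<le> d / 2" using r(1) by (intro r(2)) auto
      then show ?thesis using below(1) below(2)[of x] x by linarith
    qed
  qed
  show ?thesis
  proof
    assume "lo p q G \<le> a" then show "\<exists>x. x + of_int p \<le> (translate G a ^^ q) x" using up[OF inU] by blast
  next
    assume "\<exists>x. x + of_int p \<le> (translate G a ^^ q) x"
    then show "lo p q G \<le> a" unfolding lo_def by (intro cInf_lower bdd) auto
  qed
qed

text \<open>A point moved by more than \<open>p\<close> would still be moved by at least
  \<open>p\<close> after a slight decrease of the translation, against minimality.\<close>

lemma at_lo:
  assumes G: "degree_one_lift G" "mono G" and q: "q > 0"
  shows "(translate G (lo p q G) ^^ q) x \<le> x + of_int p"
proof (rule ccontr)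
  let ?a = "lo p q G"
  define e where "e = (translate G ?a ^^ q) x - (x + of_int p)"
  assume "\<not> ?thesis"
  then have "e > 0" by (simp add: e_def)
  then obtain r where r: "r > 0"
    "\<And>H x. (\<And>x. \<bar>translate G ?a x - H x\<bar> \<le> r) \<Longrightarrow> \<bar>(translate G ?a ^^ q) x - (H ^^ q) x\<bar> \<le> e"
    using iter_close[OF degree_one_lift_translate[OF G(1), of ?a], of e q] by auto
  have "\<bar>(translate G ?a ^^ q) x - (translate G (?a - r) ^^ q) x\<bar> \<le> e" using r(1) by (intro r(2)) auto
  then have "x + of_int p \<le> (translate G (?a - r) ^^ q) x" unfolding e_def by linarith
  then have "?a \<le> ?a - r" using lo_le_iff[OF G q] by blast
  then show False using r(1) by simp
qed

lemma le_hi_iff: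
  assumes G: "degree_one_lift G" "mono G" and q: "q > 0"
  shows "a \<le> hi p q G \<longleftrightarrow> (\<exists>x. (translate G a ^^ q) x \<le> x + of_int p)"
proof -
  have "a \<le> hi p q G \<longleftrightarrow> lo (- p) q (refl_map G) \<le> - a" by (auto simp: hi_def)
  also have "\<dots> \<longleftrightarrow> (\<exists>x. x + of_int (- p) \<le> (refl_map (translate G a) ^^ q) x)"
    by (simp add: lo_le_iff[OF degree_one_lift_refl_map mono_refl_map q] G refl_map_trans)
  also have "\<dots> \<longleftrightarrow> (\<exists>x. (translate G a ^^ q) (- x) \<le> - x + of_int p)"
    by (simp add: funpow_refl_map le_minus_iff) (simp add: algebra_simps)
  also have "\<dots> \<longleftrightarrow> (\<exists>x. (translate G a ^^ q) x \<le> x + of_int p)"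
    by (metis minus_minus)
  finally show ?thesis .
qed

lemma at_hi:
  assumes G: "degree_one_lift G" "mono G" and q: "q > 0"
  shows "x + of_int p \<le> (translate G (hi p q G) ^^ q) x"
proof -
  have "(refl_map (translate G (hi p q G)) ^^ q) (- x) \<le> - x + of_int (- p)"
    using at_lo[OF degree_one_lift_refl_map[OF G(1)] mono_refl_map[OF G(2)] q, of "- p" "- x"]
    unfolding refl_map_trans hi_def by simp
  then show ?thesis by (simp add: funpow_refl_map)
qed

lemma has_type_trans_iff:
  assumes G: "degree_one_lift G" "mono G" and q: "q > 0"
  shows "has_type (translate G a) p q \<longleftrightarrow> lo p q G \<le> a \<and> a \<le> hi p q G"
proof
  assume "has_type (translate G a) p q"
  then obtain x where "(translate G a ^^ q) x = x + of_int p" by (auto simp: has_type_def)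
  then show "lo p q G \<le> a \<and> a \<le> hi p q G"
    using lo_le_iff[OF G q] le_hi_iff[OF G q] by (metis order_refl)
next
  assume *: "lo p q G \<le> a \<and> a \<le> hi p q G"
  then obtain x y where xy: "x + of_int p \<le> (translate G a ^^ q) x" "(translate G a ^^ q) y \<le> y + of_int p"
    using lo_le_iff[OF G q] le_hi_iff[OF G q] by blast
  show "has_type (translate G a) p q"
  proof (rule ccontr)
    assume no: "\<not> ?thesis"
    show False
      by (rule no_type_cases[OF degree_one_lift_translate[OF G(1)] no]) (use xy in \<open>smt (verit)\<close>)+
  qed
qed

lemma lo_le_lo:
  assumes G: "degree_one_lift G" "mono G" and H: "degree_one_lift H" "mono H" and q: "q > 0"
    and le: "\<And>x. G x \<le> H x + d"
  shows "lo p q H \<le> lo p q G + d"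
proof -
  obtain x where x: "x + of_int p \<le> (translate G (lo p q G) ^^ q) x" using lo_le_iff[OF G q] by blast
  have "(translate G (lo p q G) ^^ q) x \<le> (translate H (lo p q G + d) ^^ q) x"
  proof (rule funpow_le_funpow)
    show "G y + lo p q G \<le> H y + (lo p q G + d)" for y using le[of y] by simp
  qed (use mono_trans[OF H(2)] in auto)
  then have "x + of_int p \<le> (translate H (lo p q G + d) ^^ q) x" using x by linarith
  then show ?thesis using lo_le_iff[OF H q] by blast
qed

lemma hi_le_hi:
  assumes G: "degree_one_lift G" "mono G" and H: "degree_one_lift H" "mono H" and q: "q > 0"
    and le: "\<And>x. G x \<le> H x + d"
  shows "hi p q H \<le> hi p q G + d"
proof -
  have "lo (- p) q (refl_map G) \<le> lo (- p) q (refl_map H) + d"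
  proof (rule lo_le_lo)
    show "refl_map H x \<le> refl_map G x + d" for x using le[of "- x"] by (simp add: refl_map_def)
  qed (use assms in \<open>auto intro: degree_one_lift_refl_map mono_refl_map\<close>)
  then show ?thesis by (simp add: hi_def)
qed

lemma lo_dist:
  assumes G: "degree_one_lift G" "mono G" and H: "degree_one_lift H" "mono H" and q: "q > 0"
    and le: "\<And>x. \<bar>G x - H x\<bar> \<le> d"
  shows "\<bar>lo p q G - lo p q H\<bar> \<le> d"
proof -
  have "G x \<le> H x + d" "H x \<le> G x + d" for x using le[of x] by linarith+
  then have "lo p q H \<le> lo p q G + d" "lo p q G \<le> lo p q H + d"
    using lo_le_lo[OF G H q, of d p] lo_le_lo[OF H G q, of d p] by blast+
  then show ?thesis by linarith
qed

lemma hi_dist: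
  assumes G: "degree_one_lift G" "mono G" and H: "degree_one_lift H" "mono H" and q: "q > 0"
    and le: "\<And>x. \<bar>G x - H x\<bar> \<le> d"
  shows "\<bar>hi p q G - hi p q H\<bar> \<le> d"
proof -
  have "G x \<le> H x + d" "H x \<le> G x + d" for x using le[of x] by linarith+
  then have "hi p q H \<le> hi p q G + d" "hi p q G \<le> hi p q H + d"
    using hi_le_hi[OF G H q, of d p] hi_le_hi[OF H G q, of d p] by blast+
  then show ?thesis by linarith
qed

lemma lo_le_hi:
  assumes G: "degree_one_lift G" "mono G" and q: "q > 0"
  shows "lo p q G \<le> hi p q G"
  using at_lo[OF G q] le_hi_iff[OF G q] by blast

text \<open>Otherwise a single monotone map would move one point by at most \<open>p\<close> in
  \<open>q\<close> steps and another by at least \<open>p'\<close> in \<open>q'\<close> steps; over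
  a common time the displacements drift apart by more than the permitted 1.\<close>

lemma hi_less_lo:
  assumes G: "degree_one_lift G" "mono G" and q: "q > 0" "q' > 0" and less: "p * int q' < p' * int q"
  shows "hi p q G < lo p' q' G"
proof (rule ccontr)
  assume "\<not> ?thesis"
  then have le: "lo p' q' G \<le> hi p q G" by simp
  let ?a = "hi p q G" let ?H = "translate G ?a"
  note H = degree_one_lift_translate[OF G(1), of ?a] mono_trans[OF G(2), of ?a]
  obtain x where x: "(?H ^^ q) x \<le> x + of_int p" using le_hi_iff[OF G q(1)] by blast
  obtain y where y: "y + of_int p' \<le> (?H ^^ q') y" using lo_le_iff[OF G q(2)] le by blast
  \<comment> \<open>Over \<open>q q'\<close> steps the displacements differ by at least 1, which is
    no contradiction yet; the factor 2 makes the difference at least 2.\<close>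
  define m where "m = 2 * q' * q"
  have "(?H ^^ m) x \<le> x + real (2 * q') * of_int p"
    unfolding m_def by (rule mono_iter_le[OF H x])
  moreover have "m = 2 * q * q'" by (simp add: m_def)
  then have "(?H ^^ m) y \<ge> y + real (2 * q) * of_int p'"
    using mono_iter_ge[OF H y, of "2 * q"] by (simp only:)
  moreover have "\<bar>((?H ^^ m) x - x) - ((?H ^^ m) y - y)\<bar> \<le> 1"
    by (rule mono_lift_iter_dist[OF H])
  ultimately have "real (2 * q) * of_int p' - real (2 * q') * of_int p \<le> 1" by linarith
  then have "real_of_int (2 * (p' * int q - p * int q')) \<le> 1"
    by (simp add: algebra_simps)
  then have "2 * (p' * int q - p * int q') \<le> 1" by linarith
  then show False using less by presburger
qed

text \<open>A map whose \<open>q\<close>-th iterate moves every point by more than \<open>p\<close> cannot have rotation numbers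
  too close to \<open>p/q\<close>.\<close>

lemma hi_approx:
  assumes G: "degree_one_lift G" "mono G" and q: "q > 0" and s: "s > 0"
  shows "\<exists>d>0. \<exists>N. \<forall>H P Q. degree_one_lift H \<and> mono H \<and> (\<forall>x. \<bar>G x - H x\<bar> \<le> d) \<and> Q \<ge> N \<and> Q > 0 \<and>
       int q * P - p * int Q = 1 \<longrightarrow> hi P Q H \<le> hi p q G + s"
proof -
  let ?a = "hi p q G + s"
  have "\<not> has_type (translate G ?a) p q" using has_type_trans_iff[OF G q] s by simp
  from degree_one_lift_translate[OF G(1)] this obtain d where d: "d > 0" "\<And>x. (translate G ?a ^^ q) x \<ge> x + of_int p + d"
  proof (cases rule: no_type_cases)
    case (below d)
    have "(translate G (hi p q G) ^^ q) 0 + s \<le> (translate G ?a ^^ q) 0"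
      using trans_iter_mono[OF G(2), of "hi p q G" ?a q 0] s q by simp
    then show ?thesis using below(1) below(2)[of 0] at_hi[OF G q, of 0 p] s by simp
  qed blast
  obtain r where r: "r > 0"
    "\<And>H x. (\<And>x. \<bar>translate G ?a x - H x\<bar> \<le> r) \<Longrightarrow> \<bar>(translate G ?a ^^ q) x - (H ^^ q) x\<bar> \<le> d / 2"
    using iter_close[OF degree_one_lift_translate[OF G(1), of ?a], of "d/2" q] d(1) by auto
  \<comment> \<open>With \<open>q P - p Q = 1\<close>, a periodic orbit of type \<open>P/Q\<close>
    would force \<open>Q d \<le> 2\<close>, since half of the margin \<open>d\<close> survives the
    perturbation in every block of \<open>q\<close> steps.\<close>
  obtain N :: nat where N: "real N > 2 / d" using reals_Archimedean2 by blast
  show ?thesis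
  proof (intro exI[of _ r] exI[of _ N] conjI allI impI)
    fix H P Q assume *: "degree_one_lift H \<and> mono H \<and> (\<forall>x. \<bar>G x - H x\<bar> \<le> r) \<and> Q \<ge> N \<and> Q > 0 \<and>
       int q * P - p * int Q = 1"
    then have H: "degree_one_lift H" "mono H" and close: "\<And>x. \<bar>G x - H x\<bar> \<le> r"
      and Q: "Q \<ge> N" "Q > 0" and det: "int q * P - p * int Q = 1" by auto
    note Ha = degree_one_lift_translate[OF H(1), of ?a] mono_trans[OF H(2), of ?a]
    show "hi P Q H \<le> ?a"
    proof (rule ccontr)
      assume "\<not> ?thesis"
      then obtain x where "(translate H ?a ^^ Q) x \<le> x + of_int P" using le_hi_iff[OF H Q(2), of ?a P] by auto
      then have up: "(translate H ?a ^^ (q * Q)) x \<le> x + real q * of_int P" by (rule mono_iter_le[OF Ha])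
      have step: "(translate H ?a ^^ q) y \<ge> y + (of_int p + d / 2)" for y
      proof -
        have "\<bar>(translate G ?a ^^ q) y - (translate H ?a ^^ q) y\<bar> \<le> d / 2" using close by (intro r(2)) auto
        then show ?thesis using d(2)[of y] by linarith
      qed
      have "(translate H ?a ^^ (m * q)) x \<ge> x + real m * (of_int p + d / 2)" for m
      proof (induction m)
        case (Suc m)
        have "(translate H ?a ^^ (Suc m * q)) x = (translate H ?a ^^ q) ((translate H ?a ^^ (m * q)) x)" by (simp add: funpow_add)
        then show ?case using Suc step[of "(translate H ?a ^^ (m * q)) x"]
          unfolding of_nat_Suc distrib_right mult_1 by linarith
      qed simp
      from this[of Q] up have "real Q * (of_int p + d / 2) \<le> real q * of_int P" by (simp add: mult.commute)
      moreover have "real q * of_int P - of_int p * real Q = 1"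
        using det by (metis of_int_1 of_int_diff of_int_mult of_int_of_nat_eq)
      ultimately have "real Q * d \<le> 2" by (simp add: algebra_simps)
      moreover have "real Q * d > 2"
      proof -
        have "real N * d > 2" using N d(1) by (simp add: field_simps)
        moreover have "real N * d \<le> real Q * d" using Q(1) d(1) by simp
        ultimately show ?thesis by linarith
      qed
      ultimately show False by simp
    qed
  qed (rule r(1))
qed

subsection \<open>Iterates of maps with negative Schwarzian derivative\<close>

text \<open>The last assumption is the negativity of the Schwarzian derivative multiplied by the
  square of \<open>f1\<close>, which avoids divisions.\<close>

locale smooth3 =
  fixes f f1 f2 f3 :: "real \<Rightarrow> real"
  assumes D1: "\<And>x. (f has_real_derivative f1 x) (at x)"
    and D2: "\<And>x. (f1 has_real_derivative f2 x) (at x)"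
    and D3: "\<And>x. (f2 has_real_derivative f3 x) (at x)"
    and schw: "\<And>x. f1 x \<noteq> 0 \<Longrightarrow> f3 x * f1 x - 3 / 2 * (f2 x)\<^sup>2 < 0"
begin

text \<open>The chain rule recursions for the first three derivatives of the iterates of
  \<open>f\<close>.\<close>

primrec it1 :: "nat \<Rightarrow> real \<Rightarrow> real" where
  "it1 0 x = 1"
| "it1 (Suc n) x = f1 ((f ^^ n) x) * it1 n x"

primrec it2 :: "nat \<Rightarrow> real \<Rightarrow> real" where
  "it2 0 x = 0"
| "it2 (Suc n) x = f2 ((f ^^ n) x) * (it1 n x)\<^sup>2 + f1 ((f ^^ n) x) * it2 n x"

primrec it3 :: "nat \<Rightarrow> real \<Rightarrow> real" where
  "it3 0 x = 0"
| "it3 (Suc n) x = f3 ((f ^^ n) x) * it1 n x ^ 3 + 3 * f2 ((f ^^ n) x) * it1 n x * it2 n x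
     + f1 ((f ^^ n) x) * it3 n x"

lemma D_it0: "(f ^^ n has_real_derivative it1 n x) (at x)"
proof (induction n)
  case 0
  then show ?case by (simp add: id_def)
next
  case (Suc n)
  then show ?case using DERIV_chain[OF D1 Suc] by (simp add: comp_def)
qed

lemma D_it1: "(it1 n has_real_derivative it2 n x) (at x)"
proof (induction n)
  case 0
  then show ?case by simp
next
  case (Suc n)
  have "((\<lambda>x. f1 ((f ^^ n) x)) has_real_derivative f2 ((f ^^ n) x) * it1 n x) (at x)"
    using DERIV_chain2[OF D2 D_it0] .
  from DERIV_mult[OF this Suc] show ?case
    by (simp add: power2_eq_square algebra_simps)
qed

lemma D_it2: "(it2 n has_real_derivative it3 n x) (at x)"
proof (induction n)
  case 0
  then show ?case by simp
next
  case (Suc n)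
  have 1: "((\<lambda>x. f1 ((f ^^ n) x)) has_real_derivative f2 ((f ^^ n) x) * it1 n x) (at x)"
    using DERIV_chain2[OF D2 D_it0] .
  have 2: "((\<lambda>x. f2 ((f ^^ n) x)) has_real_derivative f3 ((f ^^ n) x) * it1 n x) (at x)"
    using DERIV_chain2[OF D3 D_it0] .
  have 3: "((\<lambda>x. (it1 n x)\<^sup>2) has_real_derivative 2 * it1 n x * it2 n x) (at x)"
    using DERIV_power[OF D_it1[of n x], of 2] by (simp add: algebra_simps)
  from DERIV_add[OF DERIV_mult[OF 2 3] DERIV_mult[OF 1 Suc]] show ?case
    by (simp add: power2_eq_square power3_eq_cube algebra_simps)
qed

lemma it_schw:
  assumes "n > 0" "it1 n x \<noteq> 0"
  shows "it3 n x * it1 n x - 3 / 2 * (it2 n x)\<^sup>2 < 0"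
proof -
  have "it3 n x * it1 n x - 3 / 2 * (it2 n x)\<^sup>2 \<le> 0 \<and>
     (n > 0 \<longrightarrow> it3 n x * it1 n x - 3 / 2 * (it2 n x)\<^sup>2 < 0)"
    using assms(2)
  proof (induction n)
    case (Suc n)
    let ?A = "f1 ((f ^^ n) x)" and ?B = "f2 ((f ^^ n) x)" and ?C = "f3 ((f ^^ n) x)"
    let ?a = "it1 n x" and ?b = "it2 n x" and ?c = "it3 n x"
    have nz: "?A \<noteq> 0" "?a \<noteq> 0" using Suc.prems by auto
    \<comment> \<open>The composition rule S(f o g) = (S(f) o g) (g')^2 + S(g), multiplied by the
      square of the derivative of the composition.\<close>
    have "it3 (Suc n) x * it1 (Suc n) x - 3 / 2 * (it2 (Suc n) x)\<^sup>2 =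
      ?a ^ 4 * (?C * ?A - 3 / 2 * ?B\<^sup>2) + ?A\<^sup>2 * (?c * ?a - 3 / 2 * ?b\<^sup>2)"
      by (simp add: power2_eq_square power3_eq_cube power4_eq_xxxx algebra_simps)
    moreover have "?a ^ 4 * (?C * ?A - 3 / 2 * ?B\<^sup>2) < 0"
      using schw[OF nz(1)] nz(2) by (simp add: mult_pos_neg zero_less_power_eq)
    moreover have "?A\<^sup>2 * (?c * ?a - 3 / 2 * ?b\<^sup>2) \<le> 0"
      using Suc.IH nz(2) by (intro mult_nonneg_nonpos) auto
    ultimately show ?case by linarith
  qed simp
  then show ?thesis using assms(1) by simp
qed

text \<open>A translation has derivative 1 and Schwarzian derivative 0, whereas that of an iterate
  is negative wherever its derivative does not vanish.\<close>

lemma iterate_not_translation: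
  assumes "n > 0" "u < v" "\<And>y. u < y \<Longrightarrow> y < v \<Longrightarrow> (f ^^ n) y = y + c"
  shows False
proof -
  have open_eq: "(h has_real_derivative d') (at y)" if "(h' has_real_derivative d') (at y)"
    "\<And>z. u < z \<Longrightarrow> z < v \<Longrightarrow> h z = h' z" "u < y" "y < v" for h h' d' y
    using that(1) by (rule has_field_derivative_transform_within_open[of _ _ _ "{u<..<v}"])
      (use that in auto)
  have 1: "it1 n y = 1" if "u < y" "y < v" for y
  proof -
    have "((\<lambda>y. y + c) has_real_derivative 1) (at y)" by (auto intro!: derivative_eq_intros)
    then have "(f ^^ n has_real_derivative 1) (at y)" by (rule open_eq) (use assms(3) that in auto)
    then show ?thesis using D_it0 DERIV_unique by blast
  qed
  have 2: "it2 n y = 0" if "u < y" "y < v" for y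
  proof -
    have "((\<lambda>y. 1) has_real_derivative 0) (at y)" by simp
    then have "(it1 n has_real_derivative 0) (at y)" by (rule open_eq) (use 1 that in auto)
    then show ?thesis using D_it1 DERIV_unique by blast
  qed
  have 3: "it3 n y = 0" if "u < y" "y < v" for y
  proof -
    have "((\<lambda>y. 0) has_real_derivative 0) (at y)" by simp
    then have "(it2 n has_real_derivative 0) (at y)" by (rule open_eq) (use 2 that in auto)
    then show ?thesis using D_it2 DERIV_unique by blast
  qed
  have "u < (u + v) / 2" "(u + v) / 2 < v" using assms(2) by auto
  then show False using it_schw[OF assms(1), of "(u + v) / 2"] 1 2 3 by simp
qed

text \<open>Minimum principle: the derivative of an iterate has no positive interior minimum.\<close>

lemma iterate_no_two_fixed:
  assumes n: "n > 0" and "y < x" and pos: "\<And>z. y \<le> z \<Longrightarrow> z \<le> x \<Longrightarrow> it1 n z > 0"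
    and ends: "it1 n y \<ge> 1" "it1 n x \<ge> 1" and fix_len: "(f ^^ n) x - (f ^^ n) y = x - y"
  shows False
proof -
  have "continuous_on {y..x} (it1 n)"
    using D_it1 DERIV_isCont continuous_at_imp_continuous_on by blast
  then obtain z where z: "z \<in> {y..x}" "\<And>w. w \<in> {y..x} \<Longrightarrow> it1 n z \<le> it1 n w"
    using continuous_attains_inf[of "{y..x}" "it1 n"] \<open>y < x\<close> by auto
  have no_interior: False if w: "y < w" "w < x" "it1 n w = it1 n z" for w
  proof -
    have min: "it1 n w \<le> it1 n v" if "y \<le> v" "v \<le> x" for v using z(2) w that by simp
    have g2: "it2 n w = 0"
    proof (rule DERIV_local_min[OF D_it1])
      show "min (w - y) (x - w) > 0" using w by simp
      show "\<forall>v. \<bar>w - v\<bar> < min (w - y) (x - w) \<longrightarrow> it1 n w \<le> it1 n v"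
        by (intro allI impI min) (auto simp: abs_if split: if_splits)
    qed
    have "it1 n w > 0" using pos[of w] w(1,2) by simp
    \<comment> \<open>Where \<open>it2\<close> vanishes, the sign of the Schwarzian derivative is
      the sign of \<open>it3 * it1\<close>; the point is a strict local maximum of the derivative
      rather than a minimum.\<close>
    then have "it3 n w < 0" using it_schw[OF n, of w] g2 by (simp add: mult_less_0_iff)
    then obtain d where d: "d > 0" "\<And>h. 0 < h \<Longrightarrow> h < d \<Longrightarrow> it2 n (w + h) < it2 n w"
      using DERIV_neg_dec_right[OF D_it2] by blast
    define h where "h = min (d / 2) (x - w)"
    have h: "0 < h" "h < d" "w + h \<le> x" using d w by (auto simp: h_def)
    obtain \<xi> where \<xi>: "w < \<xi>" "\<xi> < w + h" "it1 n (w + h) - it1 n w = h * it2 n \<xi>"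
      using MVT2[of w "w + h" "it1 n" "it2 n"] D_it1 h(1) by auto
    have "it2 n \<xi> < 0" using d(2)[of "\<xi> - w"] \<xi> h g2 by simp
    then have "h * it2 n \<xi> < 0" using h(1) by (simp add: mult_pos_neg)
    then have "it1 n (w + h) < it1 n w" using \<xi>(3) by linarith
    then show False using min[of "w + h"] h w by simp
  qed
  have "it1 n z \<ge> 1"
  proof -
    have "z = y \<or> z = x" using no_interior[of z] z(1) by fastforce
    then show ?thesis using ends by auto
  qed
  \<comment> \<open>The mean slope is exactly 1, so the derivative takes the value 1 inside. As its
    minimum is at least 1, the minimum is attained in the interior after all.\<close>
  obtain \<xi> where \<xi>: "y < \<xi>" "\<xi> < x" "(f ^^ n) x - (f ^^ n) y = (x - y) * it1 n \<xi>"
    using MVT2[of y x "f ^^ n" "it1 n"] D_it0 \<open>y < x\<close> by auto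
  have "it1 n \<xi> = 1" using \<xi>(3) fix_len \<open>y < x\<close> by simp
  then have "it1 n \<xi> = it1 n z" using z(2)[of \<xi>] \<open>it1 n z \<ge> 1\<close> \<xi> by simp
  then show False using no_interior \<xi> by blast
qed

end

lemma DERIV_ge_one_right:
  assumes "(g has_real_derivative d) (at x)" "e > 0" "\<And>y. x \<le> y \<Longrightarrow> y < x + e \<Longrightarrow> g y \<ge> g x + (y - x)"
  shows "d \<ge> 1"
proof (rule ccontr)
  assume "\<not> ?thesis"
  then have neg: "d - 1 < 0" by simp
  have "((\<lambda>y. g y - y) has_real_derivative d - 1) (at x)"
    using assms(1) by (auto intro!: derivative_eq_intros)
  from DERIV_neg_dec_right[OF this neg] obtain r where r: "r > 0"
    "\<And>h. 0 < h \<Longrightarrow> h < r \<Longrightarrow> g (x + h) - (x + h) < g x - x" by blast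
  define h where "h = min r e / 2"
  have "0 < h" "h < r" "h < e" using r(1) assms(2) by (auto simp: h_def)
  then show False using r(2)[of h] assms(3)[of "x + h"] by simp
qed

lemma DERIV_ge_one_left:
  assumes "(g has_real_derivative d) (at x)" "e > 0" "\<And>y. x - e < y \<Longrightarrow> y \<le> x \<Longrightarrow> g y \<le> g x + (y - x)"
  shows "d \<ge> 1"
proof (rule ccontr)
  assume "\<not> ?thesis"
  then have neg: "d - 1 < 0" by simp
  have "((\<lambda>y. g y - y) has_real_derivative d - 1) (at x)"
    using assms(1) by (auto intro!: derivative_eq_intros)
  from DERIV_neg_dec_left[OF this neg] obtain r where r: "r > 0"
    "\<And>h. 0 < h \<Longrightarrow> h < r \<Longrightarrow> g (x - h) - (x - h) > g x - x" by blast
  define h where "h = min r e / 2"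
  have "0 < h" "h < r" "h < e" using r(1) assms(2) by (auto simp: h_def)
  then show False using r(2)[of h] assms(3)[of "x - h"] by simp
qed

text \<open>At the ends of a plateau a map agrees with its bound on one side only. Monotonicity of
  \<open>G\<close> keeps the iterates of nearby points on that side.\<close>

lemma iter_agree_right:
  fixes G H :: "real \<Rightarrow> real"
  assumes G: "degree_one_lift G" "mono G"
    and loc: "\<And>n. \<exists>e>0. \<forall>y. (G ^^ n) x \<le> y \<and> y < (G ^^ n) x + e \<longrightarrow> H y = G y"
  shows "\<exists>e>0. \<forall>y. x \<le> y \<and> y < x + e \<longrightarrow> (H ^^ n) y = (G ^^ n) y"
proof (induction n)
  case (Suc n)
  then obtain e where e: "e > 0" "\<And>y. x \<le> y \<Longrightarrow> y < x + e \<Longrightarrow> (H ^^ n) y = (G ^^ n) y" by blast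
  obtain e' where e': "e' > 0" "\<And>y. (G ^^ n) x \<le> y \<Longrightarrow> y < (G ^^ n) x + e' \<Longrightarrow> H y = G y" using loc by blast
  obtain d where d: "d > 0" "\<And>y. dist y x < d \<Longrightarrow> dist ((G ^^ n) y) ((G ^^ n) x) < e'"
    using lift_isCont[OF degree_one_lift_funpow[OF G(1)], of x n] e'(1)
    unfolding continuous_at_eps_delta by blast
  show ?case
  proof (intro exI[of _ "min e d"] conjI allI impI)
    fix y assume y: "x \<le> y \<and> y < x + min e d"
    have y': "x \<le> y" "y < x + e" using y by auto
    have "(G ^^ n) x \<le> (G ^^ n) y" using y mono_pow[OF G(2), of n] by (simp add: mono_def)
    moreover have "dist ((G ^^ n) y) ((G ^^ n) x) < e'" by (rule d(2)) (use y in \<open>auto simp: dist_real_def\<close>)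
    ultimately have "H ((G ^^ n) y) = G ((G ^^ n) y)" by (intro e'(2)) (auto simp: dist_real_def)
    then show "(H ^^ Suc n) y = (G ^^ Suc n) y" using e(2)[OF y'] by simp
  qed (use e d in auto)
qed (auto intro: exI[of _ 1])

lemma iter_agree_left:
  fixes G H :: "real \<Rightarrow> real"
  assumes G: "degree_one_lift G" "mono G"
    and loc: "\<And>n. \<exists>e>0. \<forall>y. (G ^^ n) x - e < y \<and> y \<le> (G ^^ n) x \<longrightarrow> H y = G y"
  shows "\<exists>e>0. \<forall>y. x - e < y \<and> y \<le> x \<longrightarrow> (H ^^ n) y = (G ^^ n) y"
proof -
  have "\<exists>e>0. \<forall>y. - x \<le> y \<and> y < - x + e \<longrightarrow> (refl_map H ^^ n) y = (refl_map G ^^ n) y"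
  proof (rule iter_agree_right)
    fix n
    obtain e where e: "e > 0" "\<And>y. (G ^^ n) x - e < y \<Longrightarrow> y \<le> (G ^^ n) x \<Longrightarrow> H y = G y" using loc by blast
    show "\<exists>e>0. \<forall>y. (refl_map G ^^ n) (- x) \<le> y \<and> y < (refl_map G ^^ n) (- x) + e \<longrightarrow> refl_map H y = refl_map G y"
      using e by (intro exI[of _ e]) (auto simp: funpow_refl_map refl_map_def)
  qed (use G in \<open>auto intro: degree_one_lift_refl_map mono_refl_map\<close>)
  then obtain e where e: "e > 0" "\<And>y. - x \<le> y \<Longrightarrow> y < - x + e \<Longrightarrow> (refl_map H ^^ n) y = (refl_map G ^^ n) y"
    by blast
  show ?thesis
  proof (intro exI[of _ e] conjI allI impI)
    fix y assume "x - e < y \<and> y \<le> x"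
    then show "(H ^^ n) y = (G ^^ n) y" using e(2)[of "- y"] by (simp add: funpow_refl_map)
  qed (use e in auto)
qed

subsection \<open>Interlaced orbits\<close>

lemma orbit_enum_reach:
  assumes X: "orbit_enum G P Q X" and cop: "coprime P (int Q)" and Q: "Q > 0"
  obtains n k where "X j = (G ^^ n) (X i) + of_int k"
proof -
  obtain u v where uv: "u * P + v * int Q = 1"
    using bezout_int[of P "int Q"] cop by (auto simp: coprime_iff_gcd_eq_1)
  define n where "n = nat (((j - i) * u) mod int Q)"
  have n: "int n = ((j - i) * u) mod int Q" using Q by (simp add: n_def)
  have "int Q dvd j - i - int n * P"
  proof -
    have "j - i - int n * P = (j - i) * (u * P + v * int Q) - int n * P" by (simp add: uv)
    also have "\<dots> = ((j - i) * u - ((j - i) * u) mod int Q) * P + (j - i) * v * int Q"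
      by (simp add: n algebra_simps)
    also have "\<dots> = (((j - i) * u) div int Q * int Q) * P + (j - i) * v * int Q"
      by (simp add: minus_mod_eq_div_mult)
    finally show ?thesis by simp
  qed
  then obtain k where k: "j - i - int n * P = k * int Q" by (metis dvdE mult.commute)
  have "X j = X ((i + int n * P) + k * int Q)" using k by (simp add: algebra_simps)
  also have "\<dots> = (G ^^ n) (X i) + of_int k"
    by (simp add: orbit_enum_add[OF X] orbit_enum_funpow[OF X])
  finally show ?thesis using that by blast
qed

text \<open>The offset between an index in \<open>Y\<close> and its place in \<open>X\<close> is
  periodic modulo \<open>Q\<close> and does not increase along the dynamics. As the dynamics runs
  through all indices modulo \<open>Q\<close> in one cycle, the offset is constant.\<close>

lemma orbit_interlace:
  assumes Y: "orbit_enum G P Q Y" and X: "orbit_enum H P Q X"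
    and le: "\<And>x. G x \<le> H x" and H: "mono H" and cop: "coprime P (int Q)" and Q: "Q > 0"
  obtains s where "\<And>i. X (i + s - 1) < Y i" "\<And>i. Y i \<le> X (i + s)"
proof -
  have "\<exists>j. X (j - 1) < Y i \<and> Y i \<le> X j" for i using orbit_enum_locate[OF X Q, of "Y i"] by blast
  then obtain \<kappa> where \<kappa>: "\<And>i. X (\<kappa> i - 1) < Y i" "\<And>i. Y i \<le> X (\<kappa> i)" by metis
  have uniq: "j = \<kappa> i" if "X (j - 1) < Y i" "Y i \<le> X j" for i j
  proof -
    have "X (j - 1) < X (\<kappa> i)" "X (\<kappa> i - 1) < X j" using that \<kappa>[of i] by linarith+
    then show ?thesis by (simp add: orbit_enum_less[OF X])
  qed
  define d where "d i = \<kappa> i - i" for i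
  have perQ: "d (i + k * int Q) = d i" for i k
  proof -
    have "\<kappa> i + k * int Q = \<kappa> (i + k * int Q)"
    proof (rule uniq)
      show "X (\<kappa> i + k * int Q - 1) < Y (i + k * int Q)"
        using orbit_enum_add[OF X, of "\<kappa> i - 1" k] orbit_enum_add[OF Y, of i k] \<kappa>(1)[of i]
        by (simp add: algebra_simps)
      show "Y (i + k * int Q) \<le> X (\<kappa> i + k * int Q)"
        using orbit_enum_add[OF X, of "\<kappa> i" k] orbit_enum_add[OF Y, of i k] \<kappa>(2)[of i] by simp
    qed
    then show ?thesis by (simp add: d_def)
  qed
  \<comment> \<open>The larger monotone map carries the upper neighbour of a point of
    \<open>Y\<close> above the image of that point under the smaller map.\<close>
  have decP: "d (i + P) \<le> d i" for i
  proof -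
    have "Y (i + P) = G (Y i)" using Y by (simp add: orbit_enum_def)
    also have "\<dots> \<le> H (Y i)" by (rule le)
    also have "\<dots> \<le> H (X (\<kappa> i))" using \<kappa>(2) H by (simp add: mono_def)
    also have "\<dots> = X (\<kappa> i + P)" using X by (simp add: orbit_enum_def)
    finally have "X (\<kappa> (i + P) - 1) < X (\<kappa> i + P)" using \<kappa>(1)[of "i + P"] by linarith
    then show ?thesis by (simp add: orbit_enum_less[OF X] d_def)
  qed
  have decnP: "d (i + int n * P) \<le> d i" for i n
  proof (induction n)
    case (Suc n)
    have eq: "i + int (Suc n) * P = i + int n * P + P" by (simp add: algebra_simps)
    show ?case unfolding eq using decP[of "i + int n * P"] Suc by simp
  qed simp
  \<comment> \<open>After \<open>Q\<close> steps the index has changed by a multiple of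
    \<open>Q\<close>, so a nonincreasing offset is back at its initial value and never
    dropped.\<close>
  have eqP: "d (i + P) = d i" for i
  proof -
    have eq: "i + P + int (Q - 1) * P = i + P * int Q" using Q by (simp add: of_nat_diff algebra_simps)
    have "d i \<le> d (i + P)" using decnP[of "i + P" "Q - 1"] perQ[of i P] unfolding eq by simp
    then show ?thesis using decP[of i] by simp
  qed
  have eqnP: "d (i + int n * P) = d i" for i n
  proof (induction n)
    case (Suc n)
    have eq: "i + int (Suc n) * P = i + int n * P + P" by (simp add: algebra_simps)
    show ?case unfolding eq using eqP[of "i + int n * P"] Suc by simp
  qed simp
  have const: "d j = d 0" for j
  proof -
    obtain u v where uv: "u * P + v * int Q = 1"
      using bezout_int[of P "int Q"] cop by (auto simp: coprime_iff_gcd_eq_1)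
    \<comment> \<open>\<open>n P\<close> is congruent to \<open>j\<close> modulo \<open>Q\<close>;
      the multiple of \<open>Q\<close> is added only to make the number of steps
      nonnegative.\<close>
    define n where "n = nat (j * u + \<bar>j * u\<bar> * int Q)"
    have "j * u + \<bar>j * u\<bar> * int Q \<ge> 0"
    proof -
      have "\<bar>j * u\<bar> * 1 \<le> \<bar>j * u\<bar> * int Q" using Q by (intro mult_left_mono) auto
      then show ?thesis by linarith
    qed
    then have n: "int n = j * u + \<bar>j * u\<bar> * int Q" by (simp add: n_def)
    have "j = j * (u * P + v * int Q)" by (simp add: uv)
    then have "j = 0 + int n * P + (j * v - \<bar>j * u\<bar> * P) * int Q" by (simp add: n algebra_simps)
    then show ?thesis using perQ[of "0 + int n * P" "j * v - \<bar>j * u\<bar> * P"] eqnP[of 0 n] by simp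
  qed
  have "\<kappa> i = i + d 0" for i using const[of i] by (simp add: d_def)
  then show ?thesis using that[of "d 0"] \<kappa> by (metis)
qed

lemma continuous_on_iter_translate:
  assumes "degree_one_lift G"
  shows "continuous_on UNIV (\<lambda>t. (translate G t ^^ n) x)"
proof (induction n)
  case (Suc n)
  have "continuous_on UNIV (\<lambda>t. G ((translate G t ^^ n) x) + t)"
    by (intro continuous_intros continuous_on_compose2[OF lift_cont[OF assms, of UNIV] Suc]) auto
  then show ?case by simp
qed simp

subsection \<open>Bimodal lifts\<close>

text \<open>For a bimodal lift the choice is unique, since \<open>f\<close> increases strictly from
  \<open>K\<close> to \<open>C + 1\<close>. Under reflection the maximum is at \<open>- K\<close>
  and the minimum at \<open>- C\<close>, which explains the arguments in
  \<open>left_plateau\<close>.\<close>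

definition right_plateau :: "(real \<Rightarrow> real) \<Rightarrow> real \<Rightarrow> real \<Rightarrow> real" where
  "right_plateau f C K = (SOME y. K < y \<and> y < C + 1 \<and> f y = f C)"

definition left_plateau :: "(real \<Rightarrow> real) \<Rightarrow> real \<Rightarrow> real \<Rightarrow> real" where
  "left_plateau f C K = - right_plateau (refl_map f) (- K) (- C)"

text \<open>The plateau ends are \<open>C\<^sup>+\<close> and \<open>K\<^sup>-\<close>, with \<open>K\<close> the first minimum to the right of the maximum
  \<open>C\<close>. A good orbit has no point between \<open>K\<^sup>-\<close> and \<open>C\<^sup>+\<close> modulo 1; outside these arcs \<open>f\<close>
  coincides with both of its monotone bounds.\<close>

definition good_orbit :: "(real \<Rightarrow> real) \<Rightarrow> real \<Rightarrow> real \<Rightarrow> int \<Rightarrow> nat \<Rightarrow> (int \<Rightarrow> real) \<Rightarrow> bool" where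
  "good_orbit f C K P Q X \<longleftrightarrow>
     orbit_enum (upper_bound f) P Q X \<and> orbit_enum (lower_bound f) P Q X \<and>
     X (- 1) \<le> left_plateau f C K \<and> right_plateau f C K \<le> X 0"

text \<open>\<open>C\<close> and \<open>K\<close> are consecutive turning points in any position
  relative to the integers, so that reflected and translated maps are again instances.\<close>

locale bimodal = smooth3 f f1 f2 f3 for f f1 f2 f3 :: "real \<Rightarrow> real" +
  fixes C K :: real
  assumes lift: "degree_one_lift f"
    and CK: "C < K" "K < C + 1"
    and dec: "\<And>x. C < x \<Longrightarrow> x < K \<Longrightarrow> f1 x < 0"
    and inc: "\<And>x. K < x \<Longrightarrow> x < C + 1 \<Longrightarrow> f1 x > 0"
begin

abbreviation "fu \<equiv> upper_bound f"
abbreviation "fl \<equiv> lower_bound f"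
abbreviation "Cp \<equiv> right_plateau f C K"
abbreviation "Km \<equiv> left_plateau f C K"

lemma add_int: "f (x + of_int k) = f x + of_int k"
  by (rule lift_add_int[OF lift])

lemma add_one: "f (x + 1) = f x + 1"
  using add_int[of x 1] by simp

lemma f1_add_int: "f1 (x + of_int k) = f1 x"
  by (rule lift_deriv_add_int[OF lift D1])

lemma reflected: "bimodal (refl_map f) (\<lambda>x. f1 (- x)) (\<lambda>x. - f2 (- x)) (\<lambda>x. f3 (- x)) (- K) (- C)"
proof unfold_locales
  fix x
  have minus: "(uminus has_real_derivative - 1) (at x)" by (auto intro!: derivative_eq_intros)
  show "(refl_map f has_real_derivative f1 (- x)) (at x)"
    using DERIV_minus[OF DERIV_chain2[OF D1[of "- x"] minus]] by (simp add: refl_map_def[abs_def])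
  show "((\<lambda>x. f1 (- x)) has_real_derivative - f2 (- x)) (at x)"
    using DERIV_chain2[OF D2[of "- x"] minus] by simp
  show "((\<lambda>x. - f2 (- x)) has_real_derivative f3 (- x)) (at x)"
    using DERIV_minus[OF DERIV_chain2[OF D3[of "- x"] minus]] by simp
  show "f1 (- x) \<noteq> 0 \<Longrightarrow> f3 (- x) * f1 (- x) - 3 / 2 * (- f2 (- x))\<^sup>2 < 0"
    using schw[of "- x"] by simp
  show "- K < x \<Longrightarrow> x < - C \<Longrightarrow> f1 (- x) < 0" using dec[of "- x"] by simp
  show "- C < x \<Longrightarrow> x < - K + 1 \<Longrightarrow> f1 (- x) > 0"
    using inc[of "- x + 1"] f1_add_int[of "- x" 1] by simp
qed (use CK degree_one_lift_refl_map[OF lift] in auto)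

lemma translated: "bimodal (translate f a) f1 f2 f3 C K"
proof unfold_locales
  show "((translate f a) has_real_derivative f1 x) (at x)" for x
    using D1[of x] by (auto intro!: derivative_eq_intros)
qed (use D2 D3 schw CK dec inc degree_one_lift_translate[OF lift] in auto)

lemma strict_inc: "K \<le> x \<Longrightarrow> x < y \<Longrightarrow> y \<le> C + 1 \<Longrightarrow> f x < f y"
  by (rule DERIV_pos_imp_increasing_open)
    (use D1 inc DERIV_isCont in \<open>force intro: continuous_at_imp_continuous_on\<close>)+

lemma strict_dec: "C \<le> x \<Longrightarrow> x < y \<Longrightarrow> y \<le> K \<Longrightarrow> f y < f x"
  by (rule DERIV_neg_imp_decreasing_open)
    (use D1 dec DERIV_isCont in \<open>force intro: continuous_at_imp_continuous_on\<close>)+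

lemma strict_inc_left: "K - 1 \<le> x \<Longrightarrow> x < y \<Longrightarrow> y \<le> C \<Longrightarrow> f x < f y"
  using strict_inc[of "x + 1" "y + 1"] add_one[of x] add_one[of y] by simp

lemma fK_less_fC: "f K < f C"
  using strict_dec[of C K] CK by simp

lemma right_plateau: "K < Cp" "Cp < C + 1" "f Cp = f C"
proof -
  have "\<exists>y\<ge>K. y \<le> C + 1 \<and> f y = f C"
    by (rule IVT') (use fK_less_fC add_one[of C] CK in \<open>auto intro: lift_cont[OF lift]\<close>)
  then obtain y where y: "K \<le> y" "y \<le> C + 1" "f y = f C" by blast
  have "y \<noteq> K" "y \<noteq> C + 1" using y(3) fK_less_fC add_one[of C] by auto
  then have "\<exists>y. K < y \<and> y < C + 1 \<and> f y = f C" using y by force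
  from someI_ex[OF this] show "K < Cp" "Cp < C + 1" "f Cp = f C"
    unfolding right_plateau_def by auto
qed

lemma left_plateau: "K - 1 < Km" "Km < C" "f Km = f K"
proof -
  have "- C < right_plateau (refl_map f) (- K) (- C)"
    "right_plateau (refl_map f) (- K) (- C) < - K + 1"
    "refl_map f (right_plateau (refl_map f) (- K) (- C)) = refl_map f (- K)"
    by (rule bimodal.right_plateau[OF reflected])+
  then show "K - 1 < Km" "Km < C" "f Km = f K" by (auto simp: left_plateau_def refl_map_def)
qed

lemma right_plateau_refl: "right_plateau (refl_map f) (- K) (- C) = - Km"
  by (simp add: left_plateau_def)

lemma left_plateau_refl: "left_plateau (refl_map f) (- K) (- C) = - Cp"
  by (simp add: left_plateau_def)

lemma right_plateau_translate: "right_plateau (translate f a) C K = Cp"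
  by (simp add: right_plateau_def)

lemma left_plateau_translate: "left_plateau (translate f a) C K = Km"
  by (simp add: left_plateau_def right_plateau_def refl_map_def)

lemma below_fC: "C - 1 \<le> y \<Longrightarrow> y \<le> Cp \<Longrightarrow> f y \<le> f C"
proof -
  assume y: "C - 1 \<le> y" "y \<le> Cp"
  consider "y \<le> K - 1" | "K - 1 \<le> y" "y \<le> C" | "C \<le> y" "y \<le> K" | "K \<le> y" by linarith
  then show "f y \<le> f C"
  proof cases
    case 1
    then have "f (y + 1) \<le> f C" using strict_dec[of C "y + 1"] y by (cases "y + 1 = C") auto
    then show ?thesis using add_one[of y] by simp
  next
    case 2
    then show ?thesis using strict_inc_left[of y C] by (cases "y = C") auto
  next
    case 3
    then show ?thesis using strict_dec[of C y] by (cases "y = C") auto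
  next
    case 4
    then show ?thesis using strict_inc[of y Cp] y right_plateau by (cases "y = Cp") auto
  qed
qed

lemma fu_flat: "C \<le> x \<Longrightarrow> x \<le> Cp \<Longrightarrow> fu x = f C"
proof (rule antisym)
  assume x: "C \<le> x" "x \<le> Cp"
  obtain y where "x - 1 \<le> y" "y \<le> x" "f y = fu x" using upper_bound_attained[OF lift] by blast
  then show "fu x \<le> f C" using below_fC[of y] x by simp
  show "f C \<le> fu x" by (rule upper_bound_ge[OF lift x(1)])
qed

lemma fu_inc: "Cp \<le> x \<Longrightarrow> x \<le> C + 1 \<Longrightarrow> fu x = f x"
proof (rule antisym)
  assume x: "Cp \<le> x" "x \<le> C + 1"
  obtain y where y: "x - 1 \<le> y" "y \<le> x" "f y = fu x" using upper_bound_attained[OF lift] by blast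
  have fx: "f C \<le> f x" using strict_inc[of Cp x] x right_plateau by (cases "x = Cp") auto
  have "f y \<le> f x"
  proof (cases "y \<le> Cp")
    case True
    then show ?thesis using below_fC[of y] y x fx CK right_plateau by simp
  next
    case False
    then show ?thesis using strict_inc[of y x] y x right_plateau by (cases "y = x") auto
  qed
  then show "fu x \<le> f x" using y by simp
  show "f x \<le> fu x" by (rule upper_bound_ge[OF lift]) simp
qed

lemma fl_flat: "Km \<le> x \<Longrightarrow> x \<le> K \<Longrightarrow> fl x = f K"
  using bimodal.fu_flat[OF reflected, of "- x"]
  by (simp add: lower_bound_refl right_plateau_refl) (simp add: refl_map_def)

lemma fl_inc: "K \<le> x \<Longrightarrow> x \<le> Km + 1 \<Longrightarrow> fl x = f x"
  using bimodal.fu_inc[OF reflected, of "- (x - 1)"] add_one[of "x - 1"]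
    lift_add_int[OF degree_one_lift_lower_bound[OF lift], of "x - 1" 1]
  by (simp add: lower_bound_refl right_plateau_refl) (simp add: refl_map_def)

lemmas fu = degree_one_lift_upper_bound[OF lift] mono_upper_bound[OF lift]
lemmas fl = degree_one_lift_lower_bound[OF lift] mono_lower_bound[OF lift]

lemma fu_add_int: "fu (x + of_int k) = fu x + of_int k"
  by (rule lift_add_int[OF fu(1)])

lemma fl_add_int: "fl (x + of_int k) = fl x + of_int k"
  by (rule lift_add_int[OF fl(1)])

text \<open>Reducing the index modulo \<open>Q\<close> brings a point between \<open>X 0\<close> and
  \<open>X (-1) + 1\<close>. The last two clauses record that an end of the arc can be hit only if
  \<open>X 0\<close> or \<open>X (-1)\<close> sits at its plateau end.\<close>

lemma orbit_in_arc:
  assumes per: "\<And>i. X (i + int Q) = X i + 1" and sm: "strict_mono X" and Q: "Q > 0"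
    and X: "X (- 1) \<le> Km" "Cp \<le> X 0"
  obtains k :: int where "Cp \<le> X i + of_int k" "X i + of_int k \<le> Km + 1"
    "Cp = X i + of_int k \<Longrightarrow> X 0 = Cp" "X i + of_int k = Km + 1 \<Longrightarrow> X (- 1) = Km"
proof -
  let ?i = "i mod int Q"
  \<comment> \<open>Only order and periodicity of the list matter here, so the dynamics is replaced
    by the identity with shift 0.\<close>
  have "orbit_enum (\<lambda>x. x) 0 Q X" using per sm by (simp add: orbit_enum_def)
  from orbit_enum_add[OF this, of ?i "i div int Q"]
  have "X i = X ?i + of_int (i div int Q)" by simp
  then have eq: "X i + of_int (- (i div int Q)) = X ?i" by simp
  have "?i \<ge> 0" "?i \<le> - 1 + int Q" using Q by (auto simp: pos_mod_bound add.commute le_less_trans zle_diff1_eq)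
  then have "X 0 \<le> X ?i" "X ?i \<le> X (- 1 + int Q)" using sm by (auto simp: strict_mono_less_eq)
  then have "X 0 \<le> X ?i" "X ?i \<le> X (- 1) + 1" using per[of "- 1"] by auto
  then show ?thesis using that[of "- (i div int Q)", unfolded eq] X by linarith
qed

lemma on_arc: "Cp \<le> x + of_int k \<Longrightarrow> x + of_int k \<le> Km + 1 \<Longrightarrow> fu x = f x \<and> fl x = f x"
  using fu_inc[of "x + of_int k"] fl_inc[of "x + of_int k"] right_plateau left_plateau
  by (simp add: fu_add_int fl_add_int add_int)

lemma good_orbitD:
  assumes "good_orbit f C K P Q X" "Q > 0"
  shows "f (X i) = X (i + P)" "fu (X i) = X (i + P)" "fl (X i) = X (i + P)"
proof -
  have X: "\<And>i. X (i + int Q) = X i + 1" "strict_mono X" "X (- 1) \<le> Km" "Cp \<le> X 0"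
    using assms(1) by (auto simp: good_orbit_def orbit_enum_def)
  obtain k :: int where "Cp \<le> X i + of_int k" "X i + of_int k \<le> Km + 1"
    using orbit_in_arc[OF X(1,2) assms(2) X(3,4)] by blast
  from on_arc[OF this] show "f (X i) = X (i + P)" "fu (X i) = X (i + P)" "fl (X i) = X (i + P)"
    using assms(1) by (auto simp: good_orbit_def orbit_enum_def)
qed

text \<open>An orbit of either bound suffices: off the hole between the plateau ends both bounds
  coincide with \<open>f\<close>.\<close>

lemma good_orbitI:
  assumes "orbit_enum G P Q X" "G = fu \<or> G = fl" "Q > 0" "X (- 1) \<le> Km" "Cp \<le> X 0"
  shows "good_orbit f C K P Q X"
proof -
  have X: "\<And>i. X (i + int Q) = X i + 1" "strict_mono X" "\<And>i. G (X i) = X (i + P)"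
    using assms(1) by (auto simp: orbit_enum_def)
  have "fu (X i) = fl (X i)" for i
  proof -
    obtain k :: int where "Cp \<le> X i + of_int k" "X i + of_int k \<le> Km + 1"
      using orbit_in_arc[OF X(1,2) assms(3-5)] by blast
    from on_arc[OF this] show ?thesis by simp
  qed
  then show ?thesis using X assms(2,4,5) by (auto simp: good_orbit_def orbit_enum_def)
qed

lemma good_orbit_has_type:
  assumes "good_orbit f C K P Q X" "Q > 0"
  shows "has_type fu P Q" "has_type fl P Q"
proof -
  have X: "orbit_enum fu P Q X" "orbit_enum fl P Q X" using assms(1) by (auto simp: good_orbit_def)
  have "X (0 + int Q * P) = X 0 + of_int P"
    using orbit_enum_add[OF X(1), of 0 P] by (simp add: mult.commute)
  then show "has_type fu P Q" "has_type fl P Q"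
    using orbit_enum_funpow[OF X(1), of Q 0] orbit_enum_funpow[OF X(2), of Q 0]
    unfolding has_type_def by metis+
qed

text \<open>Reversing the order with \<open>i\<close> replaced by \<open>- 1 - i\<close>
  interchanges the two points next to the hole.\<close>

lemma good_orbit_refl:
  assumes "good_orbit f C K P Q X"
  shows "good_orbit (refl_map f) (- K) (- C) (- P) Q (\<lambda>i. - X (- 1 - i))"
proof -
  have en: "orbit_enum (refl_map G) (- P) Q (\<lambda>i. - X (- 1 - i))" if "orbit_enum G P Q X" for G
    unfolding orbit_enum_def
  proof (intro conjI allI)
    show "strict_mono (\<lambda>i. - X (- 1 - i))"
      using that by (auto simp: orbit_enum_def strict_mono_def)
    fix i
    show "- X (- 1 - (i + int Q)) = - X (- 1 - i) + 1"
      using orbit_enum_add[OF that, of "- 1 - i" "- 1"] by (simp add: algebra_simps)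
    have "G (X (- 1 - i)) = X (- 1 - i + P)" using that by (simp add: orbit_enum_def)
    then show "refl_map G (- X (- 1 - i)) = - X (- 1 - (i + - P))"
      by (simp add: refl_map_def algebra_simps)
  qed
  show ?thesis
    using assms en[of fu] en[of fl]
    unfolding good_orbit_def right_plateau_refl left_plateau_refl
    by (simp add: lower_bound_refl)
qed

end

lemma upper_bound_translate': "degree_one_lift f \<Longrightarrow> upper_bound (translate f a) = translate (upper_bound f) a"
  by (rule ext) (rule upper_bound_translate)

lemma lower_bound_translate': "degree_one_lift f \<Longrightarrow> lower_bound (translate f a) = translate (lower_bound f) a"
  by (rule ext) (rule lower_bound_translate)

lemma upper_bound_lipschitz:
  assumes "degree_one_lift f" "\<And>x y. \<bar>f x - f y\<bar> \<le> B * \<bar>x - y\<bar>"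
  shows "\<bar>upper_bound f x - upper_bound f y\<bar> \<le> B * \<bar>x - y\<bar>"
proof -
  have le: "upper_bound f v \<le> upper_bound f u + B * (v - u)" if "u \<le> v" for u v
  proof (rule upper_bound_leI)
    have "B \<ge> 0" using assms(2)[of 0 1] abs_ge_zero[of "f 0 - f 1"] by simp
    fix z assume "z \<le> v"
    show "f z \<le> upper_bound f u + B * (v - u)"
    proof (cases "z \<le> u")
      case True
      then show ?thesis using upper_bound_ge[OF assms(1) True] \<open>B \<ge> 0\<close> that by (simp add: add_increasing2)
    next
      case False
      then have "f z \<le> f u + B * (z - u)" using assms(2)[of z u] by simp
      moreover have "B * (z - u) \<le> B * (v - u)" using \<open>B \<ge> 0\<close> \<open>z \<le> v\<close> by (intro mult_left_mono) auto
      ultimately show ?thesis using upper_bound_ge[OF assms(1), of u u] by simp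
    qed
  qed
  have mono: "u \<le> v \<Longrightarrow> upper_bound f u \<le> upper_bound f v" for u v
    using mono_upper_bound[OF assms(1)] by (simp add: mono_def)
  show ?thesis
  proof (cases "x \<le> y")
    case True
    then show ?thesis using le[of x y] mono[of x y] by simp
  next
    case False
    then show ?thesis using le[of y x] mono[of y x] by simp
  qed
qed

lemma iter_lipschitz:
  fixes G :: "real \<Rightarrow> real"
  assumes "\<And>x y. \<bar>G x - G y\<bar> \<le> B * \<bar>x - y\<bar>" "B \<ge> 0"
  shows "\<bar>(G ^^ n) x - (G ^^ n) y\<bar> \<le> B ^ n * \<bar>x - y\<bar>"
proof (induction n)
  case (Suc n)
  have "\<bar>(G ^^ Suc n) x - (G ^^ Suc n) y\<bar> \<le> B * \<bar>(G ^^ n) x - (G ^^ n) y\<bar>"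
    using assms(1) by simp
  also have "\<dots> \<le> B * (B ^ n * \<bar>x - y\<bar>)" using Suc assms(2) by (intro mult_left_mono) auto
  finally show ?case by simp
qed simp

context bimodal
begin

subsection \<open>Locking forces a periodic orbit off both plateaus\<close>

text \<open>A point of the plateau left of \<open>Cp\<close> has the same image as
  \<open>Cp\<close>. If it were periodic, \<open>Cp\<close> would come back to a point further left
  and be moved by less than \<open>P\<close>.\<close>

lemma upper_orbit_avoids:
  assumes X: "orbit_enum fu P Q X" and Q: "Q > 0" and above: "\<And>x. x + of_int P \<le> (fu ^^ Q) x"
  shows "\<not> (C \<le> X i + of_int k \<and> X i + of_int k < Cp)"
proof
  assume *: "C \<le> X i + of_int k \<and> X i + of_int k < Cp"
  let ?j = "i + k * int Q"
  have Xj: "X ?j = X i + of_int k" by (rule orbit_enum_add[OF X])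
  obtain r where r: "Q = Suc r" using Q by (cases Q) auto
  have "fu (X ?j) = f C" "fu Cp = f C" using * Xj right_plateau CK by (auto intro!: fu_flat)
  then have "(fu ^^ Q) (X ?j) = (fu ^^ Q) Cp" by (simp add: r funpow_Suc_right del: funpow.simps)
  moreover have "(fu ^^ Q) (X ?j) = X ?j + of_int P"
    using orbit_enum_funpow[OF X, of Q ?j] orbit_enum_add[OF X, of ?j P] by (simp add: mult.commute)
  ultimately show False using above[of Cp] * Xj by simp
qed

text \<open>The part of the hole where the upper bound still increases is excluded as follows.
  Locking gives a periodic orbit \<open>Z\<close> of the lower bound which interlaces with
  \<open>X\<close>, and \<open>f\<close> increases on all the intervals from \<open>Z i\<close> to
  \<open>X (i + 1)\<close> and maps them to each other. Hence \<open>f ^^ Q\<close> fixes both ends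
  of one of them up to the translation by \<open>P\<close>. Its slope is at least 1 at both ends by
  one-sided comparison with the bounds, which contradicts the minimum principle.\<close>

lemma locked_no_hole_orbit:
  assumes Q: "Q > 0" and cop: "coprime P (int Q)" and tl: "has_type fl P Q"
    and above: "\<And>x. x + of_int P \<le> (fu ^^ Q) x"
    and X: "orbit_enum fu P Q X" and X0: "Km < X 0" "X 0 < C"
  shows False
proof -
  note avoid = upper_orbit_avoids[OF X Q above]
  obtain r where r: "Q = Suc r" using Q by (cases Q) auto
  have XQ: "(fu ^^ Q) (X i) = X i + of_int P" for i
    using orbit_enum_funpow[OF X, of Q i] orbit_enum_add[OF X, of i P] by (simp add: mult.commute)
  \<comment> \<open>Up to \<open>K\<close> the lower bound keeps the value it has at
    \<open>X 0\<close>, and from there the upper bound arrives at exactly \<open>X 0 + P\<close>. A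
    periodic point of the lower bound right of \<open>X 0\<close> therefore lies beyond
    \<open>K\<close>.\<close>
  have flat: "(fl ^^ Q) y \<le> X 0 + of_int P" if "X 0 \<le> y" "y \<le> K" for y
  proof -
    have "fl y = fl (X 0)" using fl_flat[of y] fl_flat[of "X 0"] that X0 CK by simp
    then have "(fl ^^ Q) y = (fl ^^ Q) (X 0)" by (simp add: r funpow_Suc_right del: funpow.simps)
    also have "\<dots> \<le> (fu ^^ Q) (X 0)" by (rule funpow_le_funpow[OF lower_le_upper[OF lift] fu(2)]) simp
    finally show ?thesis by (simp add: XQ)
  qed
  obtain w where "(fl ^^ Q) w = w + of_int P" using tl by (auto simp: has_type_def)
  from orbit_enum_exists[OF fl this Q cop] obtain Y where Y: "orbit_enum fl P Q Y" by metis
  obtain s where s: "\<And>i. X (i + s - 1) < Y i" "\<And>i. Y i \<le> X (i + s)"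
    using orbit_interlace[OF Y X lower_le_upper[OF lift] fu(2) cop Q] by blast
  define y1 where "y1 = Y (1 - s)"
  have y1: "X 0 < y1" "y1 \<le> X 1" using s[of "1 - s"] by (auto simp: y1_def)
  have y1fix: "(fl ^^ Q) y1 = y1 + of_int P"
    unfolding y1_def using orbit_enum_funpow[OF Y, of Q "1 - s"] orbit_enum_add[OF Y, of "1 - s" P]
    by (simp add: mult.commute)
  have "K < y1" using flat[of y1] y1fix y1 by force
  \<comment> \<open>Its leftmost point is taken because all points between \<open>K\<close> and it
    are moved by less than \<open>P\<close>. This gives the slope estimate from the left and keeps
    the orbit off the plateau of the lower bound.\<close>
  define S where "S = {K..y1} \<inter> {y. y + of_int P \<le> (fl ^^ Q) y}"
  have contQ: "continuous_on T (fl ^^ n)" for T n by (rule lift_cont[OF degree_one_lift_funpow[OF fl(1)]])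
  have "compact S" unfolding S_def
    by (intro compact_Int_closed closed_Collect_le continuous_intros contQ) auto
  moreover have "y1 \<in> S" using \<open>K < y1\<close> y1fix by (simp add: S_def)
  ultimately obtain y0 where y0: "y0 \<in> S" "\<And>y. y \<in> S \<Longrightarrow> y0 \<le> y"
    using compact_attains_inf[of S] by auto
  have "K \<notin> S" using flat[of K] X0 CK by (simp add: S_def)
  then have y0K: "K < y0" "y0 \<le> y1" using y0(1) by (auto simp: S_def less_le)
  have below: "(fl ^^ Q) y < y + of_int P" if "K \<le> y" "y < y0" for y
    using y0(2)[of y] that y0K by (force simp: S_def)
  have y0fix: "(fl ^^ Q) y0 = y0 + of_int P"
  proof (rule ccontr)
    assume "\<not> ?thesis"
    then have pos: "(fl ^^ Q) y0 - y0 - of_int P > 0" using y0(1) by (simp add: S_def)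
    have neg: "(fl ^^ Q) K - K - of_int P < 0" using below[of K] y0K by simp
    have "\<exists>y\<ge>K. y \<le> y0 \<and> (fl ^^ Q) y - y - of_int P = 0"
      by (rule IVT') (use pos neg y0K in \<open>auto intro!: continuous_intros contQ\<close>)
    then obtain y where y: "K \<le> y" "y \<le> y0" "(fl ^^ Q) y - y - of_int P = 0" by blast
    then have "y \<in> S" using y0K by (simp add: S_def)
    then have "y = y0" using y0(2)[of y] y by simp
    then show False using y(3) pos by simp
  qed
  obtain Z where Z: "orbit_enum fl P Q Z" "Z 0 = y0"
    using orbit_enum_exists[OF fl y0fix Q cop] by metis
  obtain s' where s': "\<And>i. X (i + s' - 1) < Z i" "\<And>i. Z i \<le> X (i + s')"
    using orbit_interlace[OF Z(1) X lower_le_upper[OF lift] fu(2) cop Q] by blast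
  have "X (s' - 1) < X 1" "X 0 < X s'" using s'[of 0] Z(2) y0K y1 X0 CK by auto
  then have "s' = 1" by (simp add: orbit_enum_less[OF X])
  then have XZ: "X i < Z i" "Z i \<le> X (i + 1)" for i using s'[of i] by auto
  \<comment> \<open>If the orbit met the plateau away from its left end, points slightly left of
    \<open>y0\<close> would merge with the orbit of \<open>y0\<close> and later be moved too far for
    points that are moved by less than \<open>P\<close>.\<close>
  have Zavoid: "\<not> (Km < Z j + of_int k \<and> Z j + of_int k \<le> K)" for j k
  proof
    assume *: "Km < Z j + of_int k \<and> Z j + of_int k \<le> K"
    obtain n l where nl: "Z j = (fl ^^ n) (Z 0) + of_int l" using orbit_enum_reach[OF Z(1) cop Q] by blast
    define c where "c = l + k"
    have c: "(fl ^^ n) y0 + of_int c = Z j + of_int k" using nl Z(2) by (simp add: c_def)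
    obtain d where d: "d > 0" "\<And>y. dist y y0 < d \<Longrightarrow> dist ((fl ^^ n) y) ((fl ^^ n) y0) < Z j + of_int k - Km"
      using lift_isCont[OF degree_one_lift_funpow[OF fl(1)], of y0 n] * unfolding continuous_at_eps_delta
      by (metis diff_gt_0_iff_gt)
    define y where "y = max K (y0 - d / 2)"
    have y: "K \<le> y" "y < y0" "dist y y0 < d" using d(1) y0K by (auto simp: y_def dist_real_def max_def)
    have "(fl ^^ n) y \<le> (fl ^^ n) y0" using y(2) mono_pow[OF fl(2), of n] by (simp add: mono_def)
    then have "Km < (fl ^^ n) y + of_int c" "(fl ^^ n) y + of_int c \<le> K"
      using d(2)[OF y(3)] c * by (auto simp: dist_real_def)
    then have "fl ((fl ^^ n) y + of_int c) = f K" by (intro fl_flat) auto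
    moreover have "fl ((fl ^^ n) y0 + of_int c) = f K" using c * by (intro fl_flat) auto
    ultimately have eq: "(fl ^^ Suc n) y = (fl ^^ Suc n) y0" by (simp add: fl_add_int)
    have "Suc n * 1 \<le> Suc n * Q" using Q by (intro mult_le_mono) auto
    then have split: "Suc n * Q = (Suc n * Q - Suc n) + Suc n" by simp
    have "(fl ^^ (Suc n * Q)) y = (fl ^^ (Suc n * Q)) y0"
      by (subst (1 2) split, subst (1 2) funpow_add) (use eq in \<open>simp del: funpow.simps\<close>)
    moreover have "(fl ^^ (Suc n * Q)) y0 = y0 + of_int (int (Suc n) * P)"
      by (rule periodic_iter[OF fl(1) y0fix])
    moreover have "(fl ^^ (Suc n * Q)) y \<le> y + real (Suc n) * of_int P"
      by (rule mono_iter_le[OF fl]) (use below[OF y(1,2)] in simp)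
    ultimately show False using y(2) by simp
  qed
  \<comment> \<open>After a common integer translation both ends of each interval lie in the
    increasing arc from \<open>K\<close> to \<open>C + 1\<close>: \<open>Z i\<close> on the part
    where the lower bound equals \<open>f\<close>, \<open>X (i + 1)\<close> on the part where the
    upper bound does.\<close>
  have pos: "\<exists>k::int. K < Z i + of_int k \<and> Z i + of_int k \<le> Km + 1 \<and> Cp \<le> X (i + 1) + of_int k \<and> X (i + 1) + of_int k < C + 1" for i
  proof -
    let ?i = "i mod int Q" let ?k = "- (i div int Q)"
    have eqZ: "Z i + of_int ?k = Z ?i"
      using orbit_enum_add[OF Z(1), of ?i "i div int Q"] by simp
    have "?i + 1 + i div int Q * int Q = i + 1" by simp
    then have eqX: "X (i + 1) + of_int ?k = X (?i + 1)"
      using orbit_enum_add[OF X, of "?i + 1" "i div int Q"] by simp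
    have i: "0 \<le> ?i" "?i + 1 \<le> int Q" using Q by (auto simp: zless_imp_add1_zle)
    have "Z 0 \<le> Z ?i" using i by (simp add: orbit_enum_le[OF Z(1)])
    then have KZ: "K < Z ?i" using Z(2) y0K by simp
    have "X (?i + 1) \<le> X (0 + 1 * int Q)" using i by (simp add: orbit_enum_le[OF X])
    then have XC: "X (?i + 1) < C + 1" using X0 orbit_enum_add[OF X, of 0 1] by simp
    have "Cp \<le> X (?i + 1)" using avoid[of "?i + 1" 0] KZ XZ(2)[of ?i] CK by simp
    moreover have "Z ?i \<le> Km + 1" using Zavoid[of ?i "- 1"] XC XZ(2)[of ?i] CK by simp
    ultimately show ?thesis using KZ XC eqZ eqX by (intro exI[of _ ?k]) simp
  qed
  have fX: "f (X (i + 1)) = X (i + 1 + P)" for i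
  proof -
    obtain k :: int where k: "Cp \<le> X (i + 1) + of_int k" "X (i + 1) + of_int k < C + 1" using pos[of i] by blast
    then have "fu (X (i + 1) + of_int k) = f (X (i + 1) + of_int k)" by (intro fu_inc) auto
    then have "fu (X (i + 1)) = f (X (i + 1))" by (simp add: fu_add_int add_int)
    then show ?thesis using X by (simp add: orbit_enum_def)
  qed
  have fZ: "f (Z i) = Z (i + P)" for i
  proof -
    obtain k :: int where k: "K < Z i + of_int k" "Z i + of_int k \<le> Km + 1" using pos[of i] by blast
    then have "fl (Z i + of_int k) = f (Z i + of_int k)" by (intro fl_inc) auto
    then have "fl (Z i) = f (Z i)" by (simp add: fl_add_int add_int)
    then show ?thesis using Z(1) by (simp add: orbit_enum_def)
  qed
  \<comment> \<open>The whole interval from \<open>Z 0\<close> to \<open>X 1\<close> stays in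
    increasing arcs under iteration, so the derivative of the iterate is positive on it.\<close>
  have band: "Z (int n * P) \<le> (f ^^ n) z \<and> (f ^^ n) z \<le> X (int n * P + 1) \<and> it1 n z > 0"
    if z: "Z 0 \<le> z" "z \<le> X 1" for z n
  proof (induction n)
    case (Suc n)
    let ?i = "int n * P"
    have eq: "int (Suc n) * P = ?i + P" by (simp add: algebra_simps)
    obtain k :: int where k: "K < Z ?i + of_int k" "X (?i + 1) + of_int k < C + 1" using pos[of ?i] by blast
    have le: "f u \<le> f v" if "Z ?i \<le> u" "u \<le> v" "v \<le> X (?i + 1)" for u v
      using strict_inc[of "u + of_int k" "v + of_int k"] that k by (cases "u = v") (auto simp: add_int)
    have "f1 ((f ^^ n) z + of_int k) > 0" using Suc k by (intro inc) auto
    then have "f1 ((f ^^ n) z) > 0" by (simp add: f1_add_int)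
    moreover have "f (Z ?i) \<le> f ((f ^^ n) z)" "f ((f ^^ n) z) \<le> f (X (?i + 1))" using Suc by (auto intro!: le)
    moreover have eq2: "?i + P + 1 = ?i + 1 + P" by simp
    ultimately show ?case using Suc fZ[of ?i] fX[of ?i] unfolding eq eq2 by simp
  qed (use z in simp)
  have fnZ: "(f ^^ n) (Z 0) = Z (int n * P)" for n
  proof (induction n)
    case (Suc n)
    then show ?case using fZ[of "int n * P"] by (simp add: algebra_simps)
  qed simp
  have fnX: "(f ^^ n) (X 1) = X (int n * P + 1)" for n
  proof (induction n)
    case (Suc n)
    then show ?case using fX[of "int n * P"] by (simp add: algebra_simps)
  qed simp
  show False
  proof (cases "Z 0 = X 1")
    case True
    \<comment> \<open>The two orbits would coincide, although \<open>X 0\<close> lies in the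
      interval that \<open>Z\<close> avoids.\<close>
    then have eq: "Z (int n * P) = X (int n * P + 1)" for n using fnZ[of n] fnX[of n] by simp
    obtain n k where "X 0 = (fu ^^ n) (X 1) + of_int k" using orbit_enum_reach[OF X cop Q] by blast
    then have "X 0 = Z (int n * P) + of_int k"
      using orbit_enum_funpow[OF X, of n 1] eq[of n] by (simp add: add.commute)
    then show False using Zavoid[of "int n * P" k] X0 CK by simp
  next
    case False
    then have lt: "Z 0 < X 1" using XZ(2)[of 0] by simp
    have Q1: "(f ^^ Q) (X 1) = X 1 + of_int P"
      using fnX[of Q] orbit_enum_add[OF X, of 1 P] by (simp add: mult.commute add.commute)
    have Q0: "(f ^^ Q) (Z 0) = Z 0 + of_int P"
      using fnZ[of Q] orbit_enum_add[OF Z(1), of 0 P] by (simp add: mult.commute)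
    \<comment> \<open>To the right of \<open>X 1\<close> the iterate is that of the upper bound,
      which moves every point by at least \<open>P\<close>; hence the slope at \<open>X 1\<close> is
      at least 1.\<close>
    have "\<exists>e>0. \<forall>y. X 1 \<le> y \<and> y < X 1 + e \<longrightarrow> (f ^^ Q) y = (fu ^^ Q) y"
    proof (rule iter_agree_right[OF fu])
      fix n
      let ?x = "(fu ^^ n) (X 1)"
      have x: "?x = X (int n * P + 1)" using orbit_enum_funpow[OF X, of n 1] by (simp add: add.commute)
      obtain k :: int where k: "Cp \<le> ?x + of_int k" "?x + of_int k < C + 1" using pos[of "int n * P"] x by auto
      show "\<exists>e>0. \<forall>y. ?x \<le> y \<and> y < ?x + e \<longrightarrow> f y = fu y"
      proof (intro exI[of _ "C + 1 - (?x + of_int k)"] conjI allI impI)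
        fix y assume "?x \<le> y \<and> y < ?x + (C + 1 - (?x + of_int k))"
        then have "fu (y + of_int k) = f (y + of_int k)" using k by (intro fu_inc) auto
        then show "f y = fu y" by (simp add: fu_add_int add_int)
      qed (use k in simp)
    qed
    then obtain e where e: "e > 0" "\<And>y. X 1 \<le> y \<Longrightarrow> y < X 1 + e \<Longrightarrow> (f ^^ Q) y = (fu ^^ Q) y" by blast
    have d1: "it1 Q (X 1) \<ge> 1"
    proof (rule DERIV_ge_one_right[OF D_it0 e(1)])
      fix y assume "X 1 \<le> y" "y < X 1 + e"
      then show "(f ^^ Q) (X 1) + (y - X 1) \<le> (f ^^ Q) y" using e(2)[of y] above[of y] Q1 by simp
    qed
    \<comment> \<open>To the left of \<open>Z 0\<close> the iterate is that of the lower bound,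
      which moves these points by less than \<open>P\<close>.\<close>
    have "\<exists>e>0. \<forall>y. Z 0 - e < y \<and> y \<le> Z 0 \<longrightarrow> (f ^^ Q) y = (fl ^^ Q) y"
    proof (rule iter_agree_left[OF fl])
      fix n
      let ?x = "(fl ^^ n) (Z 0)"
      have x: "?x = Z (int n * P)" using orbit_enum_funpow[OF Z(1), of n 0] by simp
      obtain k :: int where k: "K < ?x + of_int k" "?x + of_int k \<le> Km + 1" using pos[of "int n * P"] x by auto
      show "\<exists>e>0. \<forall>y. ?x - e < y \<and> y \<le> ?x \<longrightarrow> f y = fl y"
      proof (intro exI[of _ "?x + of_int k - K"] conjI allI impI)
        fix y assume "?x - (?x + of_int k - K) < y \<and> y \<le> ?x"
        then have "fl (y + of_int k) = f (y + of_int k)" using k by (intro fl_inc) auto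
        then show "f y = fl y" by (simp add: fl_add_int add_int)
      qed (use k in simp)
    qed
    then obtain e' where e': "e' > 0" "\<And>y. Z 0 - e' < y \<Longrightarrow> y \<le> Z 0 \<Longrightarrow> (f ^^ Q) y = (fl ^^ Q) y" by blast
    have d0: "it1 Q (Z 0) \<ge> 1"
    proof (rule DERIV_ge_one_left[OF D_it0])
      show "min e' (Z 0 - K) > 0" using e'(1) y0K Z(2) by simp
      fix y assume y: "Z 0 - min e' (Z 0 - K) < y" "y \<le> Z 0"
      have "K < y" using y by (simp add: min_def split: if_splits)
      then have "(fl ^^ Q) y \<le> y + of_int P"
        using below[of y] y0fix y Z(2) by (cases "y = y0") auto
      then show "(f ^^ Q) y \<le> (f ^^ Q) (Z 0) + (y - Z 0)" using e'(2)[of y] y Q0 by simp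
    qed
    show False
      by (rule iterate_no_two_fixed[OF Q lt _ d0 d1]) (use band Q0 Q1 in auto)
  qed
qed

text \<open>At the right end of the locking interval no point of an orbit of the upper bound lies
  strictly between the plateau ends, so it remains to shift the indices such that the hole falls
  between -1 and 0.\<close>

lemma locked_good_orbit:
  assumes Q: "Q > 0" and cop: "coprime P (int Q)" and tl: "has_type fl P Q" and tu: "has_type fu P Q"
    and above: "\<And>x. x + of_int P \<le> (fu ^^ Q) x"
  obtains X where "good_orbit f C K P Q X"
proof -
  obtain w where "(fu ^^ Q) w = w + of_int P" using tu by (auto simp: has_type_def)
  from orbit_enum_exists[OF fu this Q cop] obtain X where X: "orbit_enum fu P Q X" by metis
  have no: "\<not> (Km < X j \<and> X j < C)" for j
    using locked_no_hole_orbit[OF Q cop tl above orbit_enum_shift[OF X, of j]] by auto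
  obtain i where i: "X (i - 1) < Cp" "Cp \<le> X i" using orbit_enum_locate[OF X Q] by blast
  have "X (i - 1) \<le> Km" using no[of "i - 1"] upper_orbit_avoids[OF X Q above, of "i - 1" 0] i(1) by force
  then have "good_orbit f C K P Q (\<lambda>j. X (j + i))"
    using i(2) by (intro good_orbitI[OF orbit_enum_shift[OF X]]) (auto simp: Q)
  then show ?thesis using that by blast
qed

subsection \<open>Tips\<close>

text \<open>If \<open>X 0\<close> were beyond \<open>Cp\<close>, all orbit points would have left
  neighbourhoods on which \<open>f\<close> equals both bounds. At a tip one bound moves points by at
  most \<open>P\<close> and the other by at least \<open>P\<close>, so an iterate of
  \<open>f\<close> would be a translation on an interval.\<close>

lemma tip_right:
  assumes X: "good_orbit f C K P Q X" and Q: "Q > 0"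
    and below: "\<And>x. (fl ^^ Q) x \<le> x + of_int P" and above: "\<And>x. x + of_int P \<le> (fu ^^ Q) x"
  shows "X 0 = Cp"
proof (rule ccontr)
  assume "X 0 \<noteq> Cp"
  have en: "orbit_enum fu P Q X" "orbit_enum fl P Q X" "X (- 1) \<le> Km" "Cp \<le> X 0"
    using X by (auto simp: good_orbit_def)
  have per: "X (i + int Q) = X i + 1" for i using en(1) by (simp add: orbit_enum_def)
  have sm: "strict_mono X" using en(1) by (simp add: orbit_enum_def)
  have loc: "\<exists>e>0. \<forall>y. X i - e < y \<and> y \<le> X i \<longrightarrow> f y = fu y \<and> f y = fl y" for i
  proof -
    obtain k :: int where k: "Cp \<le> X i + of_int k" "X i + of_int k \<le> Km + 1"
      "Cp = X i + of_int k \<Longrightarrow> X 0 = Cp"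
      using orbit_in_arc[OF per sm Q en(3,4), of i] by blast
    then have lt: "Cp < X i + of_int k" using \<open>X 0 \<noteq> Cp\<close> by force
    show ?thesis
    proof (intro exI[of _ "X i + of_int k - Cp"] conjI allI impI)
      fix y assume "X i - (X i + of_int k - Cp) < y \<and> y \<le> X i"
      then have "Cp \<le> y + of_int k" "y + of_int k \<le> Km + 1" using k by auto
      from on_arc[OF this] show "f y = fu y" "f y = fl y" by auto
    qed (use lt in simp)
  qed
  have "\<exists>e>0. \<forall>y. X 0 - e < y \<and> y \<le> X 0 \<longrightarrow> (f ^^ Q) y = (fu ^^ Q) y"
    by (rule iter_agree_left[OF fu]) (use loc orbit_enum_funpow[OF en(1), of _ 0] in \<open>simp, blast\<close>)
  then obtain e where e: "e > 0" "\<And>y. X 0 - e < y \<Longrightarrow> y \<le> X 0 \<Longrightarrow> (f ^^ Q) y = (fu ^^ Q) y" by blast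
  have "\<exists>e>0. \<forall>y. X 0 - e < y \<and> y \<le> X 0 \<longrightarrow> (f ^^ Q) y = (fl ^^ Q) y"
    by (rule iter_agree_left[OF fl]) (use loc orbit_enum_funpow[OF en(2), of _ 0] in \<open>simp, blast\<close>)
  then obtain e' where e': "e' > 0" "\<And>y. X 0 - e' < y \<Longrightarrow> y \<le> X 0 \<Longrightarrow> (f ^^ Q) y = (fl ^^ Q) y" by blast
  show False
  proof (rule iterate_not_translation[OF Q])
    show "X 0 - min e e' < X 0" using e e' by simp
    fix y assume y: "X 0 - min e e' < y" "y < X 0"
    then have "(f ^^ Q) y = (fu ^^ Q) y" "(f ^^ Q) y = (fl ^^ Q) y" using e(2)[of y] e'(2)[of y] by auto
    then show "(f ^^ Q) y = y + of_int P" using below[of y] above[of y] by simp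
  qed
qed

lemma tip_left:
  assumes X: "good_orbit f C K P Q X" and Q: "Q > 0"
    and below: "\<And>x. (fl ^^ Q) x \<le> x + of_int P" and above: "\<And>x. x + of_int P \<le> (fu ^^ Q) x"
  shows "X (- 1) = Km"
proof -
  have "(\<lambda>i. - X (- 1 - i)) 0 = right_plateau (refl_map f) (- K) (- C)"
  proof (rule bimodal.tip_right[OF reflected good_orbit_refl[OF X] Q])
    fix x
    show "(lower_bound (refl_map f) ^^ Q) x \<le> x + of_int (- P)"
      using above[of "- x"] by (simp add: lower_bound_refl funpow_refl_map)
    show "x + of_int (- P) \<le> (upper_bound (refl_map f) ^^ Q) x"
      using below[of "- x"] by (simp add: upper_bound_refl funpow_refl_map)
  qed
  then show ?thesis by (simp add: right_plateau_refl)
qed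

text \<open>By the determinant condition \<open>q\<close> steps lead from index -1 to index
  \<open>p Q\<close>, that is, from \<open>X (-1)\<close> to \<open>X 0 + p\<close>, and at a tip
  these two points are the plateau ends.\<close>

lemma tip_return:
  assumes X: "good_orbit f C K P Q X" and Q: "Q > 0"
    and below: "\<And>x. (fl ^^ Q) x \<le> x + of_int P" and above: "\<And>x. x + of_int P \<le> (fu ^^ Q) x"
    and det: "int q * P - int Q * p = 1"
  shows "(fu ^^ q) Km = Cp + of_int p"
proof -
  have en: "orbit_enum fu P Q X" using X by (auto simp: good_orbit_def)
  have "- 1 + int q * P = 0 + p * int Q" using det by (simp add: algebra_simps)
  then show ?thesis
    using orbit_enum_funpow[OF en, of q "- 1"] orbit_enum_add[OF en, of 0 p]
      tip_right[OF X Q below above] tip_left[OF X Q below above] by simp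
qed

text \<open>The image of \<open>Cp\<close> is bounded in two ways: from above because
  \<open>Km\<close> is near and goes to \<open>Cp + p\<close>, and from below because
  \<open>Cp + s\<close> is moved by at least \<open>p\<close> while one step through the flat piece
  brings the images of \<open>Cp\<close> and \<open>Cp + s\<close> close together.\<close>

lemma tip_estimate:
  assumes B: "\<And>x. \<bar>f1 x\<bar> \<le> B" and s: "s > 0" "Cp + s \<le> C + 1" and \<theta>: "\<And>x. Cp \<le> x \<Longrightarrow> x \<le> Cp + s \<Longrightarrow> f1 x \<le> \<theta>"
    and q: "q > 0" and ret: "(translate fu a ^^ q) Km = Cp + of_int p"
    and above: "Cp + s + of_int p \<le> (translate fu a ^^ q) (Cp + s)"
  shows "s * (1 - B ^ (q - 1) * \<theta>) \<le> B ^ q * (Cp - Km)"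
proof -
  let ?G = "translate fu a"
  have "B \<ge> 0" using B[of 0] abs_ge_zero[of "f1 0"] by linarith
  have lip: "\<bar>f x - f y\<bar> \<le> B * \<bar>x - y\<bar>" for x y
  proof -
    have "\<bar>f v - f u\<bar> \<le> B * \<bar>v - u\<bar>" if uv: "u < v" for u v
    proof -
      obtain z where "f v - f u = (v - u) * f1 z" using MVT2[OF uv, of f f1] D1 by blast
      then show ?thesis using B[of z] uv by (simp add: abs_mult mult.commute mult_left_mono)
    qed
    from this[of x y] this[of y x] show ?thesis by (cases x y rule: linorder_cases) (auto simp: abs_minus_commute)
  qed
  have "\<bar>?G x - ?G y\<bar> \<le> B * \<bar>x - y\<bar>" for x y
    using upper_bound_lipschitz[OF lift lip] by simp
  note lipn = iter_lipschitz[OF this \<open>B \<ge> 0\<close>]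
  obtain r where r: "q = Suc r" using q by (cases q) auto
  have fCs: "f (Cp + s) - f Cp \<le> \<theta> * s"
  proof -
    obtain z where z: "Cp < z" "z < Cp + s" "f (Cp + s) - f Cp = (Cp + s - Cp) * f1 z"
      using MVT2[of Cp "Cp + s" f f1] s D1 by auto
    then show ?thesis using \<theta>[of z] s(1) by (simp add: mult.commute)
  qed
  have fge: "f Cp \<le> f (Cp + s)" using strict_inc[of Cp "Cp + s"] s right_plateau by simp
  have fuCp: "fu Cp = f Cp" "fu (Cp + s) = f (Cp + s)" using fu_inc[of Cp] fu_inc[of "Cp + s"] s right_plateau by auto
  have "\<bar>(?G ^^ q) (Cp + s) - (?G ^^ q) Cp\<bar> \<le> B ^ r * \<bar>?G (Cp + s) - ?G Cp\<bar>"
    using lipn[of r "?G (Cp + s)" "?G Cp"] by (simp add: r funpow_Suc_right del: funpow.simps)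
  also have "\<dots> \<le> B ^ r * (\<theta> * s)" using fCs fge fuCp \<open>B \<ge> 0\<close> by (intro mult_left_mono) auto
  finally have 1: "(?G ^^ q) Cp \<ge> Cp + s + of_int p - B ^ r * \<theta> * s" using above by simp
  have "Km < Cp" using left_plateau right_plateau CK by linarith
  then have "(?G ^^ q) Cp \<le> Cp + of_int p + B ^ q * (Cp - Km)" using lipn[of q Cp Km] ret by simp
  with 1 show ?thesis by (simp add: r algebra_simps)
qed

subsection \<open>Locking of a child forces locking of its parents\<close>

text \<open>In \<open>q\<close> steps the good orbit jumps over the hole, so \<open>Km\<close> is
  moved by more than \<open>p\<close>. Lowering the translation makes \<open>Km\<close> periodic of
  type \<open>p/q\<close>. The next point of the new orbit stays right of the hole, because with the
  larger translation \<open>q2\<close> steps take \<open>Cp\<close> no further than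
  \<open>Km + p2\<close>.\<close>

lemma good_orbit_left_parent:
  assumes X: "good_orbit (translate f a) C K P Q X" and PQ: "P = p + p2" "Q = q + q2" "q > 0" "q2 > 0"
    and det: "p2 * int q - p * int q2 = 1"
  shows "\<exists>t. has_type (translate fl t) p q \<and> has_type (translate fu t) p q"
proof -
  let ?G = "\<lambda>t. translate fl t"
  have en: "orbit_enum (?G a) P Q X" "X (- 1) \<le> Km" "Cp \<le> X 0"
    using X by (auto simp: good_orbit_def lower_bound_translate'[OF lift] right_plateau_translate left_plateau_translate)
  have mG: "mono (?G t)" for t by (rule mono_trans[OF fl(2)])
  have KmCp: "Km < Cp" using left_plateau right_plateau CK by linarith
  have "(?G a ^^ q) (X (- 1)) \<le> (?G a ^^ q) Km" using mono_pow[OF mG, of q a] en(2) by (simp add: mono_def)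
  moreover have "- 1 + int q * P = 0 + p * int Q" using det PQ by (simp add: algebra_simps)
  then have "(?G a ^^ q) (X (- 1)) = X 0 + of_int p"
    using orbit_enum_funpow[OF en(1), of q "- 1"] orbit_enum_add[OF en(1), of 0 p] by simp
  ultimately have hiA: "(?G a ^^ q) Km > Km + of_int p" using en(3) KmCp by linarith
  have "(?G a ^^ q2) Cp \<le> (?G a ^^ q2) (X 0)" using mono_pow[OF mG, of q2 a] en(3) by (simp add: mono_def)
  moreover have "0 + int q2 * P = - 1 + p2 * int Q" using det PQ by (simp add: algebra_simps)
  then have "(?G a ^^ q2) (X 0) = X (- 1) + of_int p2"
    using orbit_enum_funpow[OF en(1), of q2 0] orbit_enum_add[OF en(1), of "- 1" p2] by simp
  ultimately have A2: "(?G a ^^ q2) Cp \<le> Km + of_int p2" using en(2) by linarith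
  define \<phi> where "\<phi> t = (?G t ^^ q) Km" for t
  have cont: "continuous_on UNIV \<phi>" unfolding \<phi>_def by (rule continuous_on_iter_translate[OF fl(1)])
  \<comment> \<open>Lowering the translation by the whole excess removes at least that excess, so
    the intermediate value theorem applies between \<open>t1\<close> and \<open>a\<close>.\<close>
  define t1 where "t1 = a - (\<phi> a - Km - of_int p)"
  have "t1 \<le> a" using hiA by (simp add: t1_def \<phi>_def)
  have "\<phi> t1 + (a - t1) \<le> \<phi> a" unfolding \<phi>_def by (rule trans_iter_mono[OF fl(2) \<open>t1 \<le> a\<close> PQ(3)])
  then have "\<phi> t1 \<le> Km + of_int p" by (simp add: t1_def)
  then have "\<exists>t\<ge>t1. t \<le> a \<and> \<phi> t = Km + of_int p"
    using hiA \<open>t1 \<le> a\<close> continuous_on_subset[OF cont] by (intro IVT') (auto simp: \<phi>_def)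
  then obtain t where t: "t \<le> a" "\<phi> t = Km + of_int p" by blast
  then have ta: "t < a" using hiA by (cases "t = a") (auto simp: \<phi>_def)
  have per: "(?G t ^^ q) Km = Km + of_int p" using t(2) by (simp add: \<phi>_def)
  have cop: "coprime p (int q)"
  proof (rule coprimeI)
    fix c assume "c dvd p" "c dvd int q"
    then have "c dvd p2 * int q - p * int q2" by (intro dvd_diff dvd_mult dvd_mult2)
    then show "is_unit c" by (simp add: det)
  qed
  obtain Z where Z: "orbit_enum (?G t) p q Z" "Z 0 = Km"
    using orbit_enum_exists[OF degree_one_lift_translate[OF fl(1)] mG per PQ(3) cop] by metis
  have "1 + int q2 * p = 0 + p2 * int q" using det by (simp add: algebra_simps)
  then have Z1: "(?G t ^^ q2) (Z 1) = Km + of_int p2"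
    using orbit_enum_funpow[OF Z(1), of q2 1] orbit_enum_add[OF Z(1), of 0 p2] Z(2) by simp
  \<comment> \<open>\<open>Z 1\<close> arrives exactly at \<open>Km + p2\<close> after
    \<open>q2\<close> steps. A start left of \<open>Cp\<close> would end strictly before, since the
    translation was strictly lowered.\<close>
  have "Cp \<le> Z 1"
  proof (rule ccontr)
    assume "\<not> ?thesis"
    then have "(?G t ^^ q2) (Z 1) \<le> (?G t ^^ q2) Cp" using mono_pow[OF mG, of q2 t] by (simp add: mono_def)
    also have "\<dots> < (?G a ^^ q2) Cp" using trans_iter_mono[OF fl(2) less_imp_le[OF ta] PQ(4), of Cp] ta by linarith
    finally show False using Z1 A2 by simp
  qed
  interpret T: bimodal "translate f t" f1 f2 f3 C K by (rule translated)
  have "good_orbit (translate f t) C K p q (\<lambda>i. Z (i + 1))"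
  proof (rule T.good_orbitI[OF orbit_enum_shift])
    show "orbit_enum (?G t) p q Z" by (rule Z)
    show "?G t = upper_bound (translate f t) \<or> ?G t = lower_bound (translate f t)"
      by (simp add: lower_bound_translate'[OF lift])
  qed (use PQ(3) Z(2) \<open>Cp \<le> Z 1\<close> in \<open>auto simp: right_plateau_translate left_plateau_translate\<close>)
  from T.good_orbit_has_type[OF this PQ(3)] show ?thesis
    by (auto simp: lower_bound_translate'[OF lift] upper_bound_translate'[OF lift])
qed

lemma good_orbit_right_parent:
  assumes X: "good_orbit (translate f a) C K P Q X" and PQ: "P = p + p2" "Q = q + q2" "q > 0" "q2 > 0"
    and det: "p * int q2 - p2 * int q = 1"
  shows "\<exists>t. has_type (translate fl t) p q \<and> has_type (translate fu t) p q"
proof -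
  interpret T: bimodal "translate f a" f1 f2 f3 C K by (rule translated)
  interpret R: bimodal "refl_map f" "\<lambda>x. f1 (- x)" "\<lambda>x. - f2 (- x)" "\<lambda>x. f3 (- x)" "- K" "- C"
    by (rule reflected)
  have "good_orbit (translate (refl_map f) (- a)) (- K) (- C) (- P) Q (\<lambda>i. - X (- 1 - i))"
    using T.good_orbit_refl[OF X] by (simp add: refl_map_trans)
  from R.good_orbit_left_parent[OF this, of "- p" "- p2" q q2] PQ det
  obtain t where t: "has_type (translate (lower_bound (refl_map f)) t) (- p) q"
    "has_type (translate (upper_bound (refl_map f)) t) (- p) q" by auto
  have "has_type (refl_map (translate fu (- t))) (- p) q" using t(1)
    unfolding refl_map_trans by (simp add: lower_bound_refl)
  moreover have "has_type (refl_map (translate fl (- t))) (- p) q" using t(2)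
    unfolding refl_map_trans by (simp add: upper_bound_refl)
  ultimately show ?thesis unfolding has_type_refl_map by (intro exI[of _ "- t"]) simp
qed

end

subsection \<open>Closest returns\<close>

text \<open>Times at which the rotation by \<open>P/Q\<close> comes closer to its start than ever
  before, scaled by \<open>Q\<close> to stay within the integers. The bound \<open>2 \<le> n\<close>
  removes the vacuous first return.\<close>

definition closest_return :: "int \<Rightarrow> nat \<Rightarrow> nat \<Rightarrow> bool" where
  "closest_return P Q n \<longleftrightarrow> 2 \<le> n \<and>
     (\<exists>m. \<forall>k m'. 0 < k \<and> k < n \<longrightarrow> \<bar>int n * P - m * int Q\<bar> < \<bar>int k * P - m' * int Q\<bar>)"

lemma mod_eq_obtain:
  fixes a b q :: int
  assumes "a mod q = b mod q"
  obtains m where "a - b = m * q"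
proof -
  have "q dvd a - b" using assms by (simp add: mod_eq_dvd_iff)
  then obtain k where "a - b = q * k" by (rule dvdE)
  then show ?thesis using that[of k] by (simp add: mult.commute)
qed

lemma sum_gaps_int:
  fixes X :: "int \<Rightarrow> real"
  assumes "a \<le> b + 1"
  shows "(\<Sum>j\<in>{a..b}. X j - X (j - 1)) = X b - X (a - 1)"
proof -
  have "(\<Sum>j\<in>{a..a + int n - 1}. X j - X (j - 1)) = X (a + int n - 1) - X (a - 1)" for n
  proof (induction n)
    case (Suc n)
    have "{a..a + int (Suc n) - 1} = insert (a + int n) {a..a + int n - 1}" by auto
    then show ?case using Suc by simp
  qed simp
  from this[of "nat (b + 1 - a)"] show ?thesis using assms by simp
qed

text \<open>Gaps with different indices modulo \<open>Q\<close> are disjoint modulo 1 and hence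
  belong to the \<open>Q\<close> gaps that fill one period.\<close>

lemma sum_gaps_le_one:
  assumes X: "orbit_enum G P Q X" and Q: "Q > 0" and A: "finite A" "inj_on (\<lambda>a. g a mod int Q) A"
  shows "(\<Sum>a\<in>A. X (g a) - X (g a - 1)) \<le> 1"
proof -
  have gap: "X (g a) - X (g a - 1) = X (g a mod int Q) - X (g a mod int Q - 1)" for a
    using orbit_enum_add[OF X, of "g a mod int Q" "g a div int Q"]
      orbit_enum_add[OF X, of "g a mod int Q - 1" "g a div int Q"] by (simp add: algebra_simps)
  have "(\<Sum>a\<in>A. X (g a) - X (g a - 1)) = (\<Sum>a\<in>A. X (g a mod int Q) - X (g a mod int Q - 1))"
    by (rule sum.cong) (use gap in auto)
  also have "\<dots> = (\<Sum>j\<in>(\<lambda>a. g a mod int Q) ` A. X j - X (j - 1))"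
    by (simp add: sum.reindex[OF A(2)])
  also have "\<dots> \<le> (\<Sum>j\<in>{0..int Q - 1}. X j - X (j - 1))"
  proof (rule sum_mono2)
    show "(\<lambda>a. g a mod int Q) ` A \<subseteq> {0..int Q - 1}" using Q by (auto simp: zle_diff1_eq)
    show "0 \<le> X j - X (j - 1)" for j using orbit_enum_le[OF X, of "j - 1" j] by simp
  qed simp
  also have "\<dots> = X (int Q - 1) - X (0 - 1)" using Q by (intro sum_gaps_int) auto
  also have "\<dots> = 1" using orbit_enum_add[OF X, of "- 1" 1] by simp
  finally show ?thesis .
qed

context bimodal
begin

text \<open>Both plateau ends lie strictly inside the arc where \<open>f1\<close> is positive, so
  the logarithm of \<open>f1\<close> has bounded derivative on the compact arc outside the
  hole.\<close>

lemma log_derivative_lipschitz: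
  obtains D where "D \<ge> 0"
    "\<And>x y. Cp \<le> x \<Longrightarrow> x \<le> Km + 1 \<Longrightarrow> Cp \<le> y \<Longrightarrow> y \<le> Km + 1 \<Longrightarrow> \<bar>ln (f1 x) - ln (f1 y)\<bar> \<le> D * \<bar>x - y\<bar>"
proof -
  have pos: "f1 x > 0" if "Cp \<le> x" "x \<le> Km + 1" for x
    using inc[of x] that right_plateau left_plateau by simp
  have "continuous_on {Cp..Km+1} (\<lambda>x. f2 x / f1 x)"
  proof (rule continuous_on_divide)
    show "continuous_on {Cp..Km+1} f2" by (rule DERIV_continuous_on[OF has_field_derivative_at_within[OF D3]])
    show "continuous_on {Cp..Km+1} f1" by (rule DERIV_continuous_on[OF has_field_derivative_at_within[OF D2]])
    show "\<forall>x\<in>{Cp..Km+1}. f1 x \<noteq> 0" using pos by force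
  qed
  then have "bounded ((\<lambda>x. f2 x / f1 x) ` {Cp..Km+1})"
    by (intro compact_imp_bounded compact_continuous_image) auto
  then obtain D where D: "\<And>x. Cp \<le> x \<Longrightarrow> x \<le> Km + 1 \<Longrightarrow> \<bar>f2 x / f1 x\<bar> \<le> D"
    unfolding bounded_iff by force
  have lip: "\<bar>ln (f1 y) - ln (f1 x)\<bar> \<le> \<bar>D\<bar> * (y - x)" if "Cp \<le> x" "x < y" "y \<le> Km + 1" for x y
  proof -
    have "((\<lambda>x. ln (f1 x)) has_real_derivative f2 z / f1 z) (at z)" if "x \<le> z" "z \<le> y" for z
      using DERIV_chain2[OF DERIV_ln_divide D2[of z]] pos[of z] \<open>Cp \<le> x\<close> \<open>y \<le> Km + 1\<close> that by simp
    then obtain z where z: "x < z" "z < y" "ln (f1 y) - ln (f1 x) = (y - x) * (f2 z / f1 z)"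
      using MVT2[OF \<open>x < y\<close>, of "\<lambda>x. ln (f1 x)" "\<lambda>z. f2 z / f1 z"] by blast
    have "\<bar>f2 z / f1 z\<bar> \<le> \<bar>D\<bar>" using D[of z] z that by auto
    then have "\<bar>y - x\<bar> * \<bar>f2 z / f1 z\<bar> \<le> \<bar>y - x\<bar> * \<bar>D\<bar>" by (rule mult_left_mono) simp
    then show ?thesis unfolding z(3) abs_mult[of "y - x"] using \<open>x < y\<close> by (simp only: mult.commute abs_of_pos diff_gt_0_iff_gt)
  qed
  have "\<bar>ln (f1 x) - ln (f1 y)\<bar> \<le> \<bar>D\<bar> * \<bar>x - y\<bar>" if "Cp \<le> x" "x \<le> Km + 1" "Cp \<le> y" "y \<le> Km + 1" for x y
    using lip[of x y] lip[of y x] that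
    by (cases x y rule: linorder_cases) (auto simp: abs_minus_commute)
  then show ?thesis using that[of "\<bar>D\<bar>"] by auto
qed

text \<open>Denjoy's argument for the gaps of a periodic orbit: at a closest return the forward images of
  one gap and the backward images of the hole stay close together, so the derivatives along them
  are comparable and the two gaps reached cannot both be short.\<close>

lemma closest_return_bound:
  obtains \<kappa> where "\<kappa> > 0"
    "\<And>a P Q X N. good_orbit (translate f a) C K P Q X \<Longrightarrow> Q > 0 \<Longrightarrow> finite N \<Longrightarrow>
       (\<And>n. n \<in> N \<Longrightarrow> closest_return P Q n) \<Longrightarrow> \<kappa> * real (card N) \<le> 1"
proof -
  obtain D where D: "D \<ge> 0"
    "\<And>x y. Cp \<le> x \<Longrightarrow> x \<le> Km + 1 \<Longrightarrow> Cp \<le> y \<Longrightarrow> y \<le> Km + 1 \<Longrightarrow> \<bar>ln (f1 x) - ln (f1 y)\<bar> \<le> D * \<bar>x - y\<bar>"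
    using log_derivative_lipschitz by blast
  \<comment> \<open>The gap at index 0 contains the hole and its image contains the interval from
    \<open>f K\<close> to \<open>f C\<close>. The product of these lengths, reduced by the
    distortion over a total length of at most 1, bounds the product of the two gaps reached; the
    root prepares the passage to a sum.\<close>
  define \<kappa> where "\<kappa> = sqrt (exp (- D) * ((f C - f K) * (Cp - Km)))"
  have KmCp: "Km < Cp" using left_plateau right_plateau CK by linarith
  have "\<kappa> > 0" unfolding \<kappa>_def using fK_less_fC KmCp by simp
  moreover have "\<kappa> * real (card N) \<le> 1"
    if X: "good_orbit (translate f a) C K P Q X" and Q: "Q > 0" and N: "finite N"
      and cl: "\<And>n. n \<in> N \<Longrightarrow> closest_return P Q n" for a P Q X N
  proof -
    interpret T: bimodal "translate f a" f1 f2 f3 C K by (rule translated)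
    define G where "G = translate (upper_bound f) a"
    have en: "orbit_enum G P Q X" "X (- 1) \<le> Km" "Cp \<le> X 0"
      using X by (auto simp: G_def good_orbit_def upper_bound_translate'[OF lift] right_plateau_translate left_plateau_translate)
    have fX: "f (X i) + a = X (i + P)" for i using T.good_orbitD(1)[OF X Q, of i] by simp
    define I where "I i = X i - X (i - 1)" for i
    have Ipos: "I i > 0" for i using orbit_enum_less[OF en(1), of "i - 1" i] by (simp add: I_def)
    have Iper: "I (i + k * int Q) = I i" for i k
      using orbit_enum_add[OF en(1), of i k] orbit_enum_add[OF en(1), of "i - 1" k] by (simp add: I_def algebra_simps)
    have "\<exists>\<xi>. X (i - 1) < \<xi> \<and> \<xi> < X i \<and> I (i + P) = I i * f1 \<xi>" for i
    proof -
      obtain \<xi> where "X (i - 1) < \<xi>" "\<xi> < X i" "f (X i) - f (X (i - 1)) = (X i - X (i - 1)) * f1 \<xi>"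
        using MVT2[of "X (i - 1)" "X i" f f1] D1 Ipos[of i] by (auto simp: I_def)
      moreover have "i - 1 + P = i + P - 1" by simp
      ultimately show ?thesis using fX[of i] fX[of "i - 1"] unfolding I_def by (intro exI[of _ \<xi>]) (simp add: algebra_simps)
    qed
    then obtain \<xi> where \<xi>: "\<And>i. X (i - 1) < \<xi> i" "\<And>i. \<xi> i < X i" "\<And>i. I (i + P) = I i * f1 (\<xi> i)" by metis
    \<comment> \<open>A block of consecutive gaps whose indices are not divisible by
      \<open>Q\<close> never crosses the hole and lies in one translate of the arc on which the
      distortion is controlled.\<close>
    have arc: "\<exists>c::int. \<forall>x. X (l - 1) \<le> x \<and> x \<le> X h \<longrightarrow> Cp \<le> x - of_int c \<and> x - of_int c \<le> Km + 1"
      if "l \<le> h" "\<And>j. l \<le> j \<Longrightarrow> j \<le> h \<Longrightarrow> j mod int Q \<noteq> 0" for l h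
    proof (intro exI allI impI)
      let ?c = "l div int Q"
      fix x assume x: "X (l - 1) \<le> x \<and> x \<le> X h"
      have dm: "l = ?c * int Q + l mod int Q" by simp
      have "0 \<le> l mod int Q" "l mod int Q < int Q" using Q by auto
      moreover have "l mod int Q \<noteq> 0" using that by simp
      ultimately have l1: "0 + ?c * int Q \<le> l - 1" using dm by linarith
      have "h \<le> - 1 + (?c + 1) * int Q"
      proof (rule ccontr)
        assume "\<not> ?thesis"
        then have "(?c + 1) * int Q \<le> h" by simp
        moreover have "(?c + 1) * int Q = ?c * int Q + int Q" by (simp add: distrib_right)
        then have "l \<le> (?c + 1) * int Q" using dm \<open>l mod int Q < int Q\<close> by linarith
        ultimately show False using that(2)[of "(?c + 1) * int Q"] by simp
      qed
      then have "X h \<le> X (- 1) + of_int (?c + 1)"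
        using orbit_enum_le[OF en(1), of h "- 1 + (?c + 1) * int Q"] orbit_enum_add[OF en(1), of "- 1" "?c + 1"] by simp
      moreover have "X 0 + of_int ?c \<le> X (l - 1)"
        using orbit_enum_le[OF en(1), of "0 + ?c * int Q" "l - 1"] orbit_enum_add[OF en(1), of 0 ?c] l1 by simp
      ultimately show "Cp \<le> x - of_int ?c \<and> x - of_int ?c \<le> Km + 1" using x en by auto
    qed
    have key: "2 * \<kappa> \<le> I (int n * P) + I ((1 - int n) * P)" if nN: "n \<in> N" for n
    proof -
      obtain m where m: "2 \<le> n" "\<And>k m'. 0 < k \<Longrightarrow> k < n \<Longrightarrow> \<bar>int n * P - m * int Q\<bar> < \<bar>int k * P - m' * int Q\<bar>"
        using cl[OF nN] unfolding closest_return_def by blast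
      define r where "r = int n * P - m * int Q"
      have m': "\<bar>r\<bar> < \<bar>int k * P - m' * int Q\<bar>" if "0 < k" "k < n" for k m' using m(2)[OF that] by (simp add: r_def)
      have rQ: "\<bar>r\<bar> < int Q"
      proof -
        have "\<bar>r\<bar> < \<bar>int 1 * P - P div int Q * int Q\<bar>" using m(1) by (intro m') auto
        also have "\<dots> = P mod int Q" using Q by (simp add: minus_div_mult_eq_mod)
        also have "\<dots> < int Q" using Q by simp
        finally show ?thesis .
      qed
      \<comment> \<open>The block from \<open>l i\<close> to \<open>h i\<close> spans the two gaps
        with indices \<open>i P - r\<close> and \<open>i P\<close> and all gaps between them, for
        either sign of \<open>r\<close>.\<close>
      define l h where "l i = int i * P - max 0 r" and "h i = int i * P - min 0 r" for i :: nat
      have lh: "l i \<le> h i" for i by (simp add: l_def h_def)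
      \<comment> \<open>An index divisible by \<open>Q\<close> inside such a block would be an
        earlier return at distance at most \<open>\<bar>r\<bar>\<close>.\<close>
      have nz: "j mod int Q \<noteq> 0" if "0 < i" "i < n" "l i \<le> j" "j \<le> h i" for i j
      proof
        assume "j mod int Q = 0"
        then obtain m1 where "j = m1 * int Q" using mod_eq_obtain[of j "int Q" 0] by auto
        then have "\<bar>int i * P - m1 * int Q\<bar> \<le> \<bar>r\<bar>" using that(3,4) by (auto simp: l_def h_def)
        then show False using m'[OF that(1,2), of m1] by simp
      qed
      have diff: "ln (f1 (\<xi> (int i * P - r))) - ln (f1 (\<xi> (int i * P))) \<le> D * (\<Sum>j\<in>{l i..h i}. I j)
          \<and> f1 (\<xi> (int i * P)) > 0 \<and> f1 (\<xi> (int i * P - r)) > 0"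
        if i: "0 < i" "i < n" for i
      proof -
        obtain c :: int where c: "\<And>x. X (l i - 1) \<le> x \<Longrightarrow> x \<le> X (h i) \<Longrightarrow> Cp \<le> x - of_int c \<and> x - of_int c \<le> Km + 1"
          using arc[OF lh nz[OF i]] by blast
        let ?x = "\<xi> (int i * P - r)" and ?y = "\<xi> (int i * P)"
        have bd: "X (l i - 1) \<le> \<xi> j \<and> \<xi> j \<le> X (h i)" if "l i \<le> j" "j \<le> h i" for j
          using \<xi>(1,2)[of j] that orbit_enum_le[OF en(1), of "l i - 1" "j - 1"] orbit_enum_le[OF en(1), of j "h i"] by simp
        have x: "X (l i - 1) \<le> ?x" "?x \<le> X (h i)" and y: "X (l i - 1) \<le> ?y" "?y \<le> X (h i)"
          using bd[of "int i * P - r"] bd[of "int i * P"] by (auto simp: l_def h_def)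
        have f1x: "f1 (?x - of_int c) = f1 ?x" "f1 (?y - of_int c) = f1 ?y"
          using f1_add_int[of ?x "- c"] f1_add_int[of ?y "- c"] by simp_all
        have "\<bar>ln (f1 ?x) - ln (f1 ?y)\<bar> \<le> D * \<bar>?x - ?y\<bar>"
          using D(2)[of "?x - of_int c" "?y - of_int c"] c[OF x] c[OF y] f1x by simp
        also have "\<dots> \<le> D * (X (h i) - X (l i - 1))" using D(1) x y by (intro mult_left_mono) auto
        also have "X (h i) - X (l i - 1) = (\<Sum>j\<in>{l i..h i}. I j)"
          unfolding I_def using lh[of i] by (subst sum_gaps_int) auto
        finally have "ln (f1 ?x) - ln (f1 ?y) \<le> D * (\<Sum>j\<in>{l i..h i}. I j)" by simp
        moreover have "f1 ?x > 0" "f1 ?y > 0"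
          using inc[of "?x - of_int c"] inc[of "?y - of_int c"] c[OF x] c[OF y] f1x right_plateau left_plateau by auto
        ultimately show ?thesis by simp
      qed
      \<comment> \<open>The logarithm of the ratio of the two gaps changes at each step by the
        difference of logarithmic derivatives, which is at most \<open>D\<close> times the length of
        the block.\<close>
      have chain: "ln (I (int (Suc k) * P - r)) - ln (I (int (Suc k) * P)) - (ln (I (P - r)) - ln (I P))
          \<le> D * (\<Sum>i\<in>{1..k}. \<Sum>j\<in>{l i..h i}. I j)" if "k < n" for k
        using that
      proof (induction k)
        case (Suc k)
        let ?i = "Suc k"
        have e1: "I (int (Suc ?i) * P - r) = I (int ?i * P - r) * f1 (\<xi> (int ?i * P - r))"
          using \<xi>(3)[of "int ?i * P - r"] by (simp add: algebra_simps)
        have e2: "I (int (Suc ?i) * P) = I (int ?i * P) * f1 (\<xi> (int ?i * P))"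
          using \<xi>(3)[of "int ?i * P"] by (simp add: algebra_simps)
        have d: "ln (f1 (\<xi> (int ?i * P - r))) - ln (f1 (\<xi> (int ?i * P))) \<le> D * (\<Sum>j\<in>{l ?i..h ?i}. I j)"
          "f1 (\<xi> (int ?i * P)) > 0" "f1 (\<xi> (int ?i * P - r)) > 0" using diff[of ?i] Suc.prems by auto
        have "ln (I (int (Suc ?i) * P - r)) = ln (I (int ?i * P - r)) + ln (f1 (\<xi> (int ?i * P - r)))"
          "ln (I (int (Suc ?i) * P)) = ln (I (int ?i * P)) + ln (f1 (\<xi> (int ?i * P)))"
          unfolding e1 e2 using d(2,3) Ipos by (simp_all only: ln_mult_pos)
        moreover have "D * (\<Sum>i\<in>{1..?i}. \<Sum>j\<in>{l i..h i}. I j)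
            = D * (\<Sum>i\<in>{1..k}. \<Sum>j\<in>{l i..h i}. I j) + D * (\<Sum>j\<in>{l ?i..h ?i}. I j)"
          by (simp add: distrib_left)
        moreover have "k < n" using Suc.prems by simp
        note Suc.IH[OF this]
        ultimately show ?case using d(1) by linarith
      qed simp
      \<comment> \<open>Blocks of different times share no index modulo \<open>Q\<close>, again
        because an earlier return would otherwise be as close; within a block indices are distinct
        since \<open>\<bar>r\<bar> < Q\<close>.\<close>
      have total: "(\<Sum>i\<in>{1..n - 1}. \<Sum>j\<in>{l i..h i}. I j) \<le> 1"
      proof -
        have "(\<Sum>i\<in>{1..n - 1}. \<Sum>j\<in>{l i..h i}. I j) = (\<Sum>z\<in>Sigma {1..n - 1} (\<lambda>i. {l i..h i}). I (snd z))"
          by (subst sum.Sigma) (auto simp: case_prod_unfold)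
        also have "\<dots> \<le> 1"
          unfolding I_def
        proof (rule sum_gaps_le_one[OF en(1) Q])
          have noclash: False if nc: "i < i'" "i' < n" "l i \<le> j" "j \<le> h i" "l i' \<le> j'" "j' \<le> h i'"
            "j mod int Q = j' mod int Q" for i i' j j'
          proof -
            obtain m1 where m1: "j' - j = m1 * int Q"
              using mod_eq_obtain[OF nc(7)[symmetric]] by blast
            have "\<bar>(int i' * P - int i * P) - (j' - j)\<bar> \<le> \<bar>r\<bar>"
              using nc(3-6) by (auto simp: l_def h_def)
            then have "\<bar>int (i' - i) * P - m1 * int Q\<bar> \<le> \<bar>r\<bar>"
              using nc(1) m1 by (simp add: of_nat_diff algebra_simps)
            moreover have "0 < i' - i" "i' - i < n" using nc by auto
            ultimately show False using m'[of "i' - i" m1] by linarith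
          qed
          show "inj_on (\<lambda>z. snd z mod int Q) (Sigma {1..n - 1} (\<lambda>i. {l i..h i}))"
          proof (rule inj_onI)
            fix z z' assume zz: "z \<in> Sigma {1..n - 1} (\<lambda>i. {l i..h i})" "z' \<in> Sigma {1..n - 1} (\<lambda>i. {l i..h i})"
              "snd z mod int Q = snd z' mod int Q"
            obtain i j i' j' where ij: "z = (i, j)" "z' = (i', j')" by (metis surj_pair)
            have *: "1 \<le> i" "i \<le> n - 1" "l i \<le> j" "j \<le> h i"
              "1 \<le> i'" "i' \<le> n - 1" "l i' \<le> j'" "j' \<le> h i'" "j mod int Q = j' mod int Q"
              using zz unfolding ij by simp_all
            have "i < n" "i' < n" using *(2,6) m(1) by linarith+
            have "\<not> i < i'" using noclash[OF _ \<open>i' < n\<close> *(3,4,7,8,9)] by blast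
            moreover have "\<not> i' < i" using noclash[OF _ \<open>i < n\<close> *(7,8,3,4) *(9)[symmetric]] by blast
            ultimately have "i = i'" by simp
            obtain m1 where m1: "j' - j = m1 * int Q"
              using mod_eq_obtain[OF *(9)[symmetric]] by blast
            have "\<bar>j' - j\<bar> \<le> \<bar>r\<bar>" using *(3,4,7,8) unfolding \<open>i = i'\<close> l_def h_def
              by (simp add: min_def max_def split: if_splits)
            then have "\<bar>m1 * int Q\<bar> < int Q" using rQ m1 by simp
            then have "m1 = 0" using Q by (simp add: abs_mult)
            then show "z = z'" using m1 \<open>i = i'\<close> ij by simp
          qed
        qed auto
        finally show ?thesis .
      qed
      have n1: "Suc (n - 1) = n" using m(1) by simp
      have "ln (I (int n * P - r)) - ln (I (int n * P)) - (ln (I (P - r)) - ln (I P)) \<le> D * 1"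
        using chain[of "n - 1"] total mult_left_mono[OF total D(1)] m(1) unfolding n1 by simp
      \<comment> \<open>\<open>n P - r\<close> is a multiple of \<open>Q\<close>: the chain ends at
        the hole, so the gap at \<open>P - r\<close> is one of its backward images.\<close>
      moreover have "I (int n * P - r) = I 0" using Iper[of 0 m] by (simp add: r_def)
      ultimately have "ln (I 0) + ln (I P) - D \<le> ln (I (int n * P)) + ln (I (P - r))" by simp
      moreover have "ln (exp (- D) * (I P * I 0)) = ln (I 0) + ln (I P) - D"
        using ln_mult_pos[of "exp (- D)" "I P * I 0"] ln_mult_pos[OF Ipos[of P] Ipos[of 0]]
          mult_pos_pos[OF Ipos[of P] Ipos[of 0]] by simp
      moreover have "ln (I (int n * P) * I (P - r)) = ln (I (int n * P)) + ln (I (P - r))"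
        by (rule ln_mult_pos[OF Ipos Ipos])
      ultimately have "ln (exp (- D) * (I P * I 0)) \<le> ln (I (int n * P) * I (P - r))" by simp
      then have prod: "exp (- D) * (I P * I 0) \<le> I (int n * P) * I (P - r)"
        by (subst (asm) ln_le_cancel_iff) (auto intro!: mult_pos_pos Ipos)
      have I0: "Cp - Km \<le> I 0" using en by (simp add: I_def)
      have "X 0 \<le> X (- 1 + 1 * int Q)" using Q by (simp add: orbit_enum_le[OF en(1)])
      then have X01: "X 0 \<le> X (- 1) + 1" using orbit_enum_add[OF en(1), of "- 1" 1] by simp
      have IP: "f C - f K \<le> I P"
      proof -
        have "f Cp \<le> f (X 0)" using strict_inc[of Cp "X 0"] en X01 right_plateau left_plateau
          by (cases "Cp = X 0") auto
        moreover have "f (X (- 1)) \<le> f Km" using strict_inc_left[of "X (- 1)" Km] en X01 right_plateau left_plateau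
          by (cases "Km = X (- 1)") auto
        ultimately show ?thesis using fX[of 0] fX[of "- 1"] right_plateau left_plateau by (simp add: I_def)
      qed
      have "(f C - f K) * (Cp - Km) \<le> I P * I 0"
        using I0 IP KmCp fK_less_fC by (intro mult_mono) auto
      then have "exp (- D) * ((f C - f K) * (Cp - Km)) \<le> exp (- D) * (I P * I 0)"
        by (rule mult_left_mono) simp
      then have "exp (- D) * ((f C - f K) * (Cp - Km)) \<le> I (int n * P) * I (P - r)"
        using prod by (rule order_trans)
      then have "\<kappa> \<le> sqrt (I (int n * P) * I (P - r))" unfolding \<kappa>_def by (rule real_sqrt_le_mono)
      also have "\<dots> \<le> (I (int n * P) + I (P - r)) / 2"
        by (intro arith_geo_mean_sqrt less_imp_le Ipos)
      also have "I (P - r) = I ((1 - int n) * P)"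
        using Iper[of "(1 - int n) * P" m] by (simp add: r_def algebra_simps)
      finally show ?thesis by simp
    qed
    \<comment> \<open>Two return times giving the same index would have an exact return at their
      difference, before the larger one.\<close>
    have no: False if nn: "n \<in> N" "n' < n" "0 < n'" and dv: "int Q dvd (int n - int n') * P" for n n'
    proof -
      obtain m where m: "\<And>k m'. 0 < k \<Longrightarrow> k < n \<Longrightarrow> \<bar>int n * P - m * int Q\<bar> < \<bar>int k * P - m' * int Q\<bar>"
        using cl[OF nn(1)] unfolding closest_return_def by blast
      obtain m1 where "(int n - int n') * P = int Q * m1" using dv by (rule dvdE)
      then have "int (n - n') * P - m1 * int Q = 0" using nn(2) by (simp add: of_nat_diff mult.commute)
      then show False using m[of "n - n'" m1] nn(2,3) by simp
    qed
    have inj: "n = n'" if nn: "n \<in> N" "n' \<in> N" and dv: "int Q dvd (int n - int n') * P" for n n'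
    proof -
      have "2 \<le> n" "2 \<le> n'" using cl[OF nn(1)] cl[OF nn(2)] unfolding closest_return_def by blast+
      then have gt0: "0 < n" "0 < n'" by auto
      have "(int n' - int n) * P = - ((int n - int n') * P)" by (simp add: left_diff_distrib)
      then have dv': "int Q dvd (int n' - int n) * P" using dv by simp
      have "\<not> n' < n" using no[OF nn(1) _ gt0(2) dv] by blast
      moreover have "\<not> n < n'" using no[OF nn(2) _ gt0(1) dv'] by blast
      ultimately show ?thesis by simp
    qed
    have 1: "(\<Sum>n\<in>N. I (int n * P)) \<le> 1"
      unfolding I_def
    proof (rule sum_gaps_le_one[OF en(1) Q N])
      show "inj_on (\<lambda>n. int n * P mod int Q) N"
      proof (rule inj_onI)
        fix n n' assume n: "n \<in> N" "n' \<in> N" "int n * P mod int Q = int n' * P mod int Q"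
        have "int Q dvd int n * P - int n' * P" using n(3) by (simp only: mod_eq_dvd_iff)
        then show "n = n'" using inj[OF n(1,2)] by (simp add: left_diff_distrib)
      qed
    qed
    have 2: "(\<Sum>n\<in>N. I ((1 - int n) * P)) \<le> 1"
      unfolding I_def
    proof (rule sum_gaps_le_one[OF en(1) Q N])
      show "inj_on (\<lambda>n. (1 - int n) * P mod int Q) N"
      proof (rule inj_onI)
        fix n n' assume n: "n \<in> N" "n' \<in> N" "(1 - int n) * P mod int Q = (1 - int n') * P mod int Q"
        have "int Q dvd (1 - int n') * P - (1 - int n) * P" using n(3)[symmetric] by (simp only: mod_eq_dvd_iff)
        also have "(1 - int n') * P - (1 - int n) * P = (int n - int n') * P" by (simp add: left_diff_distrib)
        finally show "n = n'" by (rule inj[OF n(1,2)])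
      qed
    qed
    have "real (card N) * (2 * \<kappa>) \<le> (\<Sum>n\<in>N. I (int n * P) + I ((1 - int n) * P))"
      using sum_mono[of N "\<lambda>_. 2 * \<kappa>", OF key] by simp
    then have "2 * (\<kappa> * real (card N)) \<le> 2"
      using 1 2 by (simp add: sum.distrib mult.commute mult.left_commute)
    then show ?thesis by simp
  qed
  ultimately show ?thesis using that by blast
qed

end

subsection \<open>Families of lifts\<close>

lemma lower_bound_refl_map: "lower_bound (refl_map f) = refl_map (upper_bound f)"
  by (simp add: lower_bound_refl)

lemma upper_bound_refl_map: "upper_bound (refl_map f) = refl_map (lower_bound f)"
  by (simp add: lower_bound_refl)

lemma irrational_far:
  assumes "\<omega> \<notin> \<rat>"
  shows "\<exists>e>0. \<forall>k m. 0 < k \<and> k < (n::nat) \<longrightarrow> e \<le> \<bar>real k * \<omega> - of_int m\<bar>"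
proof (induction n)
  case (Suc n)
  then obtain e where e: "e > 0" "\<And>k m. 0 < k \<Longrightarrow> k < n \<Longrightarrow> e \<le> \<bar>real k * \<omega> - of_int m\<bar>" by blast
  define d where "d = \<bar>real n * \<omega> - of_int (round (real n * \<omega>))\<bar>"
  show ?case
  proof (cases "n = 0")
    case False
    have "d \<noteq> 0"
    proof
      assume "d = 0"
      then have "\<omega> = of_int (round (real n * \<omega>)) / of_int (int n)" using False by (simp add: d_def field_simps)
      moreover have "of_int (round (real n * \<omega>)) / of_int (int n) \<in> (\<rat> :: real set)"
        by (intro Rats_divide Rats_of_int)
      ultimately have "\<omega> \<in> \<rat>" by (simp only:)
      then show False using assms by simp
    qed
    then have "d > 0" by (simp add: d_def)
    moreover have "d \<le> \<bar>real n * \<omega> - of_int m\<bar>" for m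
      unfolding d_def using round_diff_minimal[of "real n * \<omega>" m] by (simp add: abs_minus_commute)
    ultimately show ?thesis using e
      by (intro exI[of _ "min d e"]) (metis less_SucE min.coboundedI1 min.coboundedI2 min_less_iff_conj)
  qed (auto intro: exI[of _ 1])
qed (auto intro: exI[of _ 1])

text \<open>Closest returns of the rotation by \<open>\<omega>\<close> with a margin
  \<open>e\<close>. The margin makes the condition open, so all fractions near
  \<open>\<omega>\<close> inherit it.\<close>

definition isolated_return :: "real \<Rightarrow> nat \<Rightarrow> bool" where
  "isolated_return \<omega> n \<longleftrightarrow> 2 \<le> n \<and>
     (\<exists>m e. \<bar>real n * \<omega> - of_int m\<bar> < e \<and> (\<forall>k m'. 0 < k \<and> k < n \<longrightarrow> e \<le> \<bar>real k * \<omega> - of_int m'\<bar>))"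

text \<open>Given \<open>n0\<close>, the threshold \<open>e\<close> is not undercut before time
  \<open>n0\<close>. Dirichlet's theorem supplies a time that undercuts it, and the least such time
  is an isolated return.\<close>

lemma infinite_isolated_returns:
  assumes "\<omega> \<notin> \<rat>"
  shows "infinite {n. isolated_return \<omega> n}"
  unfolding infinite_nat_iff_unbounded_le
proof
  fix n0 :: nat
  obtain e where e: "e > 0" "\<And>k m. 0 < k \<Longrightarrow> k < max n0 2 \<Longrightarrow> e \<le> \<bar>real k * \<omega> - of_int m\<bar>"
    using irrational_far[OF assms] by blast
  define S where "S n \<longleftrightarrow> 0 < n \<and> (\<exists>m. \<bar>real n * \<omega> - of_int m\<bar> < e)" for n :: nat
  obtain N' where "1 / real (Suc N') < e" using e(1) by (rule nat_approx_posE)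
  then obtain N :: nat where N: "N > 0" "1 / real N < e" by blast
  obtain h k where hk: "0 < k" "k \<le> int N" "\<bar>of_int k * \<omega> - of_int h\<bar> < 1 / real N"
    by (rule Dirichlet_approx[OF N(1)])
  have "\<bar>real (nat k) * \<omega> - of_int h\<bar> < e" using hk N(2) by simp
  then have "S (nat k)" unfolding S_def using hk(1) by auto
  then have ex: "S (LEAST n. S n)" by (rule LeastI)
  define n where "n = (LEAST n. S n)"
  have n: "S n" "\<And>k. k < n \<Longrightarrow> \<not> S k" unfolding n_def by (rule ex, rule not_less_Least)
  have "n \<ge> max n0 2"
  proof (rule ccontr)
    assume "\<not> ?thesis"
    then have lt: "n < max n0 2" by (simp only: not_le)
    obtain m where m: "0 < n" "\<bar>real n * \<omega> - of_int m\<bar> < e" using n(1) unfolding S_def by blast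
    show False using e(2)[OF m(1) lt, of m] m(2) by linarith
  qed
  moreover have "isolated_return \<omega> n"
    unfolding isolated_return_def
  proof (intro conjI)
    show "2 \<le> n" using \<open>n \<ge> max n0 2\<close> by simp
    obtain m where m: "\<bar>real n * \<omega> - of_int m\<bar> < e" using n(1) unfolding S_def by blast
    have far: "e \<le> \<bar>real k * \<omega> - of_int m'\<bar>" if "0 < k" "k < n" for k m'
    proof (rule ccontr)
      assume "\<not> ?thesis"
      then have "S k" using that(1) unfolding S_def by (intro conjI exI[of _ m']) auto
      then show False using n(2)[OF that(2)] by blast
    qed
    show "\<exists>m e. \<bar>real n * \<omega> - of_int m\<bar> < e \<and> (\<forall>k m'. 0 < k \<and> k < n \<longrightarrow> e \<le> \<bar>real k * \<omega> - of_int m'\<bar>)"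
      by (intro exI[of _ m] exI[of _ e] conjI allI impI m far) auto
  qed
  ultimately show "\<exists>n\<ge>n0. n \<in> {n. isolated_return \<omega> n}" by (intro exI[of _ n]) simp
qed

lemma isolated_return_stable:
  assumes "isolated_return \<omega> n"
  shows "\<exists>d>0. \<forall>P Q. Q > 0 \<longrightarrow> \<bar>of_int P / real Q - \<omega>\<bar> < d \<longrightarrow> closest_return P Q n"
proof -
  obtain m e where n: "2 \<le> n" and me: "\<bar>real n * \<omega> - of_int m\<bar> < e"
    "\<And>k m'. 0 < k \<Longrightarrow> k < n \<Longrightarrow> e \<le> \<bar>real k * \<omega> - of_int m'\<bar>"
    using assms unfolding isolated_return_def by blast
  \<comment> \<open>Up to time \<open>n\<close> a perturbation by less than \<open>d\<close> moves
    each multiple by less than half of the margin, so the strict comparison survives.\<close>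
  define d where "d = (e - \<bar>real n * \<omega> - of_int m\<bar>) / (2 * real n)"
  show ?thesis
  proof (intro exI[of _ d] conjI allI impI)
    show "d > 0" using me(1) n by (simp add: d_def)
    fix P :: int and Q :: nat assume Q: "Q > 0" and close: "\<bar>of_int P / real Q - \<omega>\<bar> < d"
    have near: "\<bar>(real k * of_int P / real Q - of_int m') - (real k * \<omega> - of_int m')\<bar> \<le> real n * d" if "k \<le> n" for k m'
    proof -
      have "(real k * of_int P / real Q - of_int m') - (real k * \<omega> - of_int m') = real k * (of_int P / real Q - \<omega>)"
        by (simp add: algebra_simps)
      then have "\<bar>(real k * of_int P / real Q - of_int m') - (real k * \<omega> - of_int m')\<bar> = real k * \<bar>of_int P / real Q - \<omega>\<bar>"
        by (simp add: abs_mult)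
      also have "\<dots> \<le> real n * d" using close that by (intro mult_mono) auto
      finally show ?thesis .
    qed
    have nd: "real n * d = (e - \<bar>real n * \<omega> - of_int m\<bar>) / 2" using n by (simp add: d_def)
    have scale: "of_int \<bar>int k * P - m' * int Q\<bar> = real Q * \<bar>real k * of_int P / real Q - of_int m'\<bar>" for k m'
    proof -
      have "real_of_int (int k * P - m' * int Q) = real Q * (real k * of_int P / real Q - of_int m')"
        using Q by (simp add: field_simps)
      then show ?thesis by (simp add: abs_mult)
    qed
    have strict: "\<bar>real n * \<omega> - of_int m\<bar> + real n * d = e - real n * d"
      unfolding nd by (simp add: diff_divide_distrib)
    have lt: "\<bar>(real n * of_int P / real Q - of_int m) - (real n * \<omega> - of_int m)\<bar> < real n * d"
    proof -
      have "(real n * of_int P / real Q - of_int m) - (real n * \<omega> - of_int m) = real n * (of_int P / real Q - \<omega>)"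
        by (simp add: algebra_simps)
      then show ?thesis using close n by (simp add: abs_mult)
    qed
    have "\<bar>real n * of_int P / real Q - of_int m\<bar> < \<bar>real k * of_int P / real Q - of_int m'\<bar>"
      if "0 < k" "k < n" for k m'
      using me(2)[OF that, of m'] near[of k m'] that lt strict by linarith
    then have "real_of_int \<bar>int n * P - m * int Q\<bar> < of_int \<bar>int k * P - m' * int Q\<bar>" if "0 < k" "k < n" for k m'
      unfolding scale using Q that by simp
    then have "\<bar>int n * P - m * int Q\<bar> < \<bar>int k * P - m' * int Q\<bar>" if "0 < k" "k < n" for k m'
      using that by (simp only: of_int_less_iff)
    then show "closest_return P Q n" unfolding closest_return_def using n by blast
  qed
qed

lemma det_coprime:
  fixes p q P Q :: int
  assumes "q * P - Q * p = 1"
  shows "coprime P Q" "coprime p q"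
proof -
  show "coprime P Q"
  proof (rule coprimeI)
    fix c assume "c dvd P" "c dvd Q"
    then have "c dvd q * P - Q * p" by (intro dvd_diff dvd_mult dvd_mult2)
    then show "is_unit c" by (simp add: assms)
  qed
  show "coprime p q"
  proof (rule coprimeI)
    fix c assume "c dvd p" "c dvd q"
    then have "c dvd q * P - Q * p" by (intro dvd_diff dvd_mult dvd_mult2)
    then show "is_unit c" by (simp add: assms)
  qed
qed

lemma (in bimodal) f1_C: "f1 C = 0"
proof (rule DERIV_local_max[OF D1])
  show "min 1 (Cp - C) > 0" using right_plateau CK by simp
  show "\<forall>y. \<bar>C - y\<bar> < min 1 (Cp - C) \<longrightarrow> f y \<le> f C"
    by (intro allI impI below_fC) auto
qed

text \<open>What is used of class N, written for the maps with \<open>a = 0\<close> in a form stable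
  under reflection. The last assumption is how a gap exceeding 1 enters.\<close>

locale lift_family =
  fixes f :: "real \<Rightarrow> real \<Rightarrow> real" and f' :: "real \<Rightarrow> real \<Rightarrow> real" and bc :: real
  assumes lift: "\<And>b. degree_one_lift (f b)"
    and deriv: "\<And>b x. (f b has_real_derivative f' b x) (at x)"
    and cont': "\<And>b x. isCont (f' b) x"
    and close: "\<And>b e. e > 0 \<Longrightarrow> \<exists>d>0. \<forall>b'. \<bar>b' - b\<bar> < d \<longrightarrow> (\<forall>x. \<bar>f b' x - f b x\<bar> \<le> e)"
    and close': "\<And>b e. e > 0 \<Longrightarrow> \<exists>d>0. \<forall>b'. \<bar>b' - b\<bar> < d \<longrightarrow> (\<forall>x. \<bar>f' b' x - f' b x\<bar> \<le> e)"
    and mono_below: "\<And>b. b \<le> bc \<Longrightarrow> mono (f b)"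
    and strict_at: "strict_mono (f bc)"
    and bimodal_above: "\<And>b. b > bc \<Longrightarrow> \<exists>f2 f3 C K. bimodal (f b) (f' b) f2 f3 C K"
    and critical: "\<exists>c. f' bc c = 0"
    and separated: "\<exists>b1>bc. \<forall>x. lower_bound (f b1) x \<noteq> upper_bound (f b1) x"
begin

abbreviation "fu b \<equiv> upper_bound (f b)"
abbreviation "fl b \<equiv> lower_bound (f b)"

lemmas fu_lift = degree_one_lift_upper_bound[OF lift]
lemmas fu_mono = mono_upper_bound[OF lift]
lemmas fl_lift = degree_one_lift_lower_bound[OF lift]
lemmas fl_mono = mono_lower_bound[OF lift]

definition \<alpha> :: "int \<Rightarrow> nat \<Rightarrow> real \<Rightarrow> real" where "\<alpha> p q b = lo p q (fl b)"
definition \<beta> :: "int \<Rightarrow> nat \<Rightarrow> real \<Rightarrow> real" where "\<beta> p q b = hi p q (fu b)"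

lemma f'_add_int: "f' b (x + of_int k) = f' b x"
  by (rule lift_deriv_add_int[OF lift deriv])

text \<open>Each bound contributes an interval of translations. Since the lower bound is the smaller
  map, its interval begins and ends later, so the intersection runs from the left end of one to the
  right end of the other.\<close>

lemma locked_iff:
  assumes "q > 0"
  shows "Rot (translate (f b) a) = {of_int p / real q} \<longleftrightarrow> \<alpha> p q b \<le> a \<and> a \<le> \<beta> p q b"
proof -
  have "lo p q (fu b) \<le> lo p q (fl b)" "hi p q (fu b) \<le> hi p q (fl b)"
    using lo_le_lo[OF fl_lift fl_mono fu_lift fu_mono assms, of b b 0 p]
      hi_le_hi[OF fl_lift fl_mono fu_lift fu_mono assms, of b b 0 p] lower_le_upper[OF lift] by auto
  then show ?thesis
    unfolding Rot_eq_iff[OF degree_one_lift_translate[OF lift] assms]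
      upper_bound_translate'[OF lift] lower_bound_translate'[OF lift]
      has_type_trans_iff[OF fl_lift fl_mono assms] has_type_trans_iff[OF fu_lift fu_mono assms]
      \<alpha>_def \<beta>_def by linarith
qed



lemma continuous_\<alpha>: "q > 0 \<Longrightarrow> isCont (\<alpha> p q) b"
  unfolding continuous_at_eps_delta
proof (intro allI impI)
  fix e :: real assume q: "q > 0" and "e > 0"
  then obtain d where d: "d > 0" "\<And>b' x. \<bar>b' - b\<bar> < d \<Longrightarrow> \<bar>f b' x - f b x\<bar> \<le> e / 2"
    using close[of "e / 2" b] by auto
  show "\<exists>d>0. \<forall>x'. dist x' b < d \<longrightarrow> dist (\<alpha> p q x') (\<alpha> p q b) < e"
  proof (intro exI[of _ d] conjI allI impI)
    fix b' assume "dist b' b < d"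
    then have "\<bar>fl b' x - fl b x\<bar> \<le> e / 2" for x
      using d(2)[of b'] by (intro lower_bound_dist lift) (auto simp: dist_real_def)
    then have "\<bar>\<alpha> p q b' - \<alpha> p q b\<bar> \<le> e / 2"
      unfolding \<alpha>_def by (intro lo_dist fl_lift fl_mono q)
    then show "dist (\<alpha> p q b') (\<alpha> p q b) < e" using \<open>e > 0\<close> by (simp add: dist_real_def)
  qed (rule d(1))
qed

lemma continuous_\<beta>: "q > 0 \<Longrightarrow> isCont (\<beta> p q) b"
  unfolding continuous_at_eps_delta
proof (intro allI impI)
  fix e :: real assume q: "q > 0" and "e > 0"
  then obtain d where d: "d > 0" "\<And>b' x. \<bar>b' - b\<bar> < d \<Longrightarrow> \<bar>f b' x - f b x\<bar> \<le> e / 2"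
    using close[of "e / 2" b] by auto
  show "\<exists>d>0. \<forall>x'. dist x' b < d \<longrightarrow> dist (\<beta> p q x') (\<beta> p q b) < e"
  proof (intro exI[of _ d] conjI allI impI)
    fix b' assume "dist b' b < d"
    then have "\<bar>fu b' x - fu b x\<bar> \<le> e / 2" for x
      using d(2)[of b'] by (intro upper_bound_dist lift) (auto simp: dist_real_def)
    then have "\<bar>\<beta> p q b' - \<beta> p q b\<bar> \<le> e / 2"
      unfolding \<beta>_def by (intro hi_dist fu_lift fu_mono q)
    then show "dist (\<beta> p q b') (\<beta> p q b) < e" using \<open>e > 0\<close> by (simp add: dist_real_def)
  qed (rule d(1))
qed

lemma locked_below: "b \<le> bc \<Longrightarrow> q > 0 \<Longrightarrow> \<alpha> p q b \<le> \<beta> p q b"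
  using lo_le_hi[OF lift mono_below]
  by (simp add: \<alpha>_def \<beta>_def lower_bound_mono_eq[OF lift mono_below] upper_bound_mono_eq[OF lift mono_below])

lemma locked_good:
  assumes "b > bc" "q > 0" "coprime p (int q)" "\<alpha> p q b \<le> \<beta> p q b"
    and "bimodal (f b) (f' b) f2 f3 C K"
  obtains X where "good_orbit (translate (f b) (\<beta> p q b)) C K p q X"
proof -
  interpret T: bimodal "translate (f b) (\<beta> p q b)" "f' b" f2 f3 C K
    by (rule bimodal.translated[OF assms(5)])
  have "Rot (translate (f b) (\<beta> p q b)) = {of_int p / real q}"
    using locked_iff[OF assms(2)] assms(4) by simp
  then have types: "has_type T.fl p q" "has_type T.fu p q"
    unfolding Rot_eq_iff[OF degree_one_lift_translate[OF lift] assms(2)] by auto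
  have "x + of_int p \<le> (T.fu ^^ q) x" for x
    unfolding upper_bound_translate'[OF lift] \<beta>_def by (rule at_hi[OF fu_lift fu_mono assms(2)])
  from T.locked_good_orbit[OF assms(2,3) types this] that show ?thesis by blast
qed



text \<open>Requiring locking at every lower height singles out the part connected to the critical
  line; the region may reappear higher up.\<close>

definition tip_height :: "int \<Rightarrow> nat \<Rightarrow> real" where
  "tip_height p q = Sup {b. \<forall>b'\<le>b. \<alpha> p q b' \<le> \<beta> p q b'}"

text \<open>Locking would yield a good orbit, and on a good orbit the two bounds agree.\<close>

lemma separated_unlocked: "\<exists>b1>bc. \<forall>p q. q > 0 \<longrightarrow> coprime p (int q) \<longrightarrow> \<beta> p q b1 < \<alpha> p q b1"
proof -
  obtain b1 where b1: "b1 > bc" "\<And>x. fl b1 x \<noteq> fu b1 x" using separated by blast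
  obtain f2 f3 C K where bim: "bimodal (f b1) (f' b1) f2 f3 C K" using bimodal_above[OF b1(1)] by blast
  have "\<beta> p q b1 < \<alpha> p q b1" if q: "q > 0" "coprime p (int q)" for p q
  proof (rule ccontr)
    assume "\<not> ?thesis"
    then have "\<alpha> p q b1 \<le> \<beta> p q b1" by simp
    from locked_good[OF b1(1) q this bim] obtain X
      where X: "good_orbit (translate (f b1) (\<beta> p q b1)) C K p q X" by blast
    interpret T: bimodal "translate (f b1) (\<beta> p q b1)" "f' b1" f2 f3 C K
      by (rule bimodal.translated[OF bim])
    have "T.fl (X 0) = T.fu (X 0)" using T.good_orbitD(2,3)[OF X q(1)] by simp
    then show False using b1(2)[of "X 0"]
      by (simp add: upper_bound_translate'[OF lift] lower_bound_translate'[OF lift])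
  qed
  then show ?thesis using b1(1) by blast
qed

text \<open>By continuity the locking interval at the supremum is nonempty, and if it had positive
  length it would persist slightly higher.\<close>

lemma tip_height:
  assumes q: "q > 0" "coprime p (int q)"
  shows "bc \<le> tip_height p q" "\<And>b. b \<le> tip_height p q \<Longrightarrow> \<alpha> p q b \<le> \<beta> p q b" "\<alpha> p q (tip_height p q) = \<beta> p q (tip_height p q)"
    and "\<And>b. (\<And>b'. b' \<le> b \<Longrightarrow> \<alpha> p q b' \<le> \<beta> p q b') \<Longrightarrow> b \<le> tip_height p q"
proof -
  let ?S = "{b. \<forall>b'\<le>b. \<alpha> p q b' \<le> \<beta> p q b'}"
  obtain b1 where b1: "b1 > bc" "\<beta> p q b1 < \<alpha> p q b1" using separated_unlocked q by blast
  have bdd: "bdd_above ?S"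
  proof (rule bdd_aboveI)
    fix b assume "b \<in> ?S"
    then have "b1 \<le> b \<longrightarrow> \<alpha> p q b1 \<le> \<beta> p q b1" by blast
    then show "b \<le> b1" using b1(2) by linarith
  qed
  have bcS: "bc \<in> ?S" using locked_below q(1) by auto
  show upper: "b \<le> tip_height p q" if "\<And>b'. b' \<le> b \<Longrightarrow> \<alpha> p q b' \<le> \<beta> p q b'" for b
    unfolding tip_height_def using that by (intro cSup_upper bdd) auto
  show "bc \<le> tip_height p q" unfolding tip_height_def using bcS by (intro cSup_upper bdd)
  have less: "\<alpha> p q b \<le> \<beta> p q b" if b: "b < tip_height p q" for b
  proof -
    have "?S \<noteq> {}" using bcS by blast
    from less_cSupD[OF this b[unfolded tip_height_def]] obtain b2 where "b2 \<in> ?S" "b < b2" by blast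
    then show ?thesis by simp
  qed
  have tendsto: "(\<lambda>b. \<beta> p q b - \<alpha> p q b) \<midarrow>x\<rightarrow> \<beta> p q x - \<alpha> p q x" for x
    using continuous_\<alpha>[OF q(1), of x p] continuous_\<beta>[OF q(1), of x p] by (intro tendsto_diff) (simp_all add: isCont_def)
  have le: "\<alpha> p q (tip_height p q) \<le> \<beta> p q (tip_height p q)"
  proof (rule ccontr)
    assume "\<not> ?thesis"
    then have neg: "\<beta> p q (tip_height p q) - \<alpha> p q (tip_height p q) < 0" by simp
    have "\<forall>\<^sub>F b in at (tip_height p q). \<beta> p q b - \<alpha> p q b < 0" using order_tendstoD(2)[OF tendsto neg] .
    then obtain d where d: "d > 0" "\<And>b. b \<noteq> tip_height p q \<Longrightarrow> dist b (tip_height p q) < d \<Longrightarrow> \<beta> p q b - \<alpha> p q b < 0"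
      unfolding eventually_at by auto
    have "dist (tip_height p q - d / 2) (tip_height p q) < d" using d(1) by (simp add: dist_real_def)
    then show False using d(1) less[of "tip_height p q - d / 2"] d(2)[of "tip_height p q - d / 2"] by simp
  qed
  then show all: "\<alpha> p q b \<le> \<beta> p q b" if "b \<le> tip_height p q" for b using less[of b] that by (cases "b = tip_height p q") auto
  show "\<alpha> p q (tip_height p q) = \<beta> p q (tip_height p q)"
  proof (rule ccontr)
    assume "\<not> ?thesis"
    then have pos: "\<beta> p q (tip_height p q) - \<alpha> p q (tip_height p q) > 0" using le by simp
    have "\<forall>\<^sub>F b in at (tip_height p q). \<beta> p q b - \<alpha> p q b > 0" using order_tendstoD(1)[OF tendsto pos] .
    then obtain d where d: "d > 0" "\<And>b. b \<noteq> tip_height p q \<Longrightarrow> dist b (tip_height p q) < d \<Longrightarrow> \<beta> p q b - \<alpha> p q b > 0"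
      unfolding eventually_at by auto
    have "tip_height p q + d / 2 \<le> tip_height p q"
    proof (rule upper)
      fix b assume b: "b \<le> tip_height p q + d / 2"
      show "\<alpha> p q b \<le> \<beta> p q b"
      proof (cases "b \<le> tip_height p q")
        case False
        then have "dist b (tip_height p q) < d" using b d(1) unfolding dist_real_def by linarith
        then show ?thesis using d(2)[of b] False by simp
      qed (rule all)
    qed
    then show False using d(1) by simp
  qed
qed

lemma reflected: "lift_family (\<lambda>b. refl_map (f b)) (\<lambda>b x. f' b (- x)) bc"
proof unfold_locales
  fix b x :: real
  have minus: "(uminus has_real_derivative - 1) (at x)" by (auto intro!: derivative_eq_intros)
  show "degree_one_lift (refl_map (f b))" by (rule degree_one_lift_refl_map[OF lift])
  show "(refl_map (f b) has_real_derivative f' b (- x)) (at x)"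
    using DERIV_minus[OF DERIV_chain2[OF deriv[of b "- x"] minus]] by (simp add: refl_map_def[abs_def])
  show "isCont (\<lambda>x. f' b (- x)) x"
    using isCont_o2[of x uminus "f' b"] cont' by (simp add: continuous_minus)
next
  fix b e :: real assume "e > 0"
  have "\<bar>refl_map (f b') x - refl_map (f b) x\<bar> = \<bar>f b' (- x) - f b (- x)\<bar>" for b' x
    by (simp add: refl_map_def)
  with close[OF \<open>e > 0\<close>, of b]
  show "\<exists>d>0. \<forall>b'. \<bar>b' - b\<bar> < d \<longrightarrow> (\<forall>x. \<bar>refl_map (f b') x - refl_map (f b) x\<bar> \<le> e)"
    by metis
  from close'[OF \<open>e > 0\<close>, of b] show "\<exists>d>0. \<forall>b'. \<bar>b' - b\<bar> < d \<longrightarrow> (\<forall>x. \<bar>f' b' (- x) - f' b (- x)\<bar> \<le> e)"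
    by blast
next
  fix b assume "b \<le> bc"
  then show "mono (refl_map (f b))" by (intro mono_refl_map mono_below)
next
  show "strict_mono (refl_map (f bc))" using strict_at by (simp add: strict_mono_def refl_map_def)
next
  fix b assume "bc < b"
  then obtain f2 f3 C K where "bimodal (f b) (f' b) f2 f3 C K" using bimodal_above by blast
  from bimodal.reflected[OF this] show "\<exists>f2 f3 C K. bimodal (refl_map (f b)) (\<lambda>x. f' b (- x)) f2 f3 C K" by blast
next
  obtain c where "f' bc c = 0" using critical by blast
  then show "\<exists>c. f' bc (- c) = 0" by (intro exI[of _ "- c"]) simp
next
  obtain b1 where b1: "b1 > bc" "\<And>x. fl b1 x \<noteq> fu b1 x" using separated by blast
  have "lower_bound (refl_map (f b1)) x \<noteq> upper_bound (refl_map (f b1)) x" for x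
    using b1(2)[of "- x"] unfolding lower_bound_refl_map upper_bound_refl_map by (simp add: refl_map_def)
  then show "\<exists>b1>bc. \<forall>x. lower_bound (refl_map (f b1)) x \<noteq> upper_bound (refl_map (f b1)) x" using b1(1) by blast
qed

lemma \<alpha>_refl: "lo p q (lower_bound (refl_map (f b))) = - \<beta> (- p) q b"
  by (simp add: \<beta>_def hi_def lower_bound_refl)

lemma \<beta>_refl: "hi p q (upper_bound (refl_map (f b))) = - \<alpha> (- p) q b"
  by (simp add: \<alpha>_def hi_def lower_bound_refl)


subsection \<open>Tips along sequences of Farey neighbours\<close>

text \<open>A uniform strict increase at the critical line forces points with equal images under a
  nearby map to be close, which makes both plateaus short.\<close>

lemma strictly_increasing_gap:
  assumes "\<eta> > 0"
  shows "\<exists>\<mu>>0. \<forall>x. f bc x + \<mu> \<le> f bc (x + \<eta>)"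
proof -
  have cont: "continuous_on {0..1} (\<lambda>x. f bc (x + \<eta>) - f bc x)"
    by (intro continuous_intros continuous_on_compose2[OF lift_cont[OF lift, of UNIV]] lift_cont[OF lift]) auto
  obtain z where z: "\<And>x. x \<in> {0..1} \<Longrightarrow> f bc (z + \<eta>) - f bc z \<le> f bc (x + \<eta>) - f bc x"
    using continuous_attains_inf[OF compact_Icc _ cont] by (metis atLeastatMost_empty_iff zero_le_one)
  have "f bc z + (f bc (z + \<eta>) - f bc z) \<le> f bc z + (f bc (x + \<eta>) - f bc x)" for x
  proof -
    obtain k :: int where k: "0 \<le> x + of_int k" "x + of_int k < 0 + 1" using lift_reduce by blast
    have "f bc (x + of_int k + \<eta>) = f bc (x + \<eta>) + of_int k"
      using lift_add_int[OF lift, of bc "x + \<eta>" k] by (simp add: algebra_simps)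
    then show ?thesis using z[of "x + of_int k"] k lift_add_int[OF lift, of bc x k] by simp
  qed
  moreover have "f bc (z + \<eta>) - f bc z > 0" using strict_at assms by (simp add: strict_mono_def)
  ultimately show ?thesis by (intro exI[of _ "f bc (z + \<eta>) - f bc z"]) (auto simp: algebra_simps)
qed

lemma derivative_bounded: "\<exists>B\<ge>1. \<forall>x. \<bar>f' bc x\<bar> \<le> B"
proof -
  have "compact (f' bc ` {0..1})"
    by (intro compact_continuous_image continuous_at_imp_continuous_on ballI cont') auto
  then have "bounded (f' bc ` {0..1})" by (rule compact_imp_bounded)
  then obtain B where B: "\<And>x. x \<in> {0..1} \<Longrightarrow> \<bar>f' bc x\<bar> \<le> B"
    unfolding bounded_iff by force
  have "\<bar>f' bc x\<bar> \<le> max B 1" for x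
  proof -
    obtain k :: int where k: "0 \<le> x + of_int k" "x + of_int k < 0 + 1" using lift_reduce by blast
    then show ?thesis using B[of "x + of_int k"] f'_add_int[of bc x k] by simp
  qed
  then show ?thesis by (intro exI[of _ "max B 1"]) auto
qed

lemma derivative_uniform:
  assumes "e > 0"
  shows "\<exists>d>0. \<forall>x y. \<bar>x - y\<bar> \<le> d \<longrightarrow> \<bar>f' bc x - f' bc y\<bar> \<le> e"
proof -
  have "uniformly_continuous_on {-1..2} (f' bc)"
    by (intro compact_uniformly_continuous continuous_at_imp_continuous_on ballI cont') auto
  then obtain d where d: "d > 0"
    "\<And>x y. x \<in> {-1..2} \<Longrightarrow> y \<in> {-1..2} \<Longrightarrow> dist y x < d \<Longrightarrow> dist (f' bc y) (f' bc x) < e"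
    unfolding uniformly_continuous_on_def using assms by metis
  have "\<bar>f' bc x - f' bc y\<bar> \<le> e" if xy: "\<bar>x - y\<bar> \<le> min (d / 2) 1" for x y
  proof -
    obtain k :: int where k: "0 \<le> x + of_int k" "x + of_int k < 0 + 1" using lift_reduce by blast
    have "\<bar>y - x\<bar> < d" "\<bar>x - y\<bar> \<le> 1" using xy d(1) by linarith+
    then have "dist (f' bc (y + of_int k)) (f' bc (x + of_int k)) < e"
      using k by (intro d(2)) (auto simp: dist_real_def)
    then show ?thesis by (simp add: f'_add_int dist_real_def)
  qed
  then show ?thesis using d(1) by (intro exI[of _ "min (d / 2) 1"]) auto
qed

text \<open>A tip there would make an iterate of the map itself a translation everywhere, but its
  derivative vanishes at the critical point.\<close>

lemma no_tip_at_critical: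
  assumes q: "q > 0"
  shows "\<alpha> p q bc \<noteq> \<beta> p q bc"
proof
  assume eq: "\<alpha> p q bc = \<beta> p q bc"
  let ?a = "\<alpha> p q bc"
  have fb: "fl bc = f bc" "fu bc = f bc"
    using lower_bound_mono_eq[OF lift mono_below] upper_bound_mono_eq[OF lift mono_below] by auto
  have "(translate (f bc) ?a ^^ q) x = x + of_int p" for x
    using at_lo[OF fl_lift fl_mono q, of bc p x] at_hi[OF fu_lift fu_mono q, of x p bc] eq
    unfolding \<alpha>_def \<beta>_def fb by simp
  then have id: "translate (f bc) ?a ^^ q = (\<lambda>x. x + of_int p)" by (rule ext)
  obtain c where c: "f' bc c = 0" using critical by blast
  obtain r where r: "q = Suc r" using q by (cases q) auto
  have D: "(translate (f bc) ?a has_real_derivative f' bc x) (at x)" for x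
    using deriv[of bc x] by (auto intro!: derivative_eq_intros)
  have "\<exists>d. ((translate (f bc) ?a ^^ n) has_real_derivative d) (at x)" for n x
  proof (induction n)
    case 0
    have "((\<lambda>x. x) has_real_derivative 1) (at x)" by simp
    then show ?case by (auto simp: id_def simp del: DERIV_ident)
  next
    case (Suc n)
    then obtain d where "((translate (f bc) ?a ^^ n) has_real_derivative d) (at x)" by blast
    from DERIV_chain[OF D this] show ?case unfolding funpow.simps by blast
  qed
  then obtain d where "((translate (f bc) ?a ^^ r) has_real_derivative d) (at (translate (f bc) ?a c))" by blast
  from DERIV_chain[OF this D] have "(translate (f bc) ?a ^^ q has_real_derivative 0) (at c)"
    unfolding r funpow_Suc_right by (simp add: c)
  moreover have "((\<lambda>x. x + of_int p) has_real_derivative 1) (at c)" by (auto intro!: derivative_eq_intros)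
  ultimately show False using DERIV_unique unfolding id by fastforce
qed

text \<open>The displacement of \<open>C\<^sup>+\<close> under the \<open>q\<close>-th iterate is bounded below
  because \<open>f\<close> is flat there, whereas at a tip \<open>K\<^sup>-\<close> is mapped exactly onto
  \<open>C\<^sup>+\<close> and both points merge at the critical line.\<close>

lemma tips_away:
  assumes q: "q > 0"
  shows "\<exists>\<epsilon>>0. \<forall>P Q b. Q > 0 \<and> int q * P - int Q * p = 1 \<and> bc \<le> b \<and> \<alpha> P Q b = \<beta> P Q b \<longrightarrow> bc + \<epsilon> \<le> b"
proof -
  obtain B0 where B0: "B0 \<ge> 1" "\<And>x. \<bar>f' bc x\<bar> \<le> B0" using derivative_bounded by blast
  \<comment> \<open>The extra 1 absorbs the change of the derivative for nearby
    \<open>b\<close>.\<close>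
  define B where "B = B0 + 1"
  have B1: "B \<ge> 1" using B0(1) by (simp add: B_def)
  \<comment> \<open>Chosen so that after the remaining \<open>q - 1\<close> steps at most half of
    the distance \<open>s\<close> is left.\<close>
  define \<theta> where "\<theta> = 1 / (2 * B ^ (q - 1))"
  have \<theta>: "\<theta> > 0" "B ^ (q - 1) * \<theta> = 1 / 2" using B1 by (simp_all add: \<theta>_def)
  obtain s0 where s0: "s0 > 0" "\<And>x y. \<bar>x - y\<bar> \<le> s0 \<Longrightarrow> \<bar>f' bc x - f' bc y\<bar> \<le> \<theta> / 4"
    using derivative_uniform[of "\<theta> / 4"] \<theta>(1) by auto
  define s where "s = min (s0 / 2) (1 / 4)"
  have s: "s > 0" "s \<le> 1 / 4" "2 * s \<le> s0" using s0(1) by (auto simp: s_def)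
  \<comment> \<open>With both plateaus shorter than \<open>\<eta>\<close>, the right side of the tip
    estimate is at most \<open>s / 4\<close>, against \<open>s / 2\<close> on the left.\<close>
  define \<eta> where "\<eta> = s / (8 * B ^ q)"
  have Bq: "B ^ q \<ge> 1" using B1 by simp
  have \<eta>: "\<eta> > 0" "B ^ q * (2 * \<eta>) = s / 4" using B1 s(1) by (simp_all add: \<eta>_def)
  have "\<eta> \<le> s" unfolding \<eta>_def using Bq s(1) by (simp add: divide_le_eq mult_le_cancel_left1)
  obtain \<mu> where \<mu>: "\<mu> > 0" "\<And>x. f bc x + \<mu> \<le> f bc (x + \<eta>)" using strictly_increasing_gap[OF \<eta>(1)] by blast
  have mono: "x \<le> y \<Longrightarrow> f bc x \<le> f bc y" for x y using mono_below[of bc] by (simp add: mono_def)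
  obtain d1 where d1: "d1 > 0" "\<And>b x. \<bar>b - bc\<bar> < d1 \<Longrightarrow> \<bar>f b x - f bc x\<bar> \<le> \<mu> / 3"
    using close[of "\<mu> / 3" bc] \<mu>(1) by auto
  obtain d2 where d2: "d2 > 0" "\<And>b x. \<bar>b - bc\<bar> < d2 \<Longrightarrow> \<bar>f' b x - f' bc x\<bar> \<le> min 1 (\<theta> / 4)"
    using close'[of "min 1 (\<theta> / 4)" bc] \<theta>(1) by auto
  show ?thesis
  proof (intro exI[of _ "min d1 d2"] conjI allI impI)
    show "min d1 d2 > 0" using d1(1) d2(1) by simp
    fix P Q b assume *: "Q > 0 \<and> int q * P - int Q * p = 1 \<and> bc \<le> b \<and> \<alpha> P Q b = \<beta> P Q b"
    show "bc + min d1 d2 \<le> b"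
    proof (rule ccontr)
      assume "\<not> ?thesis"
      then have b: "\<bar>b - bc\<bar> < d1" "\<bar>b - bc\<bar> < d2" using * by auto
      have Q: "Q > 0" and det: "int q * P - int Q * p = 1" and eq: "\<alpha> P Q b = \<beta> P Q b" using * by auto
      have "b \<noteq> bc" using no_tip_at_critical[OF Q] eq by auto
      then have bgt: "b > bc" using * by simp
      obtain f2 f3 C K where bim: "bimodal (f b) (f' b) f2 f3 C K" using bimodal_above[OF bgt] by blast
      interpret S: bimodal "f b" "f' b" f2 f3 C K by (rule bim)
      have cop: "coprime P (int Q)" using det_coprime(1)[OF det] .
      define a where "a = \<beta> P Q b"
      obtain X where X: "good_orbit (translate (f b) a) C K P Q X"
        using locked_good[OF bgt Q cop _ bim] eq unfolding a_def by auto
      interpret T: bimodal "translate (f b) a" "f' b" f2 f3 C K by (rule S.translated)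
      have below: "(T.fl ^^ Q) x \<le> x + of_int P" for x
        unfolding lower_bound_translate'[OF lift] a_def eq[symmetric] \<alpha>_def by (rule at_lo[OF fl_lift fl_mono Q])
      have above: "x + of_int P \<le> (T.fu ^^ Q) x" for x
        unfolding upper_bound_translate'[OF lift] a_def \<beta>_def by (rule at_hi[OF fu_lift fu_mono Q])
      have ret: "(translate S.fu a ^^ q) S.Km = S.Cp + of_int p"
        using T.tip_return[OF X Q below above det]
        by (simp add: upper_bound_translate'[OF lift] S.right_plateau_translate S.left_plateau_translate)
      have near: "y - x < \<eta>" if "f b x = f b y" "x \<le> y" for x y
      proof (rule ccontr)
        assume "\<not> ?thesis"
        then have "f bc x + \<mu> \<le> f bc y" using \<mu>(2)[of x] mono[of "x + \<eta>" y] by simp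
        then show False using d1(2)[OF b(1), of x] d1(2)[OF b(1), of y] that(1) \<mu>(1) by linarith
      qed
      have C1: "S.Cp - C < \<eta>" using near[of C S.Cp] S.right_plateau S.CK by simp
      have K1: "K - S.Km < \<eta>" using near[of S.Km K] S.left_plateau S.CK by simp
      have s1: "S.Cp + s \<le> C + 1" using C1 \<open>\<eta> \<le> s\<close> s(2) by linarith
      \<comment> \<open>Because \<open>P/Q\<close> is larger than \<open>p/q\<close>, the
        translation at the tip is beyond the interval of \<open>p/q\<close> for the upper bound, and
        all points are moved by more than \<open>p\<close>.\<close>
      have lt: "hi p q S.fu < lo P Q S.fu"
        by (rule hi_less_lo[OF fu_lift fu_mono q Q]) (use det in \<open>simp add: algebra_simps\<close>)
      have "lo P Q S.fu \<le> a" unfolding a_def \<beta>_def by (rule lo_le_hi[OF fu_lift fu_mono Q])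
      then have "\<not> a \<le> hi p q S.fu" using lt by simp
      then have ab: "x + of_int p \<le> (translate S.fu a ^^ q) x" for x
        unfolding le_hi_iff[OF fu_lift fu_mono q] by (meson less_imp_le not_le)
      have "s * (1 - B ^ (q - 1) * \<theta>) \<le> B ^ q * (S.Cp - S.Km)"
      proof (rule S.tip_estimate[OF _ s(1) s1 _ q ret ab])
        fix x
        show "\<bar>f' b x\<bar> \<le> B" using B0(2)[of x] d2(2)[OF b(2), of x] by (simp add: B_def abs_le_iff)
        assume x: "S.Cp \<le> x" "x \<le> S.Cp + s"
        have "\<bar>x - C\<bar> \<le> s0" using x C1 \<open>\<eta> \<le> s\<close> s(3) S.right_plateau S.CK by simp
        \<comment> \<open>The derivative at \<open>C\<close> is 0 for the map at height
          \<open>b\<close>; comparing both points with the map at the critical line transfers the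
          smallness to \<open>x\<close>.\<close>
        then have "\<bar>f' bc x - f' bc C\<bar> \<le> \<theta> / 4" by (rule s0(2))
        moreover have "\<bar>f' b x - f' bc x\<bar> \<le> \<theta> / 4" "\<bar>f' b C - f' bc C\<bar> \<le> \<theta> / 4"
          using d2(2)[OF b(2), of x] d2(2)[OF b(2), of C] by auto
        ultimately show "f' b x \<le> \<theta>" using S.f1_C \<theta>(1) by linarith
      qed
      then have "s / 2 \<le> B ^ q * (S.Cp - S.Km)" unfolding \<theta>(2) by simp
      also have "\<dots> \<le> B ^ q * (2 * \<eta>)" using C1 K1 S.CK Bq by (intro mult_left_mono) auto
      finally show False using s(1) \<eta>(2) by simp
    qed
  qed
qed

text \<open>The Farey sum of \<open>p/q\<close> and the larger \<open>P/Q\<close> has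
  \<open>P/Q\<close> as right parent, so locking of the child descends to \<open>P/Q\<close> at
  every height.\<close>

lemma tip_height_child_le:
  assumes q: "q > 0" "Q > 0" and det: "int q * P - int Q * p = 1"
  shows "tip_height (P + p) (Q + q) \<le> tip_height P Q"
proof -
  have cop: "coprime P (int Q)" using det_coprime(1)[OF det] .
  have "int q * (P + p) - int (Q + q) * p = 1" using det by (simp add: algebra_simps)
  from det_coprime(1)[OF this] have cop': "coprime (P + p) (int (Q + q))" .
  have Qq: "Q + q > 0" using q by simp
  show ?thesis
  proof (rule tip_height(4)[OF q(2) cop])
    fix b assume b: "b \<le> tip_height (P + p) (Q + q)"
    show "\<alpha> P Q b \<le> \<beta> P Q b"
    proof (cases "b \<le> bc")
      case True
      then show ?thesis by (rule locked_below[OF _ q(2)])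
    next
      case False
      then have bgt: "b > bc" by simp
      obtain f2 f3 C K where bim: "bimodal (f b) (f' b) f2 f3 C K" using bimodal_above[OF bgt] by blast
      interpret S: bimodal "f b" "f' b" f2 f3 C K by (rule bim)
      obtain X where X: "good_orbit (translate (f b) (\<beta> (P + p) (Q + q) b)) C K (P + p) (Q + q) X"
        using locked_good[OF bgt Qq cop' tip_height(2)[OF Qq cop' b] bim] by blast
      obtain t where "has_type (translate S.fl t) P Q" "has_type (translate S.fu t) P Q"
        using S.good_orbit_right_parent[OF X, of P p Q q] q det by (auto simp: algebra_simps)
      then have "\<alpha> P Q b \<le> t" "t \<le> \<beta> P Q b"
        unfolding \<alpha>_def \<beta>_def using has_type_trans_iff[OF fl_lift fl_mono q(2)] has_type_trans_iff[OF fu_lift fu_mono q(2)] by blast+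
      then show ?thesis by simp
    qed
  qed
qed

text \<open>The heights decrease and stay above the critical line by a fixed amount. The
  translations at the tips are squeezed onto the right end of the locking interval of
  \<open>p/q\<close>.\<close>

lemma tips_converge:
  assumes q: "q > 0" "Q > 0" and det: "int q * P - int Q * p = 1"
  defines "Pj \<equiv> \<lambda>j::nat. P + int j * p" and "Qj \<equiv> \<lambda>j::nat. Q + j * q"
  obtains b where "bc < b" "\<alpha> p q b \<le> \<beta> p q b" "(\<lambda>j. tip_height (Pj j) (Qj j)) \<longlonglongrightarrow> b"
    "(\<lambda>j. \<beta> (Pj j) (Qj j) (tip_height (Pj j) (Qj j))) \<longlonglongrightarrow> \<beta> p q b" "decseq (\<lambda>j. tip_height (Pj j) (Qj j))"
proof -
  have detj: "int q * Pj j - int (Qj j) * p = 1" for j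
    using det by (simp add: Pj_def Qj_def algebra_simps)
  have Qj0: "Qj j > 0" for j using q by (simp add: Qj_def)
  have cop: "coprime (Pj j) (int (Qj j))" for j using det_coprime(1)[OF detj] .
  let ?t = "\<lambda>j. tip_height (Pj j) (Qj j)"
  have dec: "decseq ?t"
  proof (rule decseq_SucI)
    fix j
    have "Pj (Suc j) = Pj j + p" "Qj (Suc j) = Qj j + q" by (simp_all add: Pj_def Qj_def algebra_simps)
    then show "?t (Suc j) \<le> ?t j" using tip_height_child_le[OF q(1) Qj0 detj, of j] by simp
  qed
  obtain \<epsilon> where \<epsilon>: "\<epsilon> > 0"
    "\<And>P Q b. Q > 0 \<and> int q * P - int Q * p = 1 \<and> bc \<le> b \<and> \<alpha> P Q b = \<beta> P Q b \<Longrightarrow> bc + \<epsilon> \<le> b"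
    using tips_away[OF q(1), of p] by auto
  have ge: "bc + \<epsilon> \<le> ?t j" for j
    using \<epsilon>(2)[of "Qj j" "Pj j" "?t j"] Qj0 detj tip_height(1)[OF Qj0 cop] tip_height(3)[OF Qj0 cop] by blast
  obtain b where b: "?t \<longlonglongrightarrow> b" and "\<forall>i. b \<le> ?t i"
    by (rule decseq_convergent[OF dec allI[OF ge]])
  have "bc + \<epsilon> \<le> b" using LIMSEQ_le_const[OF b] ge by blast
  let ?a = "\<lambda>j. \<beta> (Pj j) (Qj j) (?t j)"
  have \<beta>lim: "(\<lambda>j. \<beta> p q (?t j)) \<longlonglongrightarrow> \<beta> p q b" by (rule isCont_tendsto_compose[OF continuous_\<beta>[OF q(1)] b])
  have \<alpha>lim: "(\<lambda>j. \<alpha> p q (?t j)) \<longlonglongrightarrow> \<alpha> p q b" by (rule isCont_tendsto_compose[OF continuous_\<alpha>[OF q(1)] b])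
  have less: "p * int (Qj j) < Pj j * int q" for j using detj[of j] by (simp add: algebra_simps)
  have lower: "\<beta> p q (?t j) \<le> ?a j" for j
    using hi_less_lo[OF fu_lift fu_mono q(1) Qj0 less, of "?t j" j] lo_le_hi[OF fu_lift fu_mono Qj0, of "Pj j" j "?t j"]
    unfolding \<beta>_def by linarith
  \<comment> \<open>At a tip the translation is also the left end for the lower bound. This
    comparison gives \<open>\<alpha> p q b \<le> \<beta> p q b\<close> in the limit, so the limit
    point is locked.\<close>
  have lower\<alpha>: "\<alpha> p q (?t j) \<le> ?a j" for j
    using hi_less_lo[OF fl_lift fl_mono q(1) Qj0 less, of "?t j" j] lo_le_hi[OF fl_lift fl_mono q(1), of p "?t j"]
      tip_height(3)[OF Qj0 cop, of j]
    unfolding \<alpha>_def by linarith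
  \<comment> \<open>The map changes with \<open>j\<close> together with the tip height, so the
    approximation needs a bound uniform over all maps close to the limit map.\<close>
  have upper: "\<forall>\<^sub>F j in sequentially. ?a j \<le> \<beta> p q b + s" if s0: "s > 0" for s
  proof -
    obtain d N where dN: "d > 0"
      "\<forall>H P Q. degree_one_lift H \<and> mono H \<and> (\<forall>x. \<bar>fu b x - H x\<bar> \<le> d) \<and> Q \<ge> N \<and> Q > 0 \<and>
       int q * P - p * int Q = 1 \<longrightarrow> hi P Q H \<le> hi p q (fu b) + s"
      using hi_approx[OF fu_lift fu_mono q(1) s0, of b p] by auto
    obtain r where r: "r > 0" "\<And>b' x. \<bar>b' - b\<bar> < r \<Longrightarrow> \<bar>f b' x - f b x\<bar> \<le> d" using close[OF dN(1), of b] by blast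
    have "\<forall>\<^sub>F j in sequentially. dist (?t j) b < r" by (rule tendstoD[OF b r(1)])
    moreover have "\<forall>\<^sub>F j in sequentially. N \<le> j" by (rule eventually_ge_at_top)
    ultimately show ?thesis
    proof eventually_elim
      case (elim j)
      have "\<bar>fu b x - fu (?t j) x\<bar> \<le> d" for x
        using elim r(2)[of "?t j"] by (intro upper_bound_dist lift) (auto simp: dist_real_def abs_minus_commute)
      moreover have "j * 1 \<le> j * q" using q(1) by (intro mult_le_mono) auto
      then have "N \<le> Qj j" using elim unfolding Qj_def by linarith
      ultimately show ?case unfolding \<beta>_def
        using detj[of j] by (intro dN(2)[rule_format] conjI allI fu_lift fu_mono Qj0) (auto simp: mult.commute)
    qed
  qed
  have alim: "?a \<longlonglongrightarrow> \<beta> p q b"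
  proof (rule order_tendstoI)
    fix y assume "y < \<beta> p q b"
    then have "\<forall>\<^sub>F j in sequentially. y < \<beta> p q (?t j)" by (rule order_tendstoD(1)[OF \<beta>lim])
    then show "\<forall>\<^sub>F j in sequentially. y < ?a j"
      by eventually_elim (use lower in \<open>auto intro: less_le_trans\<close>)
  next
    fix y assume y: "\<beta> p q b < y"
    then have "\<forall>\<^sub>F j in sequentially. ?a j \<le> \<beta> p q b + (y - \<beta> p q b) / 2" by (intro upper) simp
    then show "\<forall>\<^sub>F j in sequentially. ?a j < y"
      by eventually_elim (use y in \<open>simp add: field_simps\<close>)
  qed
  have "\<alpha> p q b \<le> \<beta> p q b" by (rule LIMSEQ_le[OF \<alpha>lim alim]) (use lower\<alpha> in auto)
  then show ?thesis using that[of b] b alim dec \<open>bc + \<epsilon> \<le> b\<close> \<epsilon>(1) by simp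
qed

text \<open>The number of closest returns of a fraction locked at height \<open>b\<close> is at most
  \<open>1 / \<kappa>\<close>; fractions close enough to \<open>\<omega>\<close> share more of its
  isolated returns than that.\<close>

lemma irrational_unlocked:
  assumes "\<omega> \<notin> \<rat>" "b > bc"
  shows "\<exists>d>0. \<forall>P Q. Q > 0 \<and> coprime P (int Q) \<and> \<bar>of_int P / real Q - \<omega>\<bar> < d \<longrightarrow> tip_height P Q < b"
proof -
  obtain f2 f3 C K where bim: "bimodal (f b) (f' b) f2 f3 C K" using bimodal_above[OF assms(2)] by blast
  interpret S: bimodal "f b" "f' b" f2 f3 C K by (rule bim)
  obtain \<kappa> where \<kappa>: "\<kappa> > 0"
    "\<And>a P Q X N. good_orbit (translate (f b) a) C K P Q X \<Longrightarrow> Q > 0 \<Longrightarrow> finite N \<Longrightarrow>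
       (\<And>n. n \<in> N \<Longrightarrow> closest_return P Q n) \<Longrightarrow> \<kappa> * real (card N) \<le> 1"
    using S.closest_return_bound by metis
  obtain c :: nat where c: "real c > 1 / \<kappa>" using reals_Archimedean2 by blast
  obtain N where N: "finite N" "card N = c" "N \<subseteq> {n. isolated_return \<omega> n}"
    using infinite_arbitrarily_large[OF infinite_isolated_returns[OF assms(1)]] by blast
  have "\<forall>n\<in>N. \<exists>d>0. \<forall>P Q. Q > 0 \<longrightarrow> \<bar>of_int P / real Q - \<omega>\<bar> < d \<longrightarrow> closest_return P Q n"
    using N(3) isolated_return_stable by blast
  then obtain d where d: "\<And>n. n \<in> N \<Longrightarrow> d n > 0"
    "\<And>n P Q. n \<in> N \<Longrightarrow> Q > 0 \<Longrightarrow> \<bar>of_int P / real Q - \<omega>\<bar> < d n \<Longrightarrow> closest_return P Q n" by metis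
  define d0 where "d0 = Min (insert 1 (d ` N))"
  have d0: "d0 > 0" "\<And>n. n \<in> N \<Longrightarrow> d0 \<le> d n" using N(1) d(1) by (auto simp: d0_def)
  have "tip_height P Q < b" if PQ: "Q > 0" "coprime P (int Q)" "\<bar>of_int P / real Q - \<omega>\<bar> < d0" for P Q
  proof (rule ccontr)
    assume "\<not> ?thesis"
    then have "\<alpha> P Q b \<le> \<beta> P Q b" using tip_height(2)[OF PQ(1,2)] by simp
    from locked_good[OF assms(2) PQ(1,2) this bim] obtain X
      where "good_orbit (translate (f b) (\<beta> P Q b)) C K P Q X" by blast
    from \<kappa>(2)[OF this PQ(1) N(1)] have "\<kappa> * real c \<le> 1"
      using d(2)[OF _ PQ(1)] d0(2) PQ(3) N(2) by (metis less_le_trans)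
    then show False using c \<kappa>(1) by (simp add: field_simps)
  qed
  then show ?thesis using d0(1) by blast
qed


section \<open>Reflected statements, for fractions below \<open>p/q\<close>\<close>

lemma tip_height_refl: "lift_family.tip_height (\<lambda>b. refl_map (f b)) p q = tip_height (- p) q"
  unfolding lift_family.tip_height_def[OF reflected] tip_height_def
    lift_family.\<alpha>_def[OF reflected] lift_family.\<beta>_def[OF reflected] \<alpha>_refl \<beta>_refl by simp

lemma tips_away_left:
  assumes q: "q > 0"
  shows "\<exists>\<epsilon>>0. \<forall>P Q b. Q > 0 \<and> p * int Q - P * int q = 1 \<and> bc \<le> b \<and> \<alpha> P Q b = \<beta> P Q b \<longrightarrow> bc + \<epsilon> \<le> b"
proof -
  have "\<exists>\<epsilon>>0. \<forall>P Q b. Q > 0 \<and> int q * P - int Q * (- p) = 1 \<and> bc \<le> b \<and>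
      - \<beta> (- P) Q b = - \<alpha> (- P) Q b \<longrightarrow> bc + \<epsilon> \<le> b"
    using lift_family.tips_away[OF reflected q, of "- p"]
    unfolding lift_family.\<alpha>_def[OF reflected] lift_family.\<beta>_def[OF reflected] \<alpha>_refl \<beta>_refl .
  then obtain \<epsilon> where \<epsilon>: "\<epsilon> > 0" "\<And>P Q b. Q > 0 \<and> int q * P - int Q * (- p) = 1 \<and> bc \<le> b \<and>
      - \<beta> (- P) Q b = - \<alpha> (- P) Q b \<Longrightarrow> bc + \<epsilon> \<le> b"
    by auto
  show ?thesis
  proof (intro exI[of _ \<epsilon>] conjI allI impI)
    fix P Q b assume *: "Q > 0 \<and> p * int Q - P * int q = 1 \<and> bc \<le> b \<and> \<alpha> P Q b = \<beta> P Q b"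
    then have "int q * (- P) - int Q * (- p) = 1" by (simp add: algebra_simps)
    then show "bc + \<epsilon> \<le> b" using * by (intro \<epsilon>(2)[of Q "- P" b]) simp
  qed (rule \<epsilon>(1))
qed

lemma tips_converge_left:
  assumes q: "q > 0" "Q > 0" and det: "p * int Q - P * int q = 1"
  defines "Pj \<equiv> \<lambda>j::nat. P + int j * p" and "Qj \<equiv> \<lambda>j::nat. Q + j * q"
  obtains b where "bc < b" "\<alpha> p q b \<le> \<beta> p q b" "(\<lambda>j. tip_height (Pj j) (Qj j)) \<longlonglongrightarrow> b"
    "(\<lambda>j. \<beta> (Pj j) (Qj j) (tip_height (Pj j) (Qj j))) \<longlonglongrightarrow> \<alpha> p q b" "decseq (\<lambda>j. tip_height (Pj j) (Qj j))"
proof -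
  have det': "int q * (- P) - int Q * (- p) = 1" using det by (simp add: algebra_simps)
  have neg: "- (- P + int j * - p) = Pj j" for j by (simp add: Pj_def)
  have Qeq: "Q + j * q = Qj j" for j by (simp add: Qj_def)
  obtain b where b: "bc < b" "- \<beta> p q b \<le> - \<alpha> p q b"
    "(\<lambda>j. tip_height (Pj j) (Qj j)) \<longlonglongrightarrow> b"
    "(\<lambda>j. - \<alpha> (Pj j) (Qj j) (tip_height (Pj j) (Qj j))) \<longlonglongrightarrow> - \<alpha> p q b"
    "decseq (\<lambda>j. tip_height (Pj j) (Qj j))"
    by (rule lift_family.tips_converge[OF reflected q det',
        unfolded tip_height_refl lift_family.\<alpha>_def[OF reflected] lift_family.\<beta>_def[OF reflected]
          \<alpha>_refl \<beta>_refl neg Qeq minus_minus])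
  have "coprime (Pj j) (int (Qj j))" for j
  proof -
    have "int q * (- Pj j) - int (Qj j) * (- p) = 1" using det by (simp add: Pj_def Qj_def algebra_simps)
    from det_coprime(1)[OF this] show ?thesis by simp
  qed
  \<comment> \<open>Reflection yields the limit of the left ends; at tip heights both ends
    coincide.\<close>
  then have eq: "\<alpha> (Pj j) (Qj j) (tip_height (Pj j) (Qj j)) = \<beta> (Pj j) (Qj j) (tip_height (Pj j) (Qj j))" for j
    using q by (intro tip_height(3)) (auto simp: Qj_def)
  have "(\<lambda>j. \<beta> (Pj j) (Qj j) (tip_height (Pj j) (Qj j))) \<longlonglongrightarrow> \<alpha> p q b"
    using tendsto_minus[OF b(4)] unfolding eq minus_minus .
  then show ?thesis using that[of b] b by simp
qed

end

subsection \<open>The gap between the monotone bounds\<close>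

lemma bounds_distance_bounded:
  assumes "degree_one_lift f"
  obtains B where "\<And>x. \<bar>upper_bound f x - lower_bound f x\<bar> \<le> B"
proof -
  obtain B1 where B1: "\<And>x. \<bar>upper_bound f x - x\<bar> \<le> B1"
    using lift_displacement_bounded[OF degree_one_lift_upper_bound[OF assms]] by blast
  obtain B2 where B2: "\<And>x. \<bar>lower_bound f x - x\<bar> \<le> B2"
    using lift_displacement_bounded[OF degree_one_lift_lower_bound[OF assms]] by blast
  have "\<bar>upper_bound f x - lower_bound f x\<bar> \<le> B1 + B2" for x using B1[of x] B2[of x] by linarith
  then show ?thesis using that by blast
qed

lemma infdist_graph_le: "infdist (x, G x) (graph_of H) \<le> \<bar>G x - H x\<bar>"
proof -
  have "infdist (x, G x) (graph_of H) \<le> dist (x, G x) (x, H x)"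
    by (rule infdist_le) (simp add: graph_of_def)
  then show ?thesis by (simp add: dist_Pair_Pair dist_real_def)
qed

lemma bound_gap_le:
  assumes "\<And>x. \<bar>upper_bound f x - lower_bound f x\<bar> \<le> c"
  shows "bound_gap f \<le> c"
proof -
  have le: "(SUP x\<in>graph_of G. infdist x (graph_of H)) \<le> c" if "\<And>x. \<bar>G x - H x\<bar> \<le> c" for G H
  proof (rule cSUP_least)
    fix z assume "z \<in> graph_of G"
    then obtain x where "z = (x, G x)" by (auto simp: graph_of_def)
    then show "infdist z (graph_of H) \<le> c" using infdist_graph_le[of x G H] that[of x] by simp
  qed (simp add: graph_of_def)
  have "\<bar>lower_bound f x - upper_bound f x\<bar> \<le> c" for x using assms[of x] by linarith
  then show ?thesis unfolding bound_gap_def hausdorff_distance_def using le assms by simp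
qed

lemma bound_gap_ge:
  assumes "degree_one_lift f"
  shows "infdist (x, upper_bound f x) (graph_of (lower_bound f)) \<le> bound_gap f"
proof -
  obtain B where B: "\<And>x. \<bar>upper_bound f x - lower_bound f x\<bar> \<le> B" using bounds_distance_bounded[OF assms] by blast
  have "bdd_above ((\<lambda>z. infdist z (graph_of (lower_bound f))) ` graph_of (upper_bound f))"
  proof (rule bdd_aboveI2)
    fix z assume "z \<in> graph_of (upper_bound f)"
    then obtain y where "z = (y, upper_bound f y)" by (auto simp: graph_of_def)
    then show "infdist z (graph_of (lower_bound f)) \<le> B"
      using infdist_graph_le[of y "upper_bound f" "lower_bound f"] B[of y] by simp
  qed
  then have "infdist (x, upper_bound f x) (graph_of (lower_bound f))
      \<le> (SUP z\<in>graph_of (upper_bound f). infdist z (graph_of (lower_bound f)))"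
    by (rule cSUP_upper2) (auto simp: graph_of_def)
  then show ?thesis unfolding bound_gap_def hausdorff_distance_def by simp
qed

lemma bound_gap_nonneg: "degree_one_lift f \<Longrightarrow> 0 \<le> bound_gap f"
  using bound_gap_ge[of f 0] infdist_nonneg order_trans by blast

text \<open>Gap 0 puts each point of one graph at distance 0 from the other graph, which is closed
  by continuity; so the bounds coincide, and \<open>f\<close> lies between them.\<close>

lemma bound_gap_zero_iff:
  assumes "degree_one_lift f"
  shows "bound_gap f = 0 \<longleftrightarrow> mono f"
proof
  assume gap: "bound_gap f = 0"
  have eq: "upper_bound f x = lower_bound f x" for x
  proof -
    have "infdist (x, upper_bound f x) (graph_of (lower_bound f)) = 0"
      using bound_gap_ge[OF assms, of x] gap infdist_nonneg[of "(x, upper_bound f x)"] by (simp add: order_antisym)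
    moreover have graph: "graph_of (lower_bound f) = {p. snd p = lower_bound f (fst p)}"
      by (auto simp: graph_of_def)
    have "closed {p. snd p = lower_bound f (fst p)}"
      by (intro closed_Collect_eq continuous_intros
          continuous_on_compose2[OF lift_cont[OF degree_one_lift_lower_bound[OF assms], of UNIV]]) auto
    then have "closed (graph_of (lower_bound f))" by (simp only: graph)
    moreover have "graph_of (lower_bound f) \<noteq> {}" by (simp add: graph_of_def)
    ultimately have "(x, upper_bound f x) \<in> graph_of (lower_bound f)"
      using in_closed_iff_infdist_zero by blast
    then show ?thesis by (auto simp: graph_of_def)
  qed
  have "f x = upper_bound f x" for x
    using eq[of x] lower_bound_le[OF assms, of x x] upper_bound_ge[OF assms, of x x] by simp
  then have "f = upper_bound f" by (rule ext)
  then show "mono f" using mono_upper_bound[OF assms] by simp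
next
  assume "mono f"
  then have "bound_gap f \<le> 0"
    by (intro bound_gap_le) (simp add: upper_bound_mono_eq[OF assms] lower_bound_mono_eq[OF assms])
  then show "bound_gap f = 0" using bound_gap_nonneg[OF assms] by simp
qed

text \<open>If the bounds meet at \<open>x\<close>, they also meet at \<open>x + 1\<close>, and on
  the period between both are confined to the same interval of values of length 1.\<close>

lemma bound_gap_common_point:
  assumes f: "degree_one_lift f" and eq: "lower_bound f x = upper_bound f x"
  shows "bound_gap f \<le> 1"
proof (rule bound_gap_le)
  fix y
  let ?u = "upper_bound f" and ?l = "lower_bound f"
  note u = degree_one_lift_upper_bound[OF f] mono_upper_bound[OF f]
  note l = degree_one_lift_lower_bound[OF f] mono_lower_bound[OF f]
  obtain k :: int where k: "x \<le> y + of_int k" "y + of_int k < x + 1" using lift_reduce by blast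
  let ?y = "y + of_int k"
  have "?u x \<le> ?u ?y" "?u ?y \<le> ?u (x + 1)" "?l x \<le> ?l ?y" "?l ?y \<le> ?l (x + 1)"
    using k monoD[OF u(2)] monoD[OF l(2)] by auto
  moreover have "?u (x + 1) = ?u x + 1" "?l (x + 1) = ?l x + 1"
    using lift_add_int[OF u(1), of x 1] lift_add_int[OF l(1), of x 1] by auto
  ultimately have "\<bar>?u ?y - ?l ?y\<bar> \<le> 1" using eq by linarith
  then show "\<bar>?u y - ?l y\<bar> \<le> 1" by (simp add: lift_add_int[OF u(1)] lift_add_int[OF l(1)])
qed

subsection \<open>Families in class N\<close>

lemma C3_derivs:
  assumes "C3 f"
  shows "(f has_real_derivative deriv f x) (at x)"
    "(deriv f has_real_derivative (deriv ^^ 2) f x) (at x)"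
    "((deriv ^^ 2) f has_real_derivative (deriv ^^ 3) f x) (at x)"
proof -
  have "((deriv ^^ k) f has_real_derivative deriv ((deriv ^^ k) f) x) (at x)" if "k < 3" for k
    using assms that unfolding C3_def DERIV_deriv_iff_field_differentiable by blast
  from this[of 0] this[of 1] this[of 2]
  show "(f has_real_derivative deriv f x) (at x)"
    "(deriv f has_real_derivative (deriv ^^ 2) f x) (at x)"
    "((deriv ^^ 2) f has_real_derivative (deriv ^^ 3) f x) (at x)"
    by (simp_all add: numeral_2_eq_2 numeral_3_eq_3)
qed

lemma zero_between:
  fixes g :: "real \<Rightarrow> real"
  assumes "\<And>x. isCont g x" "x < y" "g x * g y < 0"
  obtains z where "x < z" "z < y" "g z = 0"
proof -
  have "\<exists>z\<ge>x. z \<le> y \<and> g z = 0"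
  proof (cases "g x < 0")
    case True
    then have "g y > 0" using assms(3) by (simp add: mult_less_0_iff)
    then show ?thesis using True assms(1,2) by (intro IVT) auto
  next
    case False
    then have "g x > 0" "g y < 0" using assms(3) by (auto simp: mult_less_0_iff)
    then show ?thesis using assms(1,2) by (intro IVT2) auto
  qed
  then obtain z where "x \<le> z" "z \<le> y" "g z = 0" by blast
  moreover have "z \<noteq> x" "z \<noteq> y" using calculation assms(3) by auto
  ultimately show ?thesis using that[of z] by simp
qed

text \<open>A lift that is not monotone has slopes of both signs, hence a zero of the derivative on
  each side of a point of positive slope within one period. No further zeros are allowed, so the
  sign is constant on the two arcs.\<close>

lemma class_B_bimodal:
  assumes B: "class_B f" and nm: "\<not> mono f"
  shows "\<exists>C K. bimodal f (deriv f) ((deriv ^^ 2) f) ((deriv ^^ 3) f) C K"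
proof -
  let ?g = "deriv f"
  have lift: "degree_one_lift f" and C3: "C3 f" and fin: "finite (critical_points f)"
    and card: "card (critical_points f) \<le> 2"
    and two: "card (critical_points f) = 2 \<Longrightarrow> ?g x \<noteq> 0 \<Longrightarrow> schwarzian f x < 0" for x
    using B by (auto simp: class_B_def)
  note D = C3_derivs[OF C3]
  have cont: "isCont ?g x" for x using D(2) by (rule DERIV_isCont)
  have per: "?g (x + of_int k) = ?g x" for x k by (rule lift_deriv_add_int[OF lift D(1)])
  have "\<exists>u. ?g u < 0"
  proof (rule ccontr)
    assume "\<not> ?thesis"
    then have "\<And>x. ?g x \<ge> 0" by (meson not_le)
    then have "mono f" by (intro monoI DERIV_nonneg_imp_nondecreasing[where f = f]) (use D(1) in blast)+
    then show False using nm by simp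
  qed
  then obtain u where u: "?g u < 0" by blast
  \<comment> \<open>The mean slope over a period is 1 by the degree, so a positive slope
    occurs.\<close>
  obtain w0 where "f 1 - f 0 = (1 - 0) * ?g w0" using MVT2[of 0 1 f ?g] D(1) by auto
  then have w0: "?g w0 > 0" using lift_add_int[OF lift, of 0 1] by simp
  obtain k :: int where k: "u \<le> w0 + of_int k" "w0 + of_int k < u + 1" using lift_reduce by blast
  define w where "w = w0 + of_int k"
  have w: "?g w > 0" "u < w" "w < u + 1"
    using w0 u k per[of w0 k] by (auto simp: w_def less_le)
  have gu1: "?g (u + 1) < 0" using u per[of u 1] by simp
  obtain z1 where z1: "u < z1" "z1 < w" "?g z1 = 0"
    using zero_between[OF cont w(2)] u w(1) by (auto simp: mult_neg_pos)
  obtain z2 where z2: "w < z2" "z2 < u + 1" "?g z2 = 0"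
    using zero_between[OF cont w(3)] gu1 w(1) by (auto simp: mult_pos_neg)
  have crit: "frac z \<in> critical_points f" if "?g z = 0" for z
  proof -
    have "?g (frac z) = ?g z" using per[of z "- \<lfloor>z\<rfloor>"] by (simp add: frac_def)
    then show ?thesis using that by (simp add: critical_points_def frac_lt_1)
  qed
  have frac_eq: "\<exists>m::int. x - y = of_int m" if "frac x = frac y" for x y :: real
    using that unfolding frac_def by (intro exI[of _ "\<lfloor>x\<rfloor> - \<lfloor>y\<rfloor>"]) simp
  have ne: "frac z1 \<noteq> frac z2"
  proof
    assume "frac z1 = frac z2"
    then obtain m :: int where m: "z2 - z1 = of_int m" using frac_eq[of z2 z1] by auto
    then have "0 < real_of_int m" "real_of_int m < 1" using z1 z2 by linarith+
    then show False by simp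
  qed
  have "card {frac z1, frac z2} \<le> card (critical_points f)"
    using crit z1 z2 fin by (intro card_mono) auto
  then have card2: "card (critical_points f) = 2" using ne card by simp
  have only: "critical_points f = {frac z1, frac z2}"
  proof -
    have sub: "{frac z1, frac z2} \<subseteq> critical_points f" using crit z1 z2 by auto
    have "card {frac z1, frac z2} = card (critical_points f)" using ne card2 by simp
    from card_subset_eq[OF fin sub this] show ?thesis by simp
  qed
  have nz: "?g x \<noteq> 0" if x: "z2 - 1 < x" "x < z1 \<or> z1 < x" "x < z2" for x
  proof
    assume "?g x = 0"
    from crit[OF this] have "frac x = frac z1 \<or> frac x = frac z2" by (simp add: only)
    then obtain m :: int where "x - z1 = of_int m \<or> x - z2 = of_int m"
      using frac_eq[of x z1] frac_eq[of x z2] by blast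
    then show False
    proof
      assume m: "x - z1 = of_int m"
      then have "real_of_int m < 1" "- 1 < real_of_int m" using x z1 z2 by linarith+
      moreover have "m \<noteq> 0" using m x(2) by auto
      ultimately have "m < 1" "- 1 < m" "m \<noteq> 0" by linarith+
      then show False by linarith
    next
      assume m: "x - z2 = of_int m"
      then have "real_of_int m < 0" "- 1 < real_of_int m" using x by linarith+
      then have "m < 0" "- 1 < m" by linarith+
      then show False by linarith
    qed
  qed
  have "bimodal f ?g ((deriv ^^ 2) f) ((deriv ^^ 3) f) (z2 - 1) z1"
  proof unfold_locales
    fix x
    show "(f has_real_derivative ?g x) (at x)" "(?g has_real_derivative (deriv ^^ 2) f x) (at x)"
      "((deriv ^^ 2) f has_real_derivative (deriv ^^ 3) f x) (at x)" by (rule D)+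
    show "degree_one_lift f" by (rule lift)
    show "z2 - 1 < z1" "z1 < z2 - 1 + 1" using z1 z2 by auto
    show "(deriv ^^ 3) f x * ?g x - 3 / 2 * ((deriv ^^ 2) f x)\<^sup>2 < 0" if gx: "?g x \<noteq> 0"
    proof -
      have "schwarzian f x * (?g x)\<^sup>2 < 0" using two[OF card2 gx] gx by (simp add: mult_neg_pos)
      moreover have "schwarzian f x * (?g x)\<^sup>2 = (deriv ^^ 3) f x * ?g x - 3 / 2 * ((deriv ^^ 2) f x)\<^sup>2"
        using gx unfolding schwarzian_def by (simp add: field_simps power2_eq_square)
      ultimately show ?thesis by simp
    qed
    show "?g x < 0" if x: "z2 - 1 < x" "x < z1"
    proof (rule ccontr)
      assume "\<not> ?thesis"
      then have gx: "?g x > 0" using nz[of x] x z1 z2 by auto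
      have "x \<noteq> u" using gx u by auto
      then show False
      proof (cases "x < u")
        case True
        obtain z where "x < z" "z < u" "?g z = 0" using zero_between[OF cont True] gx u by (auto simp: mult_pos_neg)
        then show False using nz[of z] x z1 z2 by auto
      next
        case False
        then have "u < x" using \<open>x \<noteq> u\<close> by simp
        obtain z where "u < z" "z < x" "?g z = 0" using zero_between[OF cont \<open>u < x\<close>] gx u by (auto simp: mult_neg_pos)
        then show False using nz[of z] x z1 z2 by auto
      qed
    qed
    show "?g x > 0" if x: "z1 < x" "x < z2 - 1 + 1"
    proof (rule ccontr)
      assume "\<not> ?thesis"
      then have gx: "?g x < 0" using nz[of x] x z1 z2 by auto
      have "x \<noteq> w" using gx w by auto
      then show False
      proof (cases "x < w")
        case True
        obtain z where "x < z" "z < w" "?g z = 0" using zero_between[OF cont True] gx w by (auto simp: mult_neg_pos)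
        then show False using nz[of z] x z1 z2 by auto
      next
        case False
        then have "w < x" using \<open>x \<noteq> w\<close> by simp
        obtain z where "w < z" "z < x" "?g z = 0" using zero_between[OF cont \<open>w < x\<close>] gx w by (auto simp: mult_pos_neg)
        then show False using nz[of z] x z1 z2 by auto
      qed
    qed
  qed
  then show ?thesis by blast
qed

text \<open>A monotone map that is not strictly monotone is constant on an interval, which would
  consist of critical points.\<close>

lemma mono_class_B_strict:
  assumes B: "class_B f" and m: "mono f"
  shows "strict_mono f"
proof (rule strict_monoI)
  fix x y :: real assume xy: "x < y"
  have lift: "degree_one_lift f" and C3: "C3 f" and fin: "finite (critical_points f)"
    using B by (auto simp: class_B_def)
  note D = C3_derivs[OF C3]
  show "f x < f y"
  proof (rule ccontr)
    assume "\<not> ?thesis"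
    then have eq: "f x = f y" using m xy by (simp add: mono_def antisym)
    \<comment> \<open>Cutting at the next integer lets a single translation carry the interval into
      the fundamental domain where critical points are counted.\<close>
    define y' where "y' = min y (of_int \<lfloor>x\<rfloor> + 1)"
    have y': "x < y'" "y' \<le> y" "y' \<le> of_int \<lfloor>x\<rfloor> + 1" using xy by (auto simp: y'_def)
    have zero: "deriv f t = 0" if t: "x < t" "t < y'" for t
    proof -
      have const: "f s = f x" if "s \<in> {x<..<y'}" for s
        using monoD[OF m, of x s] monoD[OF m, of s y] that y' eq by auto
      have "((\<lambda>s. f x) has_real_derivative 0) (at t)" by simp
      then have "(f has_real_derivative 0) (at t)"
        by (rule has_field_derivative_transform_within_open[of _ _ _ "{x<..<y'}"]) (use const t in auto)
      then show ?thesis using D(1) DERIV_unique by blast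
    qed
    have "(\<lambda>t. t + of_int (- \<lfloor>x\<rfloor>)) ` {x<..<y'} \<subseteq> critical_points f"
    proof
      fix s assume "s \<in> (\<lambda>t. t + of_int (- \<lfloor>x\<rfloor>)) ` {x<..<y'}"
      then obtain t where t: "x < t" "t < y'" "s = t + of_int (- \<lfloor>x\<rfloor>)" by auto
      have "deriv f s = 0" unfolding t(3) lift_deriv_add_int[OF lift D(1)] using zero t by simp
      moreover have "s = t - of_int \<lfloor>x\<rfloor>" using t(3) by simp
      then have "0 \<le> s" "s < 1" using t(1,2) y' of_int_floor_le[of x] by linarith+
      ultimately show "s \<in> critical_points f" by (simp add: critical_points_def)
    qed
    then have "finite ((\<lambda>t. t + of_int (- \<lfloor>x\<rfloor>)) ` {x<..<y'})" using fin finite_subset by blast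
    then have "finite {x<..<y'}" by (rule finite_imageD) (simp add: inj_on_def)
    then show False using y'(1) infinite_Ioo by blast
  qed
qed

locale N_family =
  fixes F :: "real \<Rightarrow> real \<Rightarrow> real \<Rightarrow> real"
  assumes N: "class_N F"
begin

lemma class_B: "class_B (F a b)"
  using N unfolding class_N_def by blast

lemma translate_eq: "F a b = translate (F 0 b) a"
proof
  show "F a b x = F 0 b x + a" for x using N unfolding class_N_def by blast
qed

lemma family_lift: "degree_one_lift (F a b)" using class_B[of a b] by (simp add: class_B_def)

lemma derivs: "(F a b has_real_derivative deriv (F a b) x) (at x)"
  "(deriv (F a b) has_real_derivative (deriv ^^ 2) (F a b) x) (at x)"
  using C3_derivs(1,2) class_B[of a b] by (auto simp: class_B_def)

lemma uniform_close:
  fixes H :: "real \<Rightarrow> real \<Rightarrow> real \<Rightarrow> real"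
  assumes "uniform_limit UNIV (\<lambda>(a', b'). H a' b') (H 0 b) (at (0, b))" "e > 0"
  shows "\<exists>d>0. \<forall>b'. \<bar>b' - b\<bar> < d \<longrightarrow> (\<forall>x. \<bar>H 0 b' x - H 0 b x\<bar> \<le> e)"
proof -
  have "\<forall>\<^sub>F z in at (0, b). \<forall>x\<in>UNIV. dist ((\<lambda>(a', b'). H a' b') z x) (H 0 b x) < e"
    using assms unfolding uniform_limit_iff by blast
  then obtain d where d: "d > 0"
    "\<And>z x. z \<noteq> (0, b) \<Longrightarrow> dist z (0, b) < d \<Longrightarrow> dist ((\<lambda>(a', b'). H a' b') z x) (H 0 b x) < e"
    unfolding eventually_at by auto
  have "\<bar>H 0 b' x - H 0 b x\<bar> \<le> e" if "\<bar>b' - b\<bar> < d" for b' x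
  proof (cases "b' = b")
    case False
    then have "(0, b') \<noteq> (0::real, b)" "dist (0::real, b') (0, b) < d"
      using that by (simp_all add: dist_Pair_Pair dist_real_def)
    from d(2)[OF this, of x] show ?thesis by (simp add: dist_real_def)
  qed (use assms(2) in simp)
  then show ?thesis using d(1) by blast
qed

lemma close: "e > 0 \<Longrightarrow> \<exists>d>0. \<forall>b'. \<bar>b' - b\<bar> < d \<longrightarrow> (\<forall>x. \<bar>F 0 b' x - F 0 b x\<bar> \<le> e)"
  using uniform_close[of F b e] N unfolding class_N_def by blast

lemma close': "e > 0 \<Longrightarrow> \<exists>d>0. \<forall>b'. \<bar>b' - b\<bar> < d \<longrightarrow> (\<forall>x. \<bar>deriv (F 0 b') x - deriv (F 0 b) x\<bar> \<le> e)"
  using uniform_close[of "\<lambda>a b. deriv (F a b)" b e] N unfolding class_N_def by blast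

text \<open>The heights of gap 0 are those of monotone maps. They form a down-set since the gap is
  nondecreasing and nonnegative, and contain their supremum since uniform limits of monotone maps
  are monotone.\<close>

lemma critical_value: "b \<le> critical_value F \<longleftrightarrow> mono (F 0 b)"
proof -
  let ?Z = "{b. mono (F 0 b)}"
  have gap: "mono (\<lambda>b. bound_gap (F 0 b))" "\<exists>b. bound_gap (F 0 b) = 0" "\<exists>b. bound_gap (F 0 b) > 1"
    using N unfolding class_N_def by blast+
  have iff: "bound_gap (F 0 b) = 0 \<longleftrightarrow> b \<in> ?Z" for b using bound_gap_zero_iff[OF family_lift] by simp
  have ne: "?Z \<noteq> {}" using gap(2) iff by blast
  obtain b1 where b1: "bound_gap (F 0 b1) > 1" using gap(3) by blast
  have bdd: "bdd_above ?Z"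
  proof (rule bdd_aboveI)
    fix b assume "b \<in> ?Z"
    then have "bound_gap (F 0 b) = 0" using iff by blast
    then show "b \<le> b1" using monoD[OF gap(1), of b1 b] b1 by linarith
  qed
  have down: "b' \<in> ?Z" if "b \<in> ?Z" "b' \<le> b" for b b'
  proof -
    have "bound_gap (F 0 b') \<le> bound_gap (F 0 b)" by (rule monoD[OF gap(1) that(2)])
    moreover have "bound_gap (F 0 b) = 0" using iff that(1) by blast
    ultimately have "bound_gap (F 0 b') = 0" using bound_gap_nonneg[OF family_lift, of 0 b'] by linarith
    then show ?thesis using iff by blast
  qed
  have SupZ: "Sup ?Z \<in> ?Z"
  proof (clarify, rule monoI, rule field_le_epsilon)
    fix x y e :: real assume xy: "x \<le> y" and e: "e > 0"
    obtain d where d: "d > 0" "\<And>b' x. \<bar>b' - Sup ?Z\<bar> < d \<Longrightarrow> \<bar>F 0 b' x - F 0 (Sup ?Z) x\<bar> \<le> e / 2"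
      using close[of "e / 2" "Sup ?Z"] e by auto
    obtain b where b: "b \<in> ?Z" "Sup ?Z - d < b" using less_cSupD[OF ne, of "Sup ?Z - d"] d(1) by auto
    have "b \<le> Sup ?Z" using b(1) bdd by (rule cSup_upper)
    then have "\<bar>b - Sup ?Z\<bar> < d" using b(2) by linarith
    have "F 0 b x \<le> F 0 b y" using monoD[of "F 0 b" x y] b(1) xy by simp
    then show "F 0 (Sup ?Z) x \<le> F 0 (Sup ?Z) y + e"
      using d(2)[OF \<open>\<bar>b - Sup ?Z\<bar> < d\<close>, of x] d(2)[OF \<open>\<bar>b - Sup ?Z\<bar> < d\<close>, of y] by linarith
  qed
  have "critical_value F = Sup ?Z"
    unfolding critical_value_def
  proof (rule Greatest_equality)
    show "bound_gap (F 0 (Sup ?Z)) = 0" using iff SupZ by blast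
    show "y \<le> Sup ?Z" if "bound_gap (F 0 y) = 0" for y
      by (rule cSup_upper[OF _ bdd]) (use iff that in blast)
  qed
  moreover have "b \<le> Sup ?Z \<longleftrightarrow> b \<in> ?Z"
    using down[OF SupZ, of b] cSup_upper[OF _ bdd, of b] by blast
  ultimately show ?thesis by simp
qed

sublocale lift_family "F 0" "\<lambda>b. deriv (F 0 b)" "critical_value F"
proof unfold_locales
  fix b x :: real
  show "degree_one_lift (F 0 b)" by (rule family_lift)
  show "(F 0 b has_real_derivative deriv (F 0 b) x) (at x)" by (rule derivs)
  show "isCont (deriv (F 0 b)) x" using derivs(2) by (rule DERIV_isCont)
next
  fix b e :: real assume "e > 0"
  then show "\<exists>d>0. \<forall>b'. \<bar>b' - b\<bar> < d \<longrightarrow> (\<forall>x. \<bar>F 0 b' x - F 0 b x\<bar> \<le> e)" by (rule close)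
  show "\<exists>d>0. \<forall>b'. \<bar>b' - b\<bar> < d \<longrightarrow> (\<forall>x. \<bar>deriv (F 0 b') x - deriv (F 0 b) x\<bar> \<le> e)"
    using \<open>e > 0\<close> by (rule close')
next
  show "b \<le> critical_value F \<Longrightarrow> mono (F 0 b)" for b by (simp add: critical_value)
  show "strict_mono (F 0 (critical_value F))"
    using critical_value[of "critical_value F"] by (intro mono_class_B_strict class_B) simp
  show "\<exists>f2 f3 C K. bimodal (F 0 b) (deriv (F 0 b)) f2 f3 C K" if "critical_value F < b" for b
    using class_B_bimodal[OF class_B, of 0 b] critical_value[of b] that by auto
  \<comment> \<open>Without a critical point the derivative would be bounded below by a positive
    constant, and maps slightly above the critical line would still be monotone.\<close>
  show "\<exists>c. deriv (F 0 (critical_value F)) c = 0"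
  proof (rule ccontr)
    let ?b = "critical_value F" let ?g = "deriv (F 0 ?b)"
    assume no: "\<nexists>c. ?g c = 0"
    have cont: "isCont ?g x" for x using derivs(2) by (rule DERIV_isCont)
    obtain w where "F 0 ?b 1 - F 0 ?b 0 = (1 - 0) * ?g w" using MVT2[of 0 1 "F 0 ?b" ?g] derivs(1) by auto
    then have w: "?g w > 0" using lift_add_int[OF family_lift, of 0 ?b 0 1] by simp
    have pos: "?g x > 0" for x
    proof (rule ccontr)
      assume "\<not> ?thesis"
      moreover have "?g x \<noteq> 0" using no by blast
      ultimately have x: "?g x < 0" by linarith
      show False
      proof (cases x w rule: linorder_cases)
        case less
        obtain z where "?g z = 0" using zero_between[OF cont less mult_neg_pos[OF x w]] by blast
        then show ?thesis using no by blast
      next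
        case greater
        obtain z where "?g z = 0" using zero_between[OF cont greater mult_pos_neg[OF w x]] by blast
        then show ?thesis using no by blast
      qed (use x w in auto)
    qed
    have "continuous_on {0..1} ?g" using cont by (intro continuous_at_imp_continuous_on) auto
    then obtain z where z: "\<And>x. x \<in> {0..1} \<Longrightarrow> ?g z \<le> ?g x"
      using continuous_attains_inf[OF compact_Icc, of 0 1 ?g] by (metis atLeastatMost_empty_iff zero_le_one)
    have gz: "?g z \<le> ?g x" for x
    proof -
      obtain k :: int where "0 \<le> x + of_int k" "x + of_int k < 0 + 1" using lift_reduce by blast
      then show ?thesis using z[of "x + of_int k"] lift_deriv_add_int[OF family_lift derivs(1), of 0 "critical_value F" x k] by simp
    qed
    obtain d where d: "d > 0" "\<And>b' x. \<bar>b' - ?b\<bar> < d \<Longrightarrow> \<bar>deriv (F 0 b') x - ?g x\<bar> \<le> ?g z / 2"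
      using close'[of "?g z / 2" ?b] pos[of z] by auto
    have "deriv (F 0 (?b + d / 2)) x \<ge> 0" for x
    proof -
      have "\<bar>?b + d / 2 - ?b\<bar> < d" using d(1) by simp
      from d(2)[OF this, of x] show ?thesis using gz[of x] pos[of z] by linarith
    qed
    then have "mono (F 0 (?b + d / 2))"
      by (intro monoI DERIV_nonneg_imp_nondecreasing[where f = "F 0 (?b + d / 2)"]) (use derivs(1) in blast)+
    then show False using critical_value[of "?b + d / 2"] d(1) by simp
  qed
  obtain b1 where b1: "bound_gap (F 0 b1) > 1" using N unfolding class_N_def by blast
  then have "\<not> mono (F 0 b1)" using bound_gap_zero_iff[OF family_lift, of 0 b1] by auto
  then have "b1 > critical_value F" using critical_value[of b1] by simp
  moreover have "lower_bound (F 0 b1) x \<noteq> upper_bound (F 0 b1) x" for x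
    using bound_gap_common_point[OF family_lift, of 0 b1 x] b1 by auto
  ultimately show "\<exists>b1>critical_value F. \<forall>x. lower_bound (F 0 b1) x \<noteq> upper_bound (F 0 b1) x" by blast
qed


section \<open>Locking regions of the family, their main component and its tip\<close>

lemma Lock_iff:
  assumes "q > 0"
  shows "(a, b) \<in> Lock F (of_int p / real q) \<longleftrightarrow> \<alpha> p q b \<le> a \<and> a \<le> \<beta> p q b"
  unfolding Lock_def using locked_iff[OF assms, of b a p] translate_eq[of a b] by simp

lemma bij_at_critical: "bij (F a (critical_value F))"
proof -
  have s: "strict_mono (F a (critical_value F))"
    using strict_at unfolding translate_eq[of a "critical_value F"] by (simp add: strict_mono_def)
  obtain B where B: "\<And>x. \<bar>F a (critical_value F) x - x\<bar> \<le> B" using lift_displacement_bounded[OF family_lift[of a "critical_value F"]] by blast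
  have "y \<in> range (F a (critical_value F))" for y
  proof -
    have "B \<ge> 0" using B[of 0] by linarith
    then have "\<exists>x\<ge>y-B. x \<le> y+B \<and> F a (critical_value F) x = y"
      using B[of "y - B"] B[of "y + B"] by (intro IVT') (auto intro: lift_cont[OF family_lift])
    then show ?thesis by blast
  qed
  then have "surj (F a (critical_value F))" by (simp only: set_eq_iff UNIV_I simp_thms)
  then show ?thesis using strict_mono_imp_inj_on[OF s] by (simp add: bij_def)
qed

lemma bij_imp_below:
  assumes "bij (F a b)"
  shows "b \<le> critical_value F"
proof (rule ccontr)
  assume "\<not> ?thesis"
  then obtain f2 f3 C K where bim: "bimodal (F 0 b) (deriv (F 0 b)) f2 f3 C K" using bimodal_above[of b] by auto
  interpret S: bimodal "F 0 b" "deriv (F 0 b)" f2 f3 C K by (rule bim)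
  have "F a b S.Cp = F a b C" unfolding translate_eq[of a b] using S.right_plateau by simp
  then have "S.Cp = C" using assms by (auto simp: bij_def inj_def)
  then show False using S.right_plateau S.CK by simp
qed

text \<open>The region below the tip height is a continuous image of a strip and thus connected. It
  is a whole component, because a connected set reaching higher would be locked at all intermediate
  heights.\<close>

lemma Lock_I_eq:
  assumes q: "q > 0" "coprime p (int q)"
  shows "Lock_I F (of_int p / real q) = {(a, b). b \<le> tip_height p q \<and> \<alpha> p q b \<le> a \<and> a \<le> \<beta> p q b}"
    (is "Lock_I F ?\<omega> = ?S")
proof -
  let ?L = "Lock F ?\<omega>" let ?B = "{(a, b) \<in> ?L. bij (F a b)}"
  note th = tip_height[OF q]
  have contT: "continuous_on T (\<alpha> p q)" "continuous_on T (\<beta> p q)" for T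
    using continuous_\<alpha>[OF q(1)] continuous_\<beta>[OF q(1)] by (auto intro: continuous_at_imp_continuous_on)
  have SL: "?S \<subseteq> ?L" using Lock_iff[OF q(1)] by auto
  have BS: "?B \<subseteq> ?S"
  proof clarify
    fix a b assume "(a, b) \<in> ?L" "bij (F a b)"
    then show "b \<le> tip_height p q \<and> \<alpha> p q b \<le> a \<and> a \<le> \<beta> p q b"
      using Lock_iff[OF q(1), of a b p] bij_imp_below[of a b] th(1) by linarith
  qed
  \<comment> \<open>An invertible locked map exists on the critical line. It makes the description
    of the component unique, since two components with a common point are equal.\<close>
  have BC: "(\<beta> p q (critical_value F), critical_value F) \<in> ?B"
    using Lock_iff[OF q(1)] bij_at_critical th(2)[OF th(1)] by auto
  have "connected ?S"
  proof -
    let ?h = "\<lambda>(b, t). (\<alpha> p q b + t * (\<beta> p q b - \<alpha> p q b), b)"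
    let ?D = "{..tip_height p q} \<times> {0..1::real}"
    have "connected (?h ` ?D)"
    proof (rule connected_continuous_image)
      show "continuous_on ?D ?h"
        unfolding case_prod_unfold
        by (intro continuous_intros continuous_on_compose2[OF contT(1)[of UNIV]] continuous_on_compose2[OF contT(2)[of UNIV]]) auto
      show "connected ?D" by (intro convex_connected convex_Times) auto
    qed
    moreover have "?h ` ?D = ?S"
    proof (intro set_eqI iffI)
      fix z assume "z \<in> ?h ` ?D"
      then obtain b t where z: "z = (\<alpha> p q b + t * (\<beta> p q b - \<alpha> p q b), b)" "b \<le> tip_height p q" "0 \<le> t" "t \<le> 1"
        by (force simp del: mult_cancel_right)
      have d: "0 \<le> \<beta> p q b - \<alpha> p q b" using th(2)[OF z(2)] by simp
      have "0 \<le> t * (\<beta> p q b - \<alpha> p q b)" "t * (\<beta> p q b - \<alpha> p q b) \<le> 1 * (\<beta> p q b - \<alpha> p q b)"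
        using mult_nonneg_nonneg[OF z(3) d] mult_right_mono[OF z(4) d] by blast+
      then show "z \<in> ?S" using z by simp
    next
      fix z assume "z \<in> ?S"
      then obtain a b where z: "z = (a, b)" "b \<le> tip_height p q" "\<alpha> p q b \<le> a" "a \<le> \<beta> p q b" by auto
      define t where "t = (if \<beta> p q b = \<alpha> p q b then 0 else (a - \<alpha> p q b) / (\<beta> p q b - \<alpha> p q b))"
      have "0 \<le> t" "t \<le> 1" "a = \<alpha> p q b + t * (\<beta> p q b - \<alpha> p q b)"
        using z by (auto simp: t_def divide_le_eq)
      then show "z \<in> ?h ` ?D" using z by (intro image_eqI[of _ _ "(b, t)"]) auto
    qed
    ultimately show ?thesis by simp
  qed
  moreover have "?S = d" if d: "?S \<subseteq> d" "d \<subseteq> ?L" "connected d" for d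
  proof
    show "d \<subseteq> ?S"
    proof
      fix z assume zd: "z \<in> d"
      obtain a b where z: "z = (a, b)" by (cases z)
      have "is_interval (snd ` d)"
        using connected_continuous_image[OF continuous_on_snd[OF continuous_on_id] d(3)] is_interval_connected_1 by auto
      have "b \<le> tip_height p q"
      proof (rule th(4))
        fix b' assume b': "b' \<le> b"
        have "b' \<in> snd ` d"
        proof (cases "b' \<le> tip_height p q")
          case True
          then have "(\<beta> p q b', b') \<in> d" using d(1) th(2)[of b'] by auto
          then show ?thesis by force
        next
          case False
          have "(\<beta> p q (tip_height p q), tip_height p q) \<in> d" using d(1) th(2)[of "tip_height p q"] by auto
          then have "tip_height p q \<in> snd ` d" by force
          moreover have "b \<in> snd ` d" using zd z by force
          ultimately show ?thesis using \<open>is_interval (snd ` d)\<close> False b' unfolding is_interval_1 by (meson nle_le)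
        qed
        then obtain a' where "(a', b') \<in> d" by auto
        then show "\<alpha> p q b' \<le> \<beta> p q b'" using d(2) Lock_iff[OF q(1), of a' b' p] by auto
      qed
      moreover have "z \<in> ?L" using zd d(2) by blast
      ultimately show "z \<in> ?S" using Lock_iff[OF q(1)] z by auto
    qed
  qed (rule d(1))
  ultimately have comp: "?S \<in> components ?L"
    unfolding in_components_maximal using SL BC BS by blast
  show ?thesis
    unfolding Lock_I_def
  proof (rule the_equality)
    show "?S \<in> components ?L \<and> ?B \<subseteq> ?S" using comp BS by blast
    fix S' assume S': "S' \<in> components ?L \<and> ?B \<subseteq> S'"
    have "S' \<inter> ?S \<noteq> {}" using S' BC BS by blast
    then show "S' = ?S" using components_nonoverlap[of S' ?L ?S] S' comp by blast
  qed
qed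

lemma is_tip_iff:
  assumes q: "q > 0"
  shows "is_tip F (of_int p / real q) T \<longleftrightarrow>
    critical_value F \<le> snd T \<and> \<alpha> p q (snd T) = \<beta> p q (snd T) \<and> fst T = \<beta> p q (snd T)"
proof -
  have "(\<forall>a. \<alpha> p q b \<le> a \<and> a \<le> \<beta> p q b \<longleftrightarrow> a = c) \<longleftrightarrow> \<alpha> p q b = \<beta> p q b \<and> c = \<beta> p q b" for b c
  proof
    assume *: "\<forall>a. \<alpha> p q b \<le> a \<and> a \<le> \<beta> p q b \<longleftrightarrow> a = c"
    then have "\<alpha> p q b \<le> c" "c \<le> \<beta> p q b" by auto
    then show "\<alpha> p q b = \<beta> p q b \<and> c = \<beta> p q b"
      using *[rule_format, of "\<alpha> p q b"] *[rule_format, of "\<beta> p q b"] by auto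
  qed auto
  then show ?thesis unfolding is_tip_def Lock_iff[OF q] by blast
qed

lemma tip_I_eq:
  assumes q: "q > 0" "coprime p (int q)"
  shows "tip_I F (of_int p / real q) = (\<beta> p q (tip_height p q), tip_height p q)"
  unfolding tip_I_def is_tip_iff[OF q(1)] Lock_I_eq[OF q]
proof (rule the_equality)
  note th = tip_height[OF q]
  show "(critical_value F \<le> snd (\<beta> p q (tip_height p q), tip_height p q) \<and>
     \<alpha> p q (snd (\<beta> p q (tip_height p q), tip_height p q)) = \<beta> p q (snd (\<beta> p q (tip_height p q), tip_height p q)) \<and>
     fst (\<beta> p q (tip_height p q), tip_height p q) = \<beta> p q (snd (\<beta> p q (tip_height p q), tip_height p q))) \<and>
    (\<beta> p q (tip_height p q), tip_height p q) \<in> {(a, b). b \<le> tip_height p q \<and> \<alpha> p q b \<le> a \<and> a \<le> \<beta> p q b} \<and>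
    (\<forall>z\<in>{(a, b). b \<le> tip_height p q \<and> \<alpha> p q b \<le> a \<and> a \<le> \<beta> p q b}. snd z \<le> snd (\<beta> p q (tip_height p q), tip_height p q))"
    using th(1,3) by auto
  fix T assume T: "(critical_value F \<le> snd T \<and> \<alpha> p q (snd T) = \<beta> p q (snd T) \<and> fst T = \<beta> p q (snd T)) \<and>
    T \<in> {(a, b). b \<le> tip_height p q \<and> \<alpha> p q b \<le> a \<and> a \<le> \<beta> p q b} \<and>
    (\<forall>z\<in>{(a, b). b \<le> tip_height p q \<and> \<alpha> p q b \<le> a \<and> a \<le> \<beta> p q b}. snd z \<le> snd T)"
  have "(\<beta> p q (tip_height p q), tip_height p q) \<in> {(a, b). b \<le> tip_height p q \<and> \<alpha> p q b \<le> a \<and> a \<le> \<beta> p q b}"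
    using th(3) by simp
  then have "tip_height p q \<le> snd T" using T by force
  moreover have "snd T \<le> tip_height p q" using T by auto
  ultimately have "snd T = tip_height p q" by simp
  then show "T = (\<beta> p q (tip_height p q), tip_height p q)" using T by (simp add: prod_eq_iff)
qed

lemma infdist_critical_line: "infdist T (critical_line F) = \<bar>snd T - critical_value F\<bar>"
proof (rule antisym)
  have "infdist T (critical_line F) \<le> dist T (fst T, critical_value F)"
    by (rule infdist_le) (simp add: critical_line_def)
  then show "infdist T (critical_line F) \<le> \<bar>snd T - critical_value F\<bar>"
    by (simp add: dist_prod_def dist_real_def)
  have "\<bar>snd T - critical_value F\<bar> \<le> dist T z" if "z \<in> critical_line F" for z
    using dist_snd_le[of T z] that by (auto simp: critical_line_def dist_real_def)
  moreover have "critical_line F \<noteq> {}" by (auto simp: critical_line_def)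
  ultimately show "\<bar>snd T - critical_value F\<bar> \<le> infdist T (critical_line F)"
    unfolding infdist_def by (auto intro!: cINF_greatest)
qed

lemma frontier_Lock:
  assumes q: "q > 0" and b: "\<alpha> p q b \<le> \<beta> p q b"
  shows "(\<alpha> p q b, b) \<in> frontier (Lock F (of_int p / real q))"
    "(\<beta> p q b, b) \<in> frontier (Lock F (of_int p / real q))"
proof -
  let ?L = "Lock F (of_int p / real q)"
  have no: "(a, b) \<notin> interior ?L" if a: "\<And>s. s > 0 \<Longrightarrow> (a + c * s, b) \<notin> ?L" and c: "\<bar>c\<bar> = 1" for a c
  proof
    assume "(a, b) \<in> interior ?L"
    then obtain e where e: "e > 0" "ball (a, b) e \<subseteq> ?L" unfolding mem_interior by blast
    have "(a + c * (e / 2), b) \<in> ball (a, b) e"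
      using e(1) c by (simp add: dist_Pair_Pair dist_real_def abs_mult)
    then show False using a[of "e / 2"] e by auto
  qed
  have "(\<alpha> p q b, b) \<in> ?L" "(\<beta> p q b, b) \<in> ?L" using b Lock_iff[OF q] by auto
  moreover have "(\<alpha> p q b, b) \<notin> interior ?L" by (rule no[of _ "- 1"]) (use Lock_iff[OF q] in auto)
  moreover have "(\<beta> p q b, b) \<notin> interior ?L" by (rule no[of _ 1]) (use Lock_iff[OF q] in auto)
  ultimately show "(\<alpha> p q b, b) \<in> frontier ?L" "(\<beta> p q b, b) \<in> frontier ?L"
    unfolding frontier_def using closure_subset by auto
qed

end

subsection \<open>Farey fractions\<close>

lemma num_den: "den r > 0" "coprime (num r) (den r)" "r = Fract (num r) (den r)"
  using quotient_of_denom_pos'[of r] quotient_of_coprime[of r] quotient_of_div[of r]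
  by (cases "quotient_of r"; simp add: num_def den_def Fract_of_int_quotient)+

lemma num_den_Fract:
  assumes "coprime a b" "b > 0"
  shows "num (Fract a b) = a" "den (Fract a b) = b"
  using assms by (simp_all add: num_def den_def quotient_of_Fract normalize_stable)

lemma of_rat_num_den: "real_of_rat r = of_int (num r) / of_int (den r)"
  using num_den[of r] by (metis less_irrefl of_rat_rat)

lemma num_den_0_1: "num 0 = 0" "den 0 = 1" "num 1 = 1" "den 1 = 1"
  by (simp_all add: num_def den_def)

lemma farey_parents_det:
  assumes "farey_parents r s t"
  shows "num r = num s + num t" "den r = den s + den t" "num t * den s - num s * den t = 1"
proof -
  have st: "s < t" "\<bar>num s * den t - num t * den s\<bar> = 1" "r = farey_sum s t"
    using assms by (auto simp: farey_parents_def farey_neighbors_def)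
  have "Fract (num s) (den s) < Fract (num t) (den t)" using st(1) num_den(3) by metis
  then have "num s * den t < num t * den s" using num_den(1)[of s] num_den(1)[of t] by simp
  then show det: "num t * den s - num s * den t = 1" using st(2) by linarith
  then have "den s * (num s + num t) - (den s + den t) * num s = 1" by (simp add: algebra_simps)
  from det_coprime(1)[OF this] have cop: "coprime (num s + num t) (den s + den t)" .
  have pos: "den s + den t > 0" using num_den(1)[of s] num_den(1)[of t] by simp
  show "num r = num s + num t" "den r = den s + den t"
    unfolding st(3) farey_sum_def by (rule num_den_Fract[OF cop pos])+
qed

text \<open>The left parent \<open>y/x\<close> comes from the inverse \<open>x\<close> of
  \<open>p\<close> modulo \<open>q\<close>, and the right parent is the complement
  \<open>(p - y)/(q - x)\<close>.\<close>

lemma farey_parents_exist: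
  assumes "0 < r" "r < 1"
  shows "\<exists>s t. farey_parents r s t"
proof -
  define p q where "p = num r" and "q = den r"
  have q0: "q > 0" and cop: "coprime p q" and r: "r = Fract p q"
    using num_den[of r] by (auto simp: p_def q_def)
  have p: "0 < p" "p < q" using assms q0 unfolding r by (simp_all add: zero_less_Fract_iff Fract_less_one_iff)
  obtain u v where uv: "u * p + v * q = 1"
    using bezout_int[of p q] cop by (auto simp: coprime_iff_gcd_eq_1)
  define x where "x = u mod q"
  have "q dvd p * x - 1"
  proof -
    have "p * x - 1 = p * (u - (u div q) * q) - (u * p + v * q)" by (simp add: x_def uv minus_div_mult_eq_mod)
    also have "\<dots> = q * (- p * (u div q) - v)" by (simp add: algebra_simps)
    finally show ?thesis by simp
  qed
  then obtain y where y: "p * x - 1 = q * y" by (rule dvdE)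
  have "x \<noteq> 0"
  proof
    assume "x = 0"
    then have "q dvd 1" using y by (metis diff_0 dvd_minus_iff dvd_triv_left mult_zero_right)
    then show False using p by simp
  qed
  moreover have "0 \<le> x" "x < q" using q0 by (auto simp: x_def)
  ultimately have x: "0 < x" "x < q" by auto
  have "0 \<le> q * y" using y mult_pos_pos[OF p(1) x(1)] by linarith
  then have y0: "0 \<le> y" using q0 by (simp add: zero_le_mult_iff)
  have det: "p * x - q * y = 1" using y by simp
  \<comment> \<open>This says that the right parent is at most 1; it follows from the determinant
    and the range of \<open>x\<close>.\<close>
  have yq: "p - y \<le> q - x"
  proof -
    have "(q - p) * x \<le> (q - p) * (q - 1)" using p x by (intro mult_left_mono) auto
    then have "q * (x - y) \<le> q * (q - p) - (q - p) + 1" using det by (simp add: algebra_simps)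
    also have "\<dots> \<le> q * (q - p)" using p by simp
    finally have "x - y \<le> q - p" using q0 by simp
    then show ?thesis by simp
  qed
  have c1: "coprime y x" using det_coprime(1)[of p x y q] det by (simp add: algebra_simps coprime_commute)
  have c2: "coprime (p - y) (q - x)" using det_coprime(1)[of x "p - y" "q - x" y] det by (simp add: algebra_simps)
  have n: "num (Fract y x) = y" "den (Fract y x) = x" "num (Fract (p - y) (q - x)) = p - y" "den (Fract (p - y) (q - x)) = q - x"
    using num_den_Fract[OF c1 x(1)] num_den_Fract[OF c2] x by auto
  have "farey_parents r (Fract y x) (Fract (p - y) (q - x))"
    unfolding farey_parents_def farey_neighbors_def farey_sum_def n
  proof (intro conjI)
    show "0 \<le> Fract y x" using y0 x by (simp add: zero_le_Fract_iff)
    show "Fract y x < Fract (p - y) (q - x)" using x det by (simp add: algebra_simps)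
    show "Fract (p - y) (q - x) \<le> 1" using yq x by (simp add: Fract_le_one_iff)
    show "\<bar>y * (q - x) - (p - y) * x\<bar> = 1" using det by (simp add: algebra_simps)
    show "r = Fract (y + (p - y)) (x + (q - x))" by (simp add: r)
  qed
  then show ?thesis by blast
qed

text \<open>The denominators of two left parents solve the same congruence modulo
  \<open>den r\<close> and are both smaller than \<open>den r\<close>.\<close>

lemma farey_parents_unique:
  assumes "farey_parents r s t" "farey_parents r s' t'"
  shows "s = s'" "t = t'"
proof -
  have eq: "s = s'" if st: "farey_parents r s t" "farey_parents r s' t'" for s t s' t'
  proof -
    note d = farey_parents_det[OF st(1)] and d' = farey_parents_det[OF st(2)]
    have 1: "num r * den s - num s * den r = 1" using d by (simp add: algebra_simps)
    have 2: "num r * den s' - num s' * den r = 1" using d' by (simp add: algebra_simps)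
    have "num r * (den s - den s') = (num s - num s') * den r" using 1 2 by (simp add: algebra_simps)
    then have "den r dvd num r * (den s - den s')" by simp
    then have "den r dvd den s - den s'"
      using num_den(2)[of r] by (simp add: coprime_commute coprime_dvd_mult_right_iff)
    moreover have "\<bar>den s - den s'\<bar> < den r"
      using d(2) d'(2) num_den(1)[of s] num_den(1)[of s'] num_den(1)[of t] num_den(1)[of t'] by linarith
    ultimately have "den s = den s'" using zdvd_not_zless[of "\<bar>den s - den s'\<bar>" "den r"] by force
    moreover from this have "num s * den r = num s' * den r" using 1 2 unfolding \<open>den s = den s'\<close> by linarith
    then have "num s = num s'" using num_den(1)[of r] by simp
    ultimately show "s = s'" using num_den(3)[of s] num_den(3)[of s'] by simp
  qed
  show s: "s = s'" by (rule eq[OF assms])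
  have "num t = num t'" "den t = den t'"
    using farey_parents_det(1,2)[OF assms(1)] farey_parents_det(1,2)[OF assms(2)] s by auto
  then show "t = t'" using num_den(3)[of t] num_den(3)[of t'] by simp
qed

lemma left_parent_det:
  assumes "0 < r" "r \<le> 1"
  shows "num r * den (left_parent r) - num (left_parent r) * den r = 1"
proof (cases "r = 1")
  case True
  then show ?thesis by (simp add: left_parent_def num_den_0_1)
next
  case False
  obtain s t where st: "farey_parents r s t" using farey_parents_exist[of r] assms False by auto
  have "left_parent r = s"
    unfolding left_parent_def using False st farey_parents_unique(1) by (auto intro!: the_equality)
  then show ?thesis using farey_parents_det[OF st] by (simp add: algebra_simps)
qed

lemma right_parent_det:
  assumes "0 \<le> r" "r < 1"
  shows "num (right_parent r) * den r - num r * den (right_parent r) = 1"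
proof (cases "r = 0")
  case True
  then show ?thesis by (simp add: right_parent_def num_den_0_1)
next
  case False
  obtain s t where st: "farey_parents r s t" using farey_parents_exist[of r] assms False by auto
  have "right_parent r = t"
    unfolding right_parent_def using False st farey_parents_unique(2) by (auto intro!: the_equality)
  then show ?thesis using farey_parents_det[OF st] by (simp add: algebra_simps)
qed

section \<open>The claims for one Farey fraction and for an irrational limit\<close>

context N_family
begin

text \<open>The fractions approach \<open>r\<close> from below, so their tips accumulate at the left
  end of the locking interval of \<open>r\<close>.\<close>

lemma left_part:
  fixes r :: rat
  assumes r: "0 < r" "r \<le> 1"
  shows "\<exists>\<epsilon>>0. \<forall>j\<ge>1. \<forall>T. is_tip F (real_of_rat (left_fraction r j)) T \<longrightarrow> \<epsilon> \<le> infdist T (critical_line F)"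
    and "\<exists>z. z \<in> frontier (Lock F (real_of_rat r)) \<and> critical_value F < snd z \<and>
           (\<lambda>j. tip_I F (real_of_rat (left_fraction r (Suc j)))) \<longlonglongrightarrow> z \<and>
           monoseq (\<lambda>j. snd (tip_I F (real_of_rat (left_fraction r (Suc j)))))"
proof -
  define p q P Q where "p = num r" and "q = nat (den r)"
    and "P = num (left_parent r)" and "Q = nat (den (left_parent r))"
  have q: "q > 0" "int q = den r" and Q: "Q > 0" "int Q = den (left_parent r)"
    using num_den(1)[of r] num_den(1)[of "left_parent r"] by (auto simp: q_def Q_def)
  have det: "p * int Q - P * int q = 1"
    using left_parent_det[OF r] by (simp add: p_def P_def q(2) Q(2))
  define Pj Qj where "Pj j = P + int j * p" and "Qj j = Q + j * q" for j
  have Qj: "Qj j > 0" for j using Q by (simp add: Qj_def)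
  have detj: "p * int (Qj j) - Pj j * int q = 1" for j using det by (simp add: Pj_def Qj_def algebra_simps)
  have cop: "coprime (Pj j) (int (Qj j))" for j
  proof -
    have "int q * (- Pj j) - int (Qj j) * (- p) = 1" using detj[of j] by (simp add: algebra_simps)
    from det_coprime(1)[OF this] show ?thesis by simp
  qed
  have frac: "real_of_rat (left_fraction r j) = of_int (Pj j) / real (Qj j)" for j
  proof -
    have "left_fraction r j = Fract (Pj j) (int (Qj j))"
      by (simp add: left_fraction_def Pj_def Qj_def p_def P_def q(2) Q(2) algebra_simps)
    then show ?thesis using Qj[of j] by (simp add: of_rat_rat)
  qed
  have rr: "real_of_rat r = of_int p / real q"
    using of_rat_num_den[of r] unfolding p_def q(2)[symmetric] by simp
  obtain \<epsilon> where \<epsilon>: "\<epsilon> > 0" "\<And>P Q b. Q > 0 \<and> p * int Q - P * int q = 1 \<and> critical_value F \<le> b \<and> \<alpha> P Q b = \<beta> P Q b \<Longrightarrow> critical_value F + \<epsilon> \<le> b"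
    using tips_away_left[OF q(1), of p] by auto
  show "\<exists>\<epsilon>>0. \<forall>j\<ge>1. \<forall>T. is_tip F (real_of_rat (left_fraction r j)) T \<longrightarrow> \<epsilon> \<le> infdist T (critical_line F)"
  proof (intro exI[of _ \<epsilon>] conjI allI impI)
    fix j :: nat and T assume "is_tip F (real_of_rat (left_fraction r j)) T"
    then have "critical_value F \<le> snd T" "\<alpha> (Pj j) (Qj j) (snd T) = \<beta> (Pj j) (Qj j) (snd T)"
      unfolding frac is_tip_iff[OF Qj] by auto
    then have "critical_value F + \<epsilon> \<le> snd T" using Qj detj by (intro \<epsilon>(2)[of "Qj j" "Pj j"]) blast
    then show "\<epsilon> \<le> infdist T (critical_line F)" unfolding infdist_critical_line by linarith
  qed (rule \<epsilon>(1))
  \<comment> \<open>The convergence lemma starts its sequence at the base fraction itself, so the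
    fraction with index 1 is taken as the base.\<close>
  have det1: "p * int (Qj 1) - Pj 1 * int q = 1" by (rule detj)
  have step: "Pj 1 + int j * p = Pj (Suc j)" "Qj 1 + j * q = Qj (Suc j)" for j
    by (simp_all add: Pj_def Qj_def algebra_simps)
  obtain b where b: "critical_value F < b" "\<alpha> p q b \<le> \<beta> p q b"
    "(\<lambda>j. tip_height (Pj (Suc j)) (Qj (Suc j))) \<longlonglongrightarrow> b"
    "(\<lambda>j. \<beta> (Pj (Suc j)) (Qj (Suc j)) (tip_height (Pj (Suc j)) (Qj (Suc j)))) \<longlonglongrightarrow> \<alpha> p q b"
    "decseq (\<lambda>j. tip_height (Pj (Suc j)) (Qj (Suc j)))"
    by (rule tips_converge_left[OF q(1) Qj[of 1] det1, unfolded step])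
  show "\<exists>z. z \<in> frontier (Lock F (real_of_rat r)) \<and> critical_value F < snd z \<and>
           (\<lambda>j. tip_I F (real_of_rat (left_fraction r (Suc j)))) \<longlonglongrightarrow> z \<and>
           monoseq (\<lambda>j. snd (tip_I F (real_of_rat (left_fraction r (Suc j)))))"
    unfolding frac rr tip_I_eq[OF Qj cop]
    using frontier_Lock(1)[OF q(1) b(2)] b(1) tendsto_Pair[OF b(4,3)] decseq_imp_monoseq[OF b(5)]
    by (intro exI[of _ "(\<alpha> p q b, b)"]) simp
qed

lemma right_part:
  fixes r :: rat
  assumes r: "0 \<le> r" "r < 1"
  shows "\<exists>\<epsilon>>0. \<forall>j\<ge>1. \<forall>T. is_tip F (real_of_rat (right_fraction r j)) T \<longrightarrow> \<epsilon> \<le> infdist T (critical_line F)"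
    and "\<exists>z. z \<in> frontier (Lock F (real_of_rat r)) \<and> critical_value F < snd z \<and>
           (\<lambda>j. tip_I F (real_of_rat (right_fraction r (Suc j)))) \<longlonglongrightarrow> z \<and>
           monoseq (\<lambda>j. snd (tip_I F (real_of_rat (right_fraction r (Suc j)))))"
proof -
  define p q P Q where "p = num r" and "q = nat (den r)"
    and "P = num (right_parent r)" and "Q = nat (den (right_parent r))"
  have q: "q > 0" "int q = den r" and Q: "Q > 0" "int Q = den (right_parent r)"
    using num_den(1)[of r] num_den(1)[of "right_parent r"] by (auto simp: q_def Q_def)
  have det: "int q * P - int Q * p = 1"
    using right_parent_det[OF r] by (simp add: p_def P_def q(2) Q(2) mult.commute)
  define Pj Qj where "Pj j = P + int j * p" and "Qj j = Q + j * q" for j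
  have Qj: "Qj j > 0" for j using Q by (simp add: Qj_def)
  have detj: "int q * Pj j - int (Qj j) * p = 1" for j using det by (simp add: Pj_def Qj_def algebra_simps)
  have cop: "coprime (Pj j) (int (Qj j))" for j by (rule det_coprime(1)[OF detj])
  have frac: "real_of_rat (right_fraction r j) = of_int (Pj j) / real (Qj j)" for j
  proof -
    have "right_fraction r j = Fract (Pj j) (int (Qj j))"
      by (simp add: right_fraction_def Pj_def Qj_def p_def P_def q(2) Q(2) algebra_simps)
    then show ?thesis using Qj[of j] by (simp add: of_rat_rat)
  qed
  have rr: "real_of_rat r = of_int p / real q"
    using of_rat_num_den[of r] unfolding p_def q(2)[symmetric] by simp
  obtain \<epsilon> where \<epsilon>: "\<epsilon> > 0" "\<And>P Q b. Q > 0 \<and> int q * P - int Q * p = 1 \<and> critical_value F \<le> b \<and> \<alpha> P Q b = \<beta> P Q b \<Longrightarrow> critical_value F + \<epsilon> \<le> b"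
    using tips_away[OF q(1), of p] by auto
  show "\<exists>\<epsilon>>0. \<forall>j\<ge>1. \<forall>T. is_tip F (real_of_rat (right_fraction r j)) T \<longrightarrow> \<epsilon> \<le> infdist T (critical_line F)"
  proof (intro exI[of _ \<epsilon>] conjI allI impI)
    fix j :: nat and T assume "is_tip F (real_of_rat (right_fraction r j)) T"
    then have "critical_value F \<le> snd T" "\<alpha> (Pj j) (Qj j) (snd T) = \<beta> (Pj j) (Qj j) (snd T)"
      unfolding frac is_tip_iff[OF Qj] by auto
    then have "critical_value F + \<epsilon> \<le> snd T" using Qj detj by (intro \<epsilon>(2)[of "Qj j" "Pj j"]) blast
    then show "\<epsilon> \<le> infdist T (critical_line F)" unfolding infdist_critical_line by linarith
  qed (rule \<epsilon>(1))
  have det1: "int q * Pj 1 - int (Qj 1) * p = 1" by (rule detj)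
  have step: "Pj 1 + int j * p = Pj (Suc j)" "Qj 1 + j * q = Qj (Suc j)" for j
    by (simp_all add: Pj_def Qj_def algebra_simps)
  obtain b where b: "critical_value F < b" "\<alpha> p q b \<le> \<beta> p q b"
    "(\<lambda>j. tip_height (Pj (Suc j)) (Qj (Suc j))) \<longlonglongrightarrow> b"
    "(\<lambda>j. \<beta> (Pj (Suc j)) (Qj (Suc j)) (tip_height (Pj (Suc j)) (Qj (Suc j)))) \<longlonglongrightarrow> \<beta> p q b"
    "decseq (\<lambda>j. tip_height (Pj (Suc j)) (Qj (Suc j)))"
    by (rule tips_converge[OF q(1) Qj[of 1] det1, unfolded step])
  show "\<exists>z. z \<in> frontier (Lock F (real_of_rat r)) \<and> critical_value F < snd z \<and>
           (\<lambda>j. tip_I F (real_of_rat (right_fraction r (Suc j)))) \<longlonglongrightarrow> z \<and>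
           monoseq (\<lambda>j. snd (tip_I F (real_of_rat (right_fraction r (Suc j)))))"
    unfolding frac rr tip_I_eq[OF Qj cop]
    using frontier_Lock(2)[OF q(1) b(2)] b(1) tendsto_Pair[OF b(4,3)] decseq_imp_monoseq[OF b(5)]
    by (intro exI[of _ "(\<beta> p q b, b)"]) simp
qed

lemma irrational_part:
  assumes "\<omega> \<notin> \<rat>" and c: "(\<lambda>j. real_of_rat (c j)) \<longlonglongrightarrow> \<omega>"
  shows "(\<lambda>j. infdist (tip_I F (real_of_rat (c j))) (critical_line F)) \<longlonglongrightarrow> 0"
proof (rule tendstoI)
  fix e :: real assume "e > 0"
  then have "critical_value F + e > critical_value F" by simp
  from irrational_unlocked[OF assms(1) this] obtain d where d: "d > 0"
    "\<And>P Q. Q > 0 \<and> coprime P (int Q) \<and> \<bar>of_int P / real Q - \<omega>\<bar> < d \<Longrightarrow> tip_height P Q < critical_value F + e"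
    by auto
  have "\<forall>\<^sub>F j in sequentially. dist (real_of_rat (c j)) \<omega> < d" by (rule tendstoD[OF c d(1)])
  then show "\<forall>\<^sub>F j in sequentially. dist (infdist (tip_I F (real_of_rat (c j))) (critical_line F)) 0 < e"
  proof eventually_elim
    case (elim j)
    define P Q where "P = num (c j)" and "Q = nat (den (c j))"
    have Q: "Q > 0" "int Q = den (c j)" using num_den(1)[of "c j"] by (auto simp: Q_def)
    have cop: "coprime P (int Q)" using num_den(2)[of "c j"] by (simp add: P_def Q(2))
    have cj: "real_of_rat (c j) = of_int P / real Q"
      using of_rat_num_den[of "c j"] unfolding P_def Q(2)[symmetric] by simp
    have "tip_height P Q < critical_value F + e"
      using elim Q(1) cop unfolding cj dist_real_def by (intro d(2)) blast
    moreover have "critical_value F \<le> tip_height P Q" by (rule tip_height(1)[OF Q(1) cop])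
    ultimately show ?case unfolding cj tip_I_eq[OF Q(1) cop] infdist_critical_line by simp
  qed
qed

end

theorem theorem5:
  fixes F :: "real \<Rightarrow> real \<Rightarrow> real \<Rightarrow> real" and r :: rat
  assumes "class_N F" and "0 \<le> r" and "r \<le> 1"
  shows
    "(\<exists>\<epsilon>>0. \<forall>j\<ge>1. \<forall>T.
        (0 < r \<and> is_tip F (real_of_rat (left_fraction r j)) T \<longrightarrow>
           \<epsilon> \<le> infdist T (critical_line F)) \<and>
        (r < 1 \<and> is_tip F (real_of_rat (right_fraction r j)) T \<longrightarrow>
           \<epsilon> \<le> infdist T (critical_line F)))
   \<and> (0 < r \<longrightarrow>
        (\<exists>z. z \<in> frontier (Lock F (real_of_rat r)) \<and> critical_value F < snd z \<and>
           (\<lambda>j. tip_I F (real_of_rat (left_fraction r (Suc j)))) \<longlonglongrightarrow> z \<and>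
           monoseq (\<lambda>j. snd (tip_I F (real_of_rat (left_fraction r (Suc j)))))))
   \<and> (r < 1 \<longrightarrow>
        (\<exists>z. z \<in> frontier (Lock F (real_of_rat r)) \<and> critical_value F < snd z \<and>
           (\<lambda>j. tip_I F (real_of_rat (right_fraction r (Suc j)))) \<longlonglongrightarrow> z \<and>
           monoseq (\<lambda>j. snd (tip_I F (real_of_rat (right_fraction r (Suc j)))))))
   \<and> (\<forall>\<omega>::real. 0 < \<omega> \<and> \<omega> < 1 \<and> \<omega> \<notin> \<rat> \<longrightarrow>
        (\<forall>c. farey_path c \<omega> \<longrightarrow>
           (\<lambda>j. infdist (tip_I F (real_of_rat (c j))) (critical_line F)) \<longlonglongrightarrow> 0))"
proof -
  interpret N_family F by unfold_locales (rule assms(1))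
  have "\<exists>\<epsilon>>0. \<forall>j\<ge>1. \<forall>T. 0 < r \<and> is_tip F (real_of_rat (left_fraction r j)) T \<longrightarrow> \<epsilon> \<le> infdist T (critical_line F)"
  proof (cases "0 < r")
    case True
    then show ?thesis using left_part(1)[OF True assms(3)] by blast
  next
    case False
    \<comment> \<open>For \<open>r = 0\<close> there are no left fractions and any positive number
      will do.\<close>
    then show ?thesis by (intro exI[of _ 1]) simp
  qed
  then obtain \<epsilon>1 where \<epsilon>1: "\<epsilon>1 > 0" "\<And>j T. j \<ge> 1 \<Longrightarrow> 0 < r \<and> is_tip F (real_of_rat (left_fraction r j)) T \<Longrightarrow> \<epsilon>1 \<le> infdist T (critical_line F)"
    by blast
  have "\<exists>\<epsilon>>0. \<forall>j\<ge>1. \<forall>T. r < 1 \<and> is_tip F (real_of_rat (right_fraction r j)) T \<longrightarrow> \<epsilon> \<le> infdist T (critical_line F)"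
  proof (cases "r < 1")
    case True
    then show ?thesis using right_part(1)[OF assms(2) True] by blast
  next
    case False
    then show ?thesis by (intro exI[of _ 1]) simp
  qed
  then obtain \<epsilon>2 where \<epsilon>2: "\<epsilon>2 > 0" "\<And>j T. j \<ge> 1 \<Longrightarrow> r < 1 \<and> is_tip F (real_of_rat (right_fraction r j)) T \<Longrightarrow> \<epsilon>2 \<le> infdist T (critical_line F)"
    by blast
  show ?thesis
  proof (intro conjI impI allI)
    show "\<exists>\<epsilon>>0. \<forall>j\<ge>1. \<forall>T.
        (0 < r \<and> is_tip F (real_of_rat (left_fraction r j)) T \<longrightarrow> \<epsilon> \<le> infdist T (critical_line F)) \<and>
        (r < 1 \<and> is_tip F (real_of_rat (right_fraction r j)) T \<longrightarrow> \<epsilon> \<le> infdist T (critical_line F))"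
    proof (intro exI[of _ "min \<epsilon>1 \<epsilon>2"] conjI allI impI)
      show "min \<epsilon>1 \<epsilon>2 > 0" using \<epsilon>1(1) \<epsilon>2(1) by simp
      fix j :: nat and T assume j: "1 \<le> j"
      show "min \<epsilon>1 \<epsilon>2 \<le> infdist T (critical_line F)" if "0 < r \<and> is_tip F (real_of_rat (left_fraction r j)) T"
        using \<epsilon>1(2)[OF j that] by linarith
      show "min \<epsilon>1 \<epsilon>2 \<le> infdist T (critical_line F)" if "r < 1 \<and> is_tip F (real_of_rat (right_fraction r j)) T"
        using \<epsilon>2(2)[OF j that] by linarith
    qed
    show "0 < r \<Longrightarrow> \<exists>z. z \<in> frontier (Lock F (real_of_rat r)) \<and> critical_value F < snd z \<and>
           (\<lambda>j. tip_I F (real_of_rat (left_fraction r (Suc j)))) \<longlonglongrightarrow> z \<and>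
           monoseq (\<lambda>j. snd (tip_I F (real_of_rat (left_fraction r (Suc j)))))"
      by (rule left_part(2)[OF _ assms(3)])
    show "r < 1 \<Longrightarrow> \<exists>z. z \<in> frontier (Lock F (real_of_rat r)) \<and> critical_value F < snd z \<and>
           (\<lambda>j. tip_I F (real_of_rat (right_fraction r (Suc j)))) \<longlonglongrightarrow> z \<and>
           monoseq (\<lambda>j. snd (tip_I F (real_of_rat (right_fraction r (Suc j)))))"
      by (rule right_part(2)[OF assms(2)])
    show "(\<lambda>j. infdist (tip_I F (real_of_rat (c j))) (critical_line F)) \<longlonglongrightarrow> 0"
      if "0 < \<omega> \<and> \<omega> < 1 \<and> \<omega> \<notin> \<rat>" "farey_path c \<omega>" for \<omega> c
      using that by (intro irrational_part[of \<omega>]) (auto simp: farey_path_def)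
  qed
qed

end
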